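(* Let $c\in\mathbb N$, $1\le p\le\infty$, and let $g$ be a weight on $\mathbb Z^c$ satisfying (a)–(e). Then the subalgebra $\widetilde{\mathfrak S_{1,g}}(\mathbb R^c,\mathfrak S_1)=\{\lambda\mathbf 1+A:\ \lambda\in\mathbb C,\ A\in\mathfrak S_{1,g}(\mathbb R^c,\mathfrak S_1)\}$ is full (inverse-closed) in $\mathcal B\bigl(L_p(\mathbb R^c,\mathbb C)\bigr)$.
   Context: Weight conditions on $g:\mathbb Z^c\to(0,\infty)$: (a) $g(0)=1$; (b) $g(m+n)\le g(m)g(n)$; (c) $g(-n)=g(n)$; (d) $g\ge1$; (e) for each $t\in\mathbb Z^c$, $\sqrt[n]{g(nt)}\to1$ as $n\to\infty$. $l_{1,g}(\mathbb Z^c,\mathbb C)$: families $\beta$ with $\sum_m g(m)|\beta_m|<\infty$. A bounded operator on a Banach space $Y$ is nuclear if $Ay=\sum_i a_i(y)y_i$ with $a_i\in Y^*$, $y_i\in Y$, $\sum\|a_i\|\|y_i\|<\infty$; $\mathfrak S_1(Y)$ is the set of nuclear operators with norm $\|A\|_{\mathfrak S_1}=\inf\sum\|a_i\|\|y_i\|$. Let $\varphi:L_p(\mathbb R^c,\mathbb C)\to l_p\bigl(\mathbb Z^c,L_p([0,1)^c,\mathbb C)\bigr)$ be the isometric isomorphism $\varphi(x)=\{x_m\}_{m\in\mathbb Z^c}$, $x_m(t)=x(t+m)$, $t\in[0,1)^c$. $\mathfrak S_{1,g}(\mathbb R^c,\mathfrak S_1)$ ("locally nuclear operators") is the set of $A\in\mathcal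 B(L_p(\mathbb R^c,\mathbb C))$ such that $T=\varphi A\varphi^{-1}$ has the form $(Tz)_k=\sum_{m\in\mathbb Z^c}b_{km}z_{k-m}$ with $b_{km}\in\mathfrak S_1\bigl(L_p([0,1)^c,\mathbb C)\bigr)$ and $\|b_{km}\|_{\mathfrak S_1}\le\beta_m$ for all $k,m$, for some nonnegative $\beta\in l_{1,g}(\mathbb Z^c,\mathbb C)$. A unital subalgebra $\mathcal R$ of a unital algebra $\mathcal B$ is full if every element of $\mathcal R$ invertible in $\mathcal B$ has its inverse in $\mathcal R$. *)

theory Defs
  imports "HOL-Probability.Probability"
begin

definition Lp_set :: "'a measure \<Rightarrow> ennreal \<Rightarrow> ('a \<Rightarrow> complex) set" where
  "Lp_set M p = {f. f \<in> borel_measurable M \<and>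
     (if p = \<infinity> then esssup M (\<lambda>x. ereal (cmod (f x))) < \<infinity>
      else integrable M (\<lambda>x. cmod (f x) powr enn2real p))}"

definition lpnorm :: "'a measure \<Rightarrow> ennreal \<Rightarrow> ('a \<Rightarrow> complex) \<Rightarrow> real" where
  "lpnorm M p f = (if p = \<infinity> then real_of_ereal (esssup M (\<lambda>x. ereal (cmod (f x))))
      else (\<integral>x. cmod (f x) powr enn2real p \<partial>M) powr (1 / enn2real p))"

text \<open>Bounded linear operators on L_p(M), acting on representatives and well defined modulo
  a.e. equality.\<close>
definition bounded_op :: "'a measure \<Rightarrow> ennreal \<Rightarrow> (('a \<Rightarrow> complex) \<Rightarrow> ('a \<Rightarrow> complex)) \<Rightarrow> bool" where
  "bounded_op M p T \<longleftrightarrow>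
     (\<forall>f\<in>Lp_set M p. T f \<in> Lp_set M p) \<and>
     (\<forall>f\<in>Lp_set M p. \<forall>h\<in>Lp_set M p. (AE x in M. f x = h x) \<longrightarrow> (AE x in M. T f x = T h x)) \<and>
     (\<forall>f\<in>Lp_set M p. \<forall>h\<in>Lp_set M p. AE x in M. T (\<lambda>y. f y + h y) x = T f x + T h x) \<and>
     (\<forall>f\<in>Lp_set M p. \<forall>c. AE x in M. T (\<lambda>y. c * f y) x = c * T f x) \<and>
     (\<exists>K. \<forall>f\<in>Lp_set M p. lpnorm M p (T f) \<le> K * lpnorm M p f)"

definition bounded_fun :: "'a measure \<Rightarrow> ennreal \<Rightarrow> (('a \<Rightarrow> complex) \<Rightarrow> complex) \<Rightarrow> bool" where
  "bounded_fun M p a \<longleftrightarrow>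
     (\<forall>f\<in>Lp_set M p. \<forall>h\<in>Lp_set M p. (AE x in M. f x = h x) \<longrightarrow> a f = a h) \<and>
     (\<forall>f\<in>Lp_set M p. \<forall>h\<in>Lp_set M p. a (\<lambda>y. f y + h y) = a f + a h) \<and>
     (\<forall>f\<in>Lp_set M p. \<forall>c. a (\<lambda>y. c * f y) = c * a f) \<and>
     (\<exists>K. \<forall>f\<in>Lp_set M p. cmod (a f) \<le> K * lpnorm M p f)"

definition fun_norm :: "'a measure \<Rightarrow> ennreal \<Rightarrow> (('a \<Rightarrow> complex) \<Rightarrow> complex) \<Rightarrow> real" where
  "fun_norm M p a = Inf {K. 0 \<le> K \<and> (\<forall>f\<in>Lp_set M p. cmod (a f) \<le> K * lpnorm M p f)}"

definition nuclear_rep :: "'a measure \<Rightarrow> ennreal \<Rightarrow> (('a \<Rightarrow> complex) \<Rightarrow> ('a \<Rightarrow> complex))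
     \<Rightarrow> (nat \<Rightarrow> ('a \<Rightarrow> complex) \<Rightarrow> complex) \<Rightarrow> (nat \<Rightarrow> 'a \<Rightarrow> complex) \<Rightarrow> bool" where
  "nuclear_rep M p T a y \<longleftrightarrow>
     (\<forall>i. bounded_fun M p (a i) \<and> y i \<in> Lp_set M p) \<and>
     summable (\<lambda>i. fun_norm M p (a i) * lpnorm M p (y i)) \<and>
     (\<forall>f\<in>Lp_set M p.
        (\<lambda>n. lpnorm M p (\<lambda>t. T f t - (\<Sum>i<n. a i f * y i t))) \<longlonglongrightarrow> 0)"

definition nuclear :: "'a measure \<Rightarrow> ennreal \<Rightarrow> (('a \<Rightarrow> complex) \<Rightarrow> ('a \<Rightarrow> complex)) \<Rightarrow> bool" where
  "nuclear M p T \<longleftrightarrow> bounded_op M p T \<and> (\<exists>a y. nuclear_rep M p T a y)"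

definition nuclear_norm :: "'a measure \<Rightarrow> ennreal \<Rightarrow> (('a \<Rightarrow> complex) \<Rightarrow> ('a \<Rightarrow> complex)) \<Rightarrow> real" where
  "nuclear_norm M p T = Inf {(\<Sum>i. fun_norm M p (a i) * lpnorm M p (y i)) | a y. nuclear_rep M p T a y}"

definition lp_has_sum :: "'a measure \<Rightarrow> ennreal \<Rightarrow> ('i \<Rightarrow> 'a \<Rightarrow> complex) \<Rightarrow> ('a \<Rightarrow> complex) \<Rightarrow> bool" where
  "lp_has_sum M p F S \<longleftrightarrow>
     (\<forall>e>0. \<exists>F0. finite F0 \<and> (\<forall>G. finite G \<and> F0 \<subseteq> G \<longrightarrow>
        lpnorm M p (\<lambda>t. S t - (\<Sum>m\<in>G. F m t)) < e))"

definition unit_cube :: "(real^'c::finite) set" where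
  "unit_cube = {t. \<forall>i. 0 \<le> t$i \<and> t$i < 1}"

definition cube_measure :: "(real^'c::finite) measure" where
  "cube_measure = restrict_space lborel unit_cube"

definition int_vec :: "int^'c::finite \<Rightarrow> real^'c" where
  "int_vec m = (\<chi> i. real_of_int (m$i))"

text \<open>The m-th component of phi(x): x_m(t) = x(t+m), t in [0,1)^c.\<close>
definition piece :: "int^'c::finite \<Rightarrow> (real^'c \<Rightarrow> complex) \<Rightarrow> (real^'c \<Rightarrow> complex)" where
  "piece m x = (\<lambda>t. x (t + int_vec m))"

definition weight :: "(int^'c::finite \<Rightarrow> real) \<Rightarrow> bool" where
  "weight g \<longleftrightarrow>
     (\<forall>m. 0 < g m) \<and>
     g 0 = 1 \<and>
     (\<forall>m n. g (m + n) \<le> g m * g n) \<and>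
     (\<forall>n. g (- n) = g n) \<and>
     (\<forall>n. 1 \<le> g n) \<and>
     (\<forall>t. (\<lambda>n. root n (g (int n *s t))) \<longlonglongrightarrow> 1)"

definition locally_nuclear :: "ennreal \<Rightarrow> (int^'c::finite \<Rightarrow> real)
     \<Rightarrow> ((real^'c \<Rightarrow> complex) \<Rightarrow> (real^'c \<Rightarrow> complex)) \<Rightarrow> bool" where
  "locally_nuclear p g A \<longleftrightarrow>
     bounded_op lborel p A \<and>
     (\<exists>(b :: int^'c \<Rightarrow> int^'c \<Rightarrow> ((real^'c \<Rightarrow> complex) \<Rightarrow> (real^'c \<Rightarrow> complex)))
        (\<beta> :: int^'c \<Rightarrow> real).
        (\<forall>m. 0 \<le> \<beta> m) \<and> (\<lambda>m. g m * \<beta> m) summable_on UNIV \<and>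
        (\<forall>k m. nuclear cube_measure p (b k m) \<and> nuclear_norm cube_measure p (b k m) \<le> \<beta> m) \<and>
        (\<forall>x\<in>Lp_set lborel p. \<forall>k.
           lp_has_sum cube_measure p (\<lambda>m. b k m (piece (k - m) x)) (piece k (A x))))"

definition inverse_op :: "'a measure \<Rightarrow> ennreal \<Rightarrow> (('a \<Rightarrow> complex) \<Rightarrow> ('a \<Rightarrow> complex))
     \<Rightarrow> (('a \<Rightarrow> complex) \<Rightarrow> ('a \<Rightarrow> complex)) \<Rightarrow> bool" where
  "inverse_op M p T B \<longleftrightarrow> bounded_op M p B \<and>
     (\<forall>x\<in>Lp_set M p. AE t in M. B (T x) t = x t) \<and>
     (\<forall>x\<in>Lp_set M p. AE t in M. T (B x) t = x t)"

end

(*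
  The idea.  Identify L_p(R^c) with l_p(Z^c, L_p([0,1)^c)).  Let A have blocks whose nuclear norms are
  dominated by a sequence alpha with sum g*alpha finite, and let B be the inverse of lam + A.

  (1) The blocks of B are dominated in operator norm by some Gamma with sum g*Gamma finite.  Take
  Lipschitz cutoffs chi_k (k in Z^c) of scale N that form, up to a constant, a partition of unity.
  The commutator of A and chi_k is small, of size min(1, |d|/N) on the d-th diagonal, so
  U_k = |chi_k x| satisfies U <= C*V + C*(gamma conv U), where V_k = |chi_k (lam + A) x| and
  sum gamma tends to 0 as N grows.  This scalar convolution inequality is solved by a Neumann
  series.  The series converges in the weighted norm too: the growth condition (e) allows g to be
  replaced by an equivalent weight for which convolution with C*gamma is still a contraction.

  (2) Nuclear operators form an ideal, so BA is locally nuclear by (1), and B = 1/lam - (1/lam) BA if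
  lam is nonzero, while BA = 1 and B = B(BA) if lam = 0.
*)
theory Submission
  imports Defs
begin

text \<open>For \<open>p = \<infinity>\<close> truncations of \<open>x\<close> need not converge to
  \<open>x\<close> in norm, so a bounded operator is not determined by its blocks, and bounds on the
  blocks of \<open>B\<close> alone would not control \<open>B\<close>. Domination is therefore
  expressed by \<open>dominated_op\<close>, an inequality between the cell norms of
  \<open>B x\<close> and of \<open>x\<close> for every \<open>x\<close>. It composes by convolution
  and makes block expansions converge without a density argument.

  Invertibility enters (1) as a lower bound |x| <= C |(lam + A) x|, applied to chi_k x. Since C is
  given, all smallness has to come from the commutators. A diagonal contributes its Lipschitz factor
  times the number of cutoffs that meet a given one, divided by the overlap number of the partition.
  Both counts grow like N^c, and doubling of boxes bounds their ratio independently of N.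

  For the chosen N the weighted sum of gamma is finite but need not be small. Its plain sum makes
  the iteration converge; condition (e) transfers this to the weight.

  In (2) the nuclear expansions come from A alone: the functionals are kept and the vectors are
  moved by \<open>B\<close>, so operator-norm control of \<open>B\<close> suffices.\<close>

section \<open>The norm of L_p\<close>

text \<open>The norm bound by K, in a form in which p = \<infinity> and p finite can be treated together.\<close>
definition lp_bd :: "'a measure \<Rightarrow> ennreal \<Rightarrow> ('a \<Rightarrow> complex) \<Rightarrow> real \<Rightarrow> bool" where
  "lp_bd M p f K \<longleftrightarrow> f \<in> borel_measurable M \<and> 0 \<le> K \<and>
     (if p = \<infinity> then AE x in M. cmod (f x) \<le> K
      else (\<integral>\<^sup>+x. ennreal (cmod (f x) powr enn2real p) \<partial>M) \<le> ennreal (K powr enn2real p))"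

lemma enn2real_ge_1: "1 \<le> p \<Longrightarrow> p \<noteq> \<infinity> \<Longrightarrow> 1 \<le> enn2real p"
  using enn2real_mono[of 1 p] by (simp add: less_top)

text \<open>Two degenerate values occur for \<open>p = \<infinity>\<close>: the essential supremum
  is \<open>-\<infinity>\<close> over a null space and \<open>\<infinity>\<close> for a
  non-measurable function. \<open>real_of_ereal\<close> sends both to 0.\<close>

lemma lpnorm_nonneg: "0 \<le> lpnorm M p f"
proof (cases "p = \<infinity>")
  case True
  have *: "esssup M (\<lambda>x. ereal (cmod (f x))) = -\<infinity> \<or> 0 \<le> esssup M (\<lambda>x. ereal (cmod (f x)))"
  proof (cases "emeasure M (space M) = 0")
    case True
    then have "(\<lambda>x. ereal (cmod (f x))) \<in> borel_measurable M \<Longrightarrow> esssup M (\<lambda>x. ereal (cmod (f x))) = -\<infinity>"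
      using esssup_zero_space[of M "\<lambda>x. ereal (cmod (f x))"] by (auto simp: bot_ereal_def)
    then show ?thesis using esssup_non_measurable[of "\<lambda>x. ereal (cmod (f x))" M]
      by (cases "(\<lambda>x. ereal (cmod (f x))) \<in> borel_measurable M") (auto simp: top_ereal_def)
  next
    case False
    then have "esssup M (\<lambda>x. 0::ereal) = 0" by (rule esssup_const)
    moreover have "esssup M (\<lambda>x. 0::ereal) \<le> esssup M (\<lambda>x. ereal (cmod (f x)))"
      by (rule esssup_mono) auto
    ultimately show ?thesis by simp
  qed
  then show ?thesis using True by (auto simp: lpnorm_def intro: real_of_ereal_pos)
qed (simp add: lpnorm_def)

lemma lp_bd_imp:
  assumes p: "1 \<le> p" and b: "lp_bd M p f K"
  shows "f \<in> Lp_set M p" "lpnorm M p f \<le> K"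
proof -
  have f[measurable]: "f \<in> borel_measurable M" and K: "0 \<le> K" using b by (auto simp: lp_bd_def)
  have "f \<in> Lp_set M p \<and> lpnorm M p f \<le> K"
  proof (cases "p = \<infinity>")
    case True
    then have "AE x in M. ereal (cmod (f x)) \<le> ereal K" using b by (auto simp: lp_bd_def)
    then have le: "esssup M (\<lambda>x. ereal (cmod (f x))) \<le> ereal K" by (intro esssup_I) auto
    then have "real_of_ereal (esssup M (\<lambda>x. ereal (cmod (f x)))) \<le> K"
      using K by (cases "esssup M (\<lambda>x. ereal (cmod (f x)))") auto
    then show ?thesis using True le by (auto simp: Lp_set_def lpnorm_def)
  next
    case False
    note q = enn2real_ge_1[OF p False]
    have le: "(\<integral>\<^sup>+x. ennreal (cmod (f x) powr enn2real p) \<partial>M) \<le> ennreal (K powr enn2real p)"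
      using b False by (auto simp: lp_bd_def)
    have int: "integrable M (\<lambda>x. cmod (f x) powr enn2real p)"
      using le_less_trans[OF le ennreal_less_top] by (intro integrableI_nonneg) auto
    have "(\<integral>x. cmod (f x) powr enn2real p \<partial>M) \<le> K powr enn2real p"
      using le by (subst (asm) nn_integral_eq_integral[OF int]) auto
    then have "(\<integral>x. cmod (f x) powr enn2real p \<partial>M) powr (1/enn2real p) \<le> (K powr enn2real p) powr (1/enn2real p)"
      using q by (intro powr_mono2) auto
    also have "\<dots> = K" using K q by (simp add: powr_powr)
    finally show ?thesis using False int by (auto simp: Lp_set_def lpnorm_def)
  qed
  then show "f \<in> Lp_set M p" "lpnorm M p f \<le> K" by auto
qed

lemma Lp_measurable: "f \<in> Lp_set M p \<Longrightarrow> f \<in> borel_measurable M"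
  by (auto simp: Lp_set_def)

lemma nn_integral_lpnorm:
  assumes p: "1 \<le> p" "p \<noteq> \<infinity>" and b: "f \<in> Lp_set M p"
  shows "(\<integral>\<^sup>+x. ennreal (cmod (f x) powr enn2real p) \<partial>M) = ennreal (lpnorm M p f powr enn2real p)"
proof -
  note q = enn2real_ge_1[OF p]
  have int: "integrable M (\<lambda>x. cmod (f x) powr enn2real p)" using b p by (auto simp: Lp_set_def)
  show ?thesis
    using q p by (subst nn_integral_eq_integral[OF int]) (auto simp: lpnorm_def powr_powr)
qed

lemma lp_bd_lpnorm:
  assumes p: "1 \<le> p" and b: "f \<in> Lp_set M p"
  shows "lp_bd M p f (lpnorm M p f)"
proof -
  have f[measurable]: "f \<in> borel_measurable M" using b by (auto simp: Lp_set_def)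
  show ?thesis
  proof (cases "p = \<infinity>")
    case True
    let ?e = "esssup M (\<lambda>x. ereal (cmod (f x)))"
    have fin: "?e < \<infinity>" using b True by (auto simp: Lp_set_def)
    have ae: "AE x in M. ereal (cmod (f x)) \<le> ?e" by (rule esssup_AE)
    have "AE x in M. cmod (f x) \<le> real_of_ereal ?e"
      using ae fin by (auto elim!: eventually_mono) (cases ?e; auto)
    then show ?thesis using True lpnorm_nonneg[of M p f] by (auto simp: lp_bd_def lpnorm_def)
  next
    case False
    from nn_integral_lpnorm[OF p False b] show ?thesis using False lpnorm_nonneg[of M p f] by (auto simp: lp_bd_def)
  qed
qed

lemma lp_bd_mono:
  assumes p: "1 \<le> p" and "lp_bd M p h K" "AE x in M. cmod (f x) \<le> cmod (h x)" "f \<in> borel_measurable M" "K \<le> L"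
  shows "lp_bd M p f L"
proof (cases "p = \<infinity>")
  case True
  with assms show ?thesis by (auto simp: lp_bd_def elim: eventually_elim2)
next
  case False
  note q = enn2real_ge_1[OF p False]
  have "(\<integral>\<^sup>+x. ennreal (cmod (f x) powr enn2real p) \<partial>M) \<le> (\<integral>\<^sup>+x. ennreal (cmod (h x) powr enn2real p) \<partial>M)"
    using assms(3) q by (intro nn_integral_mono_AE) (auto elim!: eventually_mono intro!: ennreal_leI powr_mono2)
  also have "\<dots> \<le> ennreal (K powr enn2real p)" using assms False by (auto simp: lp_bd_def)
  also have "\<dots> \<le> ennreal (L powr enn2real p)"
    using assms q by (intro ennreal_leI powr_mono2) (auto simp: lp_bd_def)
  finally show ?thesis using assms False by (auto simp: lp_bd_def)
qed

lemma lpnorm_mono: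
  assumes "1 \<le> p" "h \<in> Lp_set M p" "AE x in M. cmod (f x) \<le> cmod (h x)" "f \<in> borel_measurable M"
  shows "f \<in> Lp_set M p" "lpnorm M p f \<le> lpnorm M p h"
  using lp_bd_imp[OF assms(1) lp_bd_mono[OF assms(1) lp_bd_lpnorm[OF assms(1,2)] assms(3,4) order_refl]]
  by auto

lemma lpnorm_cong:
  assumes "1 \<le> p" "h \<in> Lp_set M p" "AE x in M. f x = h x" "f \<in> borel_measurable M"
  shows "f \<in> Lp_set M p" "lpnorm M p f = lpnorm M p h"
proof -
  have "AE x in M. cmod (f x) \<le> cmod (h x)" using assms(3) by auto
  note 1 = lpnorm_mono[OF assms(1,2) this assms(4)]
  show "f \<in> Lp_set M p" by (rule 1(1))
  have "AE x in M. cmod (h x) \<le> cmod (f x)" using assms(3) by auto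
  from lpnorm_mono(2)[OF assms(1) 1(1) this Lp_measurable[OF assms(2)]] 1(2)
  show "lpnorm M p f = lpnorm M p h" by auto
qed

text \<open>\<open>powr_convex\<close> concerns positive arguments. If \<open>a\<close> or
  \<open>b\<close> is 0, the claim reduces to \<open>s powr q \<le> s\<close> for \<open>s\<close>
  in [0, 1].\<close>

lemma powr_convex_nonneg:
  fixes a b t q :: real
  assumes "0 \<le> a" "0 \<le> b" "0 \<le> t" "t \<le> 1" "1 \<le> q"
  shows "(t * a + (1 - t) * b) powr q \<le> t * a powr q + (1 - t) * b powr q"
proof -
  have *: "s powr q \<le> s" if "0 \<le> s" "s \<le> 1" for s :: real
    using that assms(5) powr_mono'[of 1 q s] by (cases "s = 0") auto
  consider "a = 0" | "b = 0" | "0 < a" "0 < b" using assms by fastforce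
  then show ?thesis
  proof cases
    case 1
    then show ?thesis using * assms by (auto simp: powr_mult intro!: mult_right_mono)
  next
    case 2
    then show ?thesis using * assms by (auto simp: powr_mult intro!: mult_right_mono)
  next
    case 3
    have "convex_on {0<..} (\<lambda>x. x powr q)" by (rule powr_convex[OF assms(5)])
    from convex_onD[OF this, of "1 - t" a b] 3 assms
    show ?thesis by (simp add: algebra_simps)
  qed
qed

lemma ennreal_linear_comb:
  "0 \<le> a \<Longrightarrow> 0 \<le> x \<Longrightarrow> 0 \<le> b \<Longrightarrow> 0 \<le> y \<Longrightarrow>
    ennreal (a * x + b * y) = ennreal a * ennreal x + ennreal b * ennreal y"
  by (simp add: ennreal_mult)

text \<open>Minkowski's inequality from convexity: for finite \<open>p\<close>, \<open>f + h\<close>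
  is \<open>K + L\<close> times the convex combination of \<open>f / K\<close> and
  \<open>h / L\<close> with weights \<open>K / (K + L)\<close> and \<open>L / (K + L)\<close>.
  Dividing by the bounds is the reason for asking that they be positive.\<close>

lemma lp_bd_add_pos:
  assumes p: "1 \<le> p" and f: "lp_bd M p f K" and h: "lp_bd M p h L" and pos: "0 < K" "0 < L"
  shows "lp_bd M p (\<lambda>x. f x + h x) (K + L)"
proof -
  have [measurable]: "f \<in> borel_measurable M" "h \<in> borel_measurable M" using f h by (auto simp: lp_bd_def)
  show ?thesis
  proof (cases "p = \<infinity>")
    case True
    have "AE x in M. cmod (f x + h x) \<le> K + L" if "AE x in M. cmod (f x) \<le> K" "AE x in M. cmod (h x) \<le> L"
      using that by eventually_elim (meson add_mono norm_triangle_le)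
    then show ?thesis using True f h pos by (auto simp: lp_bd_def)
  next
    case False
    define q where "q = enn2real p"
    have q: "1 \<le> q" using enn2real_ge_1[OF p False] by (simp add: q_def)
    let ?t = "K / (K + L)"
    let ?S = "(K + L) powr q"
    have pw: "cmod (f x + h x) powr q \<le> ?S * (?t / K powr q) * cmod (f x) powr q
        + ?S * ((1 - ?t) / L powr q) * cmod (h x) powr q" for x
    proof -
      have "cmod (f x + h x) powr q \<le> (cmod (f x) + cmod (h x)) powr q"
        using q by (intro powr_mono2 norm_triangle_ineq) auto
      also have "cmod (f x) + cmod (h x) = (K + L) * (?t * (cmod (f x) / K) + (1 - ?t) * (cmod (h x) / L))"
      proof -
        have "1 - ?t = L / (K + L)" using pos by (simp add: field_simps)
        then show ?thesis using pos by (simp add: distrib_left)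
      qed
      also have "\<dots> powr q = ?S * (?t * (cmod (f x) / K) + (1 - ?t) * (cmod (h x) / L)) powr q"
        using pos by (subst powr_mult) auto
      also have "\<dots> \<le> ?S * (?t * (cmod (f x) / K) powr q + (1 - ?t) * (cmod (h x) / L) powr q)"
        using pos q by (intro mult_left_mono powr_convex_nonneg) (auto simp: field_simps)
      also have "\<dots> = ?S * (?t / K powr q) * cmod (f x) powr q
        + ?S * ((1 - ?t) / L powr q) * cmod (h x) powr q"
        using pos by (simp add: powr_divide algebra_simps)
      finally show ?thesis .
    qed
    have t: "0 \<le> ?t" "?t \<le> 1" using pos by (auto simp: field_simps)
    have fI: "(\<integral>\<^sup>+x. ennreal (cmod (f x) powr q) \<partial>M) \<le> ennreal (K powr q)"
      and hI: "(\<integral>\<^sup>+x. ennreal (cmod (h x) powr q) \<partial>M) \<le> ennreal (L powr q)"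
      using f h False by (auto simp: lp_bd_def q_def)
    have "(\<integral>\<^sup>+x. ennreal (cmod (f x + h x) powr q) \<partial>M)
        \<le> (\<integral>\<^sup>+x. ennreal (?S * (?t / K powr q)) * ennreal (cmod (f x) powr q)
          + ennreal (?S * ((1 - ?t) / L powr q)) * ennreal (cmod (h x) powr q) \<partial>M)"
    proof (rule nn_integral_mono)
      fix x
      have "ennreal (cmod (f x + h x) powr q) \<le> ennreal (?S * (?t / K powr q) * cmod (f x) powr q
        + ?S * ((1 - ?t) / L powr q) * cmod (h x) powr q)" by (rule ennreal_leI[OF pw])
      also have "\<dots> = ennreal (?S * (?t / K powr q)) * ennreal (cmod (f x) powr q)
          + ennreal (?S * ((1 - ?t) / L powr q)) * ennreal (cmod (h x) powr q)"
        using t pos by (intro ennreal_linear_comb mult_nonneg_nonneg divide_nonneg_nonneg) auto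
      finally show "ennreal (cmod (f x + h x) powr q) \<le> \<dots>" .
    qed
    also have "\<dots> = ennreal (?S * (?t / K powr q)) * (\<integral>\<^sup>+x. ennreal (cmod (f x) powr q) \<partial>M)
          + ennreal (?S * ((1 - ?t) / L powr q)) * (\<integral>\<^sup>+x. ennreal (cmod (h x) powr q) \<partial>M)"
      by (subst nn_integral_add) (auto simp: nn_integral_cmult)
    also have "\<dots> \<le> ennreal (?S * (?t / K powr q)) * ennreal (K powr q)
          + ennreal (?S * ((1 - ?t) / L powr q)) * ennreal (L powr q)"
      by (intro add_mono mult_left_mono fI hI) auto
    also have "\<dots> = ennreal (?S * (?t / K powr q) * K powr q + ?S * ((1 - ?t) / L powr q) * L powr q)"
      using t pos by (intro ennreal_linear_comb[symmetric] mult_nonneg_nonneg divide_nonneg_nonneg) auto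
    also have "?S * (?t / K powr q) * K powr q + ?S * ((1 - ?t) / L powr q) * L powr q = ?S * ?t + ?S * (1 - ?t)"
      using pos by simp
    also have "\<dots> = ?S" by (simp add: right_diff_distrib)
    finally show ?thesis using False pos by (auto simp: lp_bd_def q_def)
  qed
qed

lemma lpnorm_add:
  assumes p: "1 \<le> p" and f: "f \<in> Lp_set M p" and h: "h \<in> Lp_set M p"
  shows "(\<lambda>x. f x + h x) \<in> Lp_set M p" "lpnorm M p (\<lambda>x. f x + h x) \<le> lpnorm M p f + lpnorm M p h"
proof -
  \<comment> \<open>Norms may vanish, so both bounds are enlarged by \<open>e\<close> to become
    positive; the excess is removed by letting \<open>e\<close> tend to 0.\<close>
  have *: "lp_bd M p (\<lambda>x. f x + h x) ((lpnorm M p f + e) + (lpnorm M p h + e))" if "0 < e" for e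
    using that lpnorm_nonneg[of M p f] lpnorm_nonneg[of M p h] f h
    by (intro lp_bd_add_pos p lp_bd_mono[OF p lp_bd_lpnorm[OF p f]] lp_bd_mono[OF p lp_bd_lpnorm[OF p h]])
      (auto intro: Lp_measurable)
  show "(\<lambda>x. f x + h x) \<in> Lp_set M p" using lp_bd_imp(1)[OF p *[of 1]] by simp
  show "lpnorm M p (\<lambda>x. f x + h x) \<le> lpnorm M p f + lpnorm M p h"
  proof (rule field_le_epsilon)
    fix e :: real assume "0 < e"
    then show "lpnorm M p (\<lambda>x. f x + h x) \<le> lpnorm M p f + lpnorm M p h + e"
      using lp_bd_imp(2)[OF p *[of "e/2"]] by simp
  qed
qed

lemma lp_bd_cmult:
  assumes p: "1 \<le> p" and f: "lp_bd M p f K"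
  shows "lp_bd M p (\<lambda>x. c * f x) (cmod c * K)"
proof (cases "p = \<infinity>")
  case True
  with f show ?thesis by (auto simp: lp_bd_def norm_mult elim!: eventually_mono intro!: mult_left_mono)
next
  case False
  have [measurable]: "f \<in> borel_measurable M" using f by (auto simp: lp_bd_def)
  have "(\<integral>\<^sup>+x. ennreal (cmod (c * f x) powr enn2real p) \<partial>M)
      = ennreal (cmod c powr enn2real p) * (\<integral>\<^sup>+x. ennreal (cmod (f x) powr enn2real p) \<partial>M)"
    by (subst nn_integral_cmult[symmetric]) (auto simp: norm_mult powr_mult ennreal_mult)
  also have "\<dots> \<le> ennreal (cmod c powr enn2real p) * ennreal (K powr enn2real p)"
    using f False by (intro mult_left_mono) (auto simp: lp_bd_def)
  finally show ?thesis using False f by (auto simp: lp_bd_def powr_mult ennreal_mult)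
qed

lemma lpnorm_cmult:
  assumes p: "1 \<le> p" and f: "f \<in> Lp_set M p"
  shows "(\<lambda>x. c * f x) \<in> Lp_set M p" "lpnorm M p (\<lambda>x. c * f x) = cmod c * lpnorm M p f"
proof -
  note * = lp_bd_imp[OF p lp_bd_cmult[OF p lp_bd_lpnorm[OF p f]], of c]
  show m: "(\<lambda>x. c * f x) \<in> Lp_set M p" by (rule *)
  have "cmod c * lpnorm M p f \<le> lpnorm M p (\<lambda>x. c * f x)"
  proof (cases "c = 0")
    case True then show ?thesis by (simp add: lpnorm_nonneg)
  next
    case False
    have "lpnorm M p (\<lambda>x. inverse c * (c * f x)) \<le> cmod (inverse c) * lpnorm M p (\<lambda>x. c * f x)"
      by (rule lp_bd_imp[OF p lp_bd_cmult[OF p lp_bd_lpnorm[OF p m]]])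
    also have "(\<lambda>x. inverse c * (c * f x)) = f" using False by (simp add: fun_eq_iff)
    finally have "lpnorm M p f \<le> cmod (inverse c) * lpnorm M p (\<lambda>x. c * f x)" .
    from mult_left_mono[OF this, of "cmod c"] False show ?thesis
      by (simp add: norm_inverse mult.assoc[symmetric])
  qed
  then show "lpnorm M p (\<lambda>x. c * f x) = cmod c * lpnorm M p f" using * by auto
qed

lemma Lp_zero: "1 \<le> p \<Longrightarrow> (\<lambda>x. 0) \<in> Lp_set M p"
  and lpnorm_zero: "1 \<le> p \<Longrightarrow> lpnorm M p (\<lambda>x. 0) = 0"
proof -
  assume p: "1 \<le> p"
  have "lp_bd M p (\<lambda>x. 0) 0" using enn2real_ge_1[OF p] by (auto simp: lp_bd_def)
  from lp_bd_imp[OF p this] lpnorm_nonneg[of M p "\<lambda>x. 0"]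
  show "(\<lambda>x. 0) \<in> Lp_set M p" "lpnorm M p (\<lambda>x. 0) = 0" by auto
qed

lemma lpnorm_diff:
  assumes p: "1 \<le> p" and f: "f \<in> Lp_set M p" and h: "h \<in> Lp_set M p"
  shows "(\<lambda>x. f x - h x) \<in> Lp_set M p" "lpnorm M p (\<lambda>x. f x - h x) \<le> lpnorm M p f + lpnorm M p h"
  using lpnorm_add[OF p f lpnorm_cmult(1)[OF p h, of "-1"]] lpnorm_cmult(2)[OF p h, of "-1"] by auto

lemma lpnorm_sum:
  assumes p: "1 \<le> p" and f: "\<And>i. i \<in> I \<Longrightarrow> f i \<in> Lp_set M p"
  shows "(\<lambda>x. \<Sum>i\<in>I. f i x) \<in> Lp_set M p" "lpnorm M p (\<lambda>x. \<Sum>i\<in>I. f i x) \<le> (\<Sum>i\<in>I. lpnorm M p (f i))"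
proof -
  have "(\<lambda>x. \<Sum>i\<in>I. f i x) \<in> Lp_set M p \<and> lpnorm M p (\<lambda>x. \<Sum>i\<in>I. f i x) \<le> (\<Sum>i\<in>I. lpnorm M p (f i))"
    using f
  proof (induction I rule: infinite_finite_induct)
    case (insert i I)
    then show ?case using lpnorm_add[OF p, of "f i" M "\<lambda>x. \<Sum>i\<in>I. f i x"] by auto
  qed (auto simp: Lp_zero p lpnorm_zero)
  then show "(\<lambda>x. \<Sum>i\<in>I. f i x) \<in> Lp_set M p" "lpnorm M p (\<lambda>x. \<Sum>i\<in>I. f i x) \<le> (\<Sum>i\<in>I. lpnorm M p (f i))"
    by auto
qed

section \<open>Decomposition into cells\<close>

text \<open>One measurable map encodes the partition into translated unit cubes:
  \<open>cell t = m\<close> means that \<open>t - int_vec m\<close> lies in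
  \<open>unit_cube\<close>.\<close>

definition cell :: "real^'c::finite \<Rightarrow> int^'c" where
  "cell t = (\<chi> i. \<lfloor>t $ i\<rfloor>)"

lemma cell_eq_0_iff: "t \<in> unit_cube \<longleftrightarrow> cell t = 0"
  by (auto simp: unit_cube_def cell_def vec_eq_iff floor_eq_iff)

lemma cell_add: "cell (t + int_vec m) = cell t + m"
  and cell_diff: "cell (t - int_vec m) = cell t - m"
  by (simp_all add: cell_def int_vec_def vec_eq_iff)

lemma unit_cube_sets [measurable]: "unit_cube \<in> sets borel"
  unfolding unit_cube_def by measurable

lemma space_cube_measure: "space cube_measure = unit_cube"
  by (simp add: cube_measure_def space_restrict_space)

lemma cell_measurable [measurable]: "cell \<in> borel \<rightarrow>\<^sub>M count_space UNIV"
proof (subst measurable_count_space_eq2_countable, safe)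
  fix a :: "int^'a"
  have "cell -` {a} = (\<lambda>t. t - int_vec a) -` unit_cube"
    by (auto simp: cell_eq_0_iff cell_diff)
  moreover have "(\<lambda>t. t - int_vec a) -` unit_cube \<inter> space borel \<in> sets borel" by measurable
  ultimately show "cell -` {a} \<inter> space borel \<in> sets borel" by simp
qed auto

lemma translate_measurable: "(\<lambda>t. t + a) \<in> lborel \<rightarrow>\<^sub>M lborel" for a :: "'a::euclidean_space"
  by simp

lemma lborel_translate: "distr lborel lborel (\<lambda>t. t + a) = lborel" for a :: "'a::euclidean_space"
proof -
  have "distr lborel lborel (\<lambda>t. t + a) = distr lborel borel ((+) a)"
    by (intro distr_cong) (auto simp: add.commute)
  then show ?thesis by (simp add: lborel_distr_plus)
qed

lemma nn_integral_lborel_translate: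
  "f \<in> borel_measurable lborel \<Longrightarrow> (\<integral>\<^sup>+t. f (t + a) \<partial>lborel) = (\<integral>\<^sup>+t. f t \<partial>lborel)" for a :: "'a::euclidean_space"
  by (subst (2) lborel_translate[symmetric, of a], subst nn_integral_distr) auto

lemma AE_lborel_translate: "AE t in lborel. P t \<Longrightarrow> AE t in lborel. P (t + a)" for a :: "'a::euclidean_space"
  by (rule AE_distrD[OF translate_measurable]) (subst lborel_translate)

text \<open>Tonelli, after splitting \<open>f t\<close> over the single index \<open>k\<close> with
  \<open>cell t = k\<close>; translation invariance then moves each cell to the unit cube.\<close>

lemma nn_integral_cells:
  assumes [measurable]: "f \<in> borel_measurable lborel"
  shows "(\<integral>\<^sup>+t. f t \<partial>lborel) = (\<integral>\<^sup>+k. (\<integral>\<^sup>+t. f (t + int_vec k) \<partial>cube_measure) \<partial>count_space UNIV)"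
proof -
  have "(\<integral>\<^sup>+t. f t \<partial>lborel) = (\<integral>\<^sup>+t. (\<integral>\<^sup>+k. f t * indicator {cell t} k \<partial>count_space UNIV) \<partial>lborel)"
    by (simp add: nn_integral_cmult)
  also have "\<dots> = (\<integral>\<^sup>+k. (\<integral>\<^sup>+t. f t * indicator {cell t} k \<partial>lborel) \<partial>count_space UNIV)"
  proof (rule nn_integral_count_space_nn_integral)
    fix i :: "int^'a"
    have "(\<lambda>t. if cell t = i then f t else 0) \<in> borel_measurable lborel"
      by measurable
    also have "(\<lambda>t. if cell t = i then f t else 0) = (\<lambda>t. f t * indicator {cell t} i)"
      by (auto simp: fun_eq_iff)
    finally show "(\<lambda>t. f t * indicator {cell t} i) \<in> borel_measurable lborel" .
  qed simp
  also have "\<dots> = (\<integral>\<^sup>+k. (\<integral>\<^sup>+t. f (t + int_vec k) \<partial>cube_measure) \<partial>count_space UNIV)"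
  proof (rule nn_integral_cong)
    fix k :: "int^'a"
    have *: "(\<lambda>t. if cell t = k then f t else 0) \<in> borel_measurable lborel" by measurable
    have "(\<integral>\<^sup>+t. f t * indicator {cell t} k \<partial>lborel) = (\<integral>\<^sup>+t. (if cell t = k then f t else 0) \<partial>lborel)"
      by (intro nn_integral_cong) auto
    also have "\<dots> = (\<integral>\<^sup>+t. (if cell (t + int_vec k) = k then f (t + int_vec k) else 0) \<partial>lborel)"
      by (rule nn_integral_lborel_translate[OF *, symmetric])
    also have "\<dots> = (\<integral>\<^sup>+t. f (t + int_vec k) * indicator unit_cube t \<partial>lborel)"
      by (intro nn_integral_cong) (auto simp: cell_add cell_eq_0_iff indicator_def)
    also have "\<dots> = (\<integral>\<^sup>+t. f (t + int_vec k) \<partial>cube_measure)"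
      unfolding cube_measure_def by (subst nn_integral_restrict_space) auto
    finally show "(\<integral>\<^sup>+t. f t * indicator {cell t} k \<partial>lborel) = (\<integral>\<^sup>+t. f (t + int_vec k) \<partial>cube_measure)" .
  qed
  finally show ?thesis .
qed

lemma AE_cube_iff: "(AE t in cube_measure. P t) \<longleftrightarrow> (AE t in lborel. cell t = 0 \<longrightarrow> P t)"
  unfolding cube_measure_def cell_eq_0_iff[symmetric] by (subst AE_restrict_space_iff) auto

lemma AE_cells: "(AE t in lborel. P t) \<longleftrightarrow> (\<forall>k. AE t in cube_measure. P (t + int_vec k))"
proof safe
  fix k assume "AE t in lborel. P t"
  from AE_lborel_translate[OF this, of "int_vec k"]
  show "AE t in cube_measure. P (t + int_vec k)" by (auto simp: AE_cube_iff)
next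
  assume *: "\<forall>k. AE t in cube_measure. P (t + int_vec k)"
  have "AE t in lborel. cell t = k \<longrightarrow> P t" for k
  proof -
    have "AE t in lborel. cell t = 0 \<longrightarrow> P (t + int_vec k)" using * by (auto simp: AE_cube_iff)
    from AE_lborel_translate[OF this, of "- int_vec k"] show ?thesis
      by (simp add: cell_diff)
  qed
  then have "AE t in lborel. \<forall>k. cell t = k \<longrightarrow> P t" by (subst AE_all_countable) auto
  then show "AE t in lborel. P t" by auto
qed

lemma piece_AE_cong: "AE t in lborel. x t = y t \<Longrightarrow> AE t in cube_measure. piece k x t = piece k y t"
  by (auto simp: AE_cells piece_def)

lemma piece_measurable [measurable (raw)]:
  assumes "x \<in> borel_measurable lborel" shows "piece k x \<in> borel_measurable cube_measure"
  unfolding cube_measure_def piece_def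
  by (rule measurable_restrict_space1) (use assms in measurable)

definition cell_norm :: "ennreal \<Rightarrow> (real^'c::finite \<Rightarrow> complex) \<Rightarrow> int^'c \<Rightarrow> real" where
  "cell_norm p x k = lpnorm cube_measure p (piece k x)"

lemma cell_norm_nonneg: "0 \<le> cell_norm p x k"
  by (simp add: cell_norm_def lpnorm_nonneg)

lemma lp_bd_piece:
  assumes p: "1 \<le> p" and x: "lp_bd lborel p x K"
  shows "lp_bd cube_measure p (piece k x) K"
proof (cases "p = \<infinity>")
  case True
  then have "AE t in lborel. cmod (x t) \<le> K" using x by (auto simp: lp_bd_def)
  then have "AE t in cube_measure. cmod (piece k x t) \<le> K" by (auto simp: AE_cells piece_def)
  then show ?thesis using True x by (auto simp: lp_bd_def intro: piece_measurable)
next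
  case False
  have [measurable]: "x \<in> borel_measurable lborel" using x by (auto simp: lp_bd_def)
  let ?f = "\<lambda>k. (\<integral>\<^sup>+t. ennreal (cmod (x (t + int_vec k)) powr enn2real p) \<partial>cube_measure)"
  have "?f k = (\<integral>\<^sup>+j. ?f k * indicator {k} j \<partial>count_space UNIV)"
    by (simp add: nn_integral_cmult)
  also have "\<dots> \<le> (\<integral>\<^sup>+j. ?f j \<partial>count_space UNIV)"
    by (intro nn_integral_mono) (auto simp: indicator_def)
  also have "\<dots> = (\<integral>\<^sup>+t. ennreal (cmod (x t) powr enn2real p) \<partial>lborel)"
    by (rule nn_integral_cells[symmetric]) measurable
  also have "\<dots> \<le> ennreal (K powr enn2real p)" using x False by (auto simp: lp_bd_def)
  finally have "(\<integral>\<^sup>+t. ennreal (cmod (piece k x t) powr enn2real p) \<partial>cube_measure) \<le> ennreal (K powr enn2real p)"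
    by (simp add: piece_def)
  moreover have "0 \<le> K" using x by (simp add: lp_bd_def)
  ultimately show ?thesis using False piece_measurable[of x k] by (simp add: lp_bd_def)
qed

lemma piece_Lp:
  assumes p: "1 \<le> p" and x: "x \<in> Lp_set lborel p"
  shows "piece k x \<in> Lp_set cube_measure p" "cell_norm p x k \<le> lpnorm lborel p x"
  using lp_bd_imp[OF p lp_bd_piece[OF p lp_bd_lpnorm[OF p x], of k]] by (auto simp: cell_norm_def)

text \<open>For finite \<open>p\<close> this is the isometry of phi. Membership in L_p is assumed of
  the pieces and not of \<open>x\<close>, so that the identity can also serve to prove that
  \<open>x\<close> is in L_p.\<close>

lemma nn_integral_cell_norm:
  assumes p: "1 \<le> p" "p \<noteq> \<infinity>" and x: "x \<in> borel_measurable lborel" "\<And>k. piece k x \<in> Lp_set cube_measure p"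
  shows "(\<integral>\<^sup>+k. ennreal (cell_norm p x k powr enn2real p) \<partial>count_space UNIV)
      = (\<integral>\<^sup>+t. ennreal (cmod (x t) powr enn2real p) \<partial>lborel)"
proof -
  note [measurable] = x(1)
  show ?thesis
    unfolding cell_norm_def nn_integral_lpnorm[OF p x(2), symmetric]
    by (subst nn_integral_cells, measurable) (simp add: piece_def)
qed

lemma lp_bd_cells:
  assumes p: "1 \<le> p" and x: "x \<in> borel_measurable lborel" "\<And>k. piece k x \<in> Lp_set cube_measure p"
    and K: "0 \<le> K" "p = \<infinity> \<Longrightarrow> (\<And>k. cell_norm p x k \<le> K)"
    "p \<noteq> \<infinity> \<Longrightarrow> (\<integral>\<^sup>+k. ennreal (cell_norm p x k powr enn2real p) \<partial>count_space UNIV) \<le> ennreal (K powr enn2real p)"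
  shows "lp_bd lborel p x K"
proof (cases "p = \<infinity>")
  case True
  have "AE t in cube_measure. cmod (piece k x t) \<le> K" for k
    using lp_bd_lpnorm[OF p x(2), of k] K(2)[OF True, of k] True
    by (auto simp: lp_bd_def cell_norm_def)
  then show ?thesis using True x K by (auto simp: lp_bd_def AE_cells piece_def)
next
  case False
  then show ?thesis using nn_integral_cell_norm[OF p False x] K x by (simp add: lp_bd_def)
qed

section \<open>Hoelder and Minkowski inequalities for cell norms\<close>

lemma Young_powr:
  fixes a b q :: real
  assumes "0 \<le> a" "0 \<le> b" "1 \<le> q"
  shows "a powr (q - 1) * b \<le> (1 - 1/q) * a powr q + (1/q) * b powr q"
proof (cases "a = 0 \<or> b = 0")
  case True
  then show ?thesis using assms by auto
next
  case False
  then have pos: "0 < a" "0 < b" using assms by auto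
  have "(a powr q) powr (1 - 1/q) * (b powr q) powr (1/q) \<le> (1 - 1/q) * a powr q + (1/q) * b powr q"
    using assms pos by (intro Youngs_inequality_0) auto
  also have "(a powr q) powr (1 - 1/q) = a powr (q - 1)"
    using assms by (simp add: powr_powr right_diff_distrib)
  also have "(b powr q) powr (1/q) = b" using assms by (simp add: powr_powr)
  finally show ?thesis .
qed

text \<open>Hoelder's inequality for q and q/(q - 1), written with \<open>q - 1\<close> so that the
  conjugate exponent never appears and \<open>q = 1\<close> is included. Young's inequality is
  applied to the normalised \<open>w / W\<close> and \<open>h / n\<close>; if \<open>n = 0\<close>,
  every \<open>h i\<close> vanishes.\<close>

lemma Hoelder_count_space:
  fixes w h :: "'i \<Rightarrow> real" and q W n :: real
  assumes q: "1 \<le> q" and nn: "\<And>i. 0 \<le> w i" "\<And>i. 0 \<le> h i" "0 < W" "0 \<le> n"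
    and w: "(\<integral>\<^sup>+i. ennreal (w i powr q) \<partial>count_space UNIV) \<le> ennreal (W powr q)"
    and h: "(\<integral>\<^sup>+i. ennreal (h i powr q) \<partial>count_space UNIV) \<le> ennreal (n powr q)"
  shows "(\<integral>\<^sup>+i. ennreal (w i powr (q - 1) * h i) \<partial>count_space UNIV) \<le> ennreal (W powr (q - 1) * n)"
proof (cases "n = 0")
  case True
  then have "(\<integral>\<^sup>+i. ennreal (h i powr q) \<partial>count_space UNIV) = 0" using h by simp
  then have "h i = 0" for i
    using nn(2)[of i] by (subst (asm) nn_integral_0_iff_AE) (auto simp: AE_count_space)
  then show ?thesis by simp
next
  case False
  then have n: "0 < n" using nn by simp
  let ?C = "W powr (q - 1) * n"
  have C: "0 < ?C" using n nn by simp
  have pw: "w i powr (q - 1) * h i \<le> (?C * (1 - 1/q) / W powr q) * w i powr q + (?C / q / n powr q) * h i powr q" for i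
  proof -
    have "w i powr (q - 1) * h i = ?C * ((w i / W) powr (q - 1) * (h i / n))"
      using n nn by (simp add: powr_divide)
    also have "\<dots> \<le> ?C * ((1 - 1/q) * (w i / W) powr q + (1/q) * (h i / n) powr q)"
      using C nn n q by (intro mult_left_mono Young_powr) auto
    also have "\<dots> = (?C * (1 - 1/q) / W powr q) * w i powr q + (?C / q / n powr q) * h i powr q"
      using n nn by (simp add: powr_divide algebra_simps)
    finally show ?thesis .
  qed
  have c: "0 \<le> ?C * (1 - 1/q) / W powr q" "0 \<le> ?C / q / n powr q"
    using q by (intro divide_nonneg_nonneg mult_nonneg_nonneg[OF less_imp_le[OF C]] less_imp_le[OF C] powr_ge_zero; simp)+
  have "(\<integral>\<^sup>+i. ennreal (w i powr (q - 1) * h i) \<partial>count_space UNIV)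
     \<le> (\<integral>\<^sup>+i. ennreal (?C * (1 - 1/q) / W powr q) * ennreal (w i powr q)
          + ennreal (?C / q / n powr q) * ennreal (h i powr q) \<partial>count_space UNIV)"
  proof (rule nn_integral_mono)
    fix i
    show "ennreal (w i powr (q - 1) * h i) \<le> ennreal (?C * (1 - 1/q) / W powr q) * ennreal (w i powr q)
          + ennreal (?C / q / n powr q) * ennreal (h i powr q)"
      unfolding ennreal_linear_comb[OF c(1) powr_ge_zero c(2) powr_ge_zero, symmetric]
      by (rule ennreal_leI[OF pw])
  qed
  also have "\<dots> = ennreal (?C * (1 - 1/q) / W powr q) * (\<integral>\<^sup>+i. ennreal (w i powr q) \<partial>count_space UNIV)
          + ennreal (?C / q / n powr q) * (\<integral>\<^sup>+i. ennreal (h i powr q) \<partial>count_space UNIV)"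
    by (simp add: nn_integral_add nn_integral_cmult)
  also have "\<dots> \<le> ennreal (?C * (1 - 1/q) / W powr q) * ennreal (W powr q) + ennreal (?C / q / n powr q) * ennreal (n powr q)"
    by (intro add_mono mult_left_mono w h) auto
  also have "\<dots> = ennreal ((?C * (1 - 1/q) / W powr q) * W powr q + (?C / q / n powr q) * n powr q)"
    by (rule ennreal_linear_comb[OF c(1) powr_ge_zero c(2) powr_ge_zero, symmetric])
  also have "(?C * (1 - 1/q) / W powr q) * W powr q + (?C / q / n powr q) * n powr q = ?C * (1 - 1/q) + ?C / q"
    using n nn by simp
  also have "\<dots> = ?C" by (simp add: right_diff_distrib)
  finally show ?thesis .
qed

lemma nn_integral_count_space_swap:
  fixes f :: "'i \<Rightarrow> 'j::countable \<Rightarrow> ennreal"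
  shows "(\<integral>\<^sup>+i. (\<integral>\<^sup>+j. f i j \<partial>count_space UNIV) \<partial>count_space UNIV)
       = (\<integral>\<^sup>+j. (\<integral>\<^sup>+i. f i j \<partial>count_space UNIV) \<partial>count_space UNIV)"
  by (rule nn_integral_count_space_nn_integral) auto

lemma nn_integral_count_space_reindex:
  assumes "bij f"
  shows "(\<integral>\<^sup>+i. F (f i) \<partial>count_space UNIV) = (\<integral>\<^sup>+j. F j \<partial>count_space UNIV)"
  by (rule nn_integral_bij_count_space[OF assms])

lemma bij_diff_right: "bij (\<lambda>s. s - k)" and bij_diff_left: "bij (\<lambda>s. k - s)" for k :: "'a::ab_group_add"
  by (rule bij_betw_byWitness[of _ "\<lambda>s. s + k"]; simp) (rule bij_betw_byWitness[of _ "\<lambda>s. k - s"]; simp)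

text \<open>Proved by duality: w is paired with its own (p - 1)-st power, and Hoelder's inequality is
  applied to each translated summand.\<close>
lemma Minkowski_cells:
  fixes w :: "real^'c::finite \<Rightarrow> complex" and v :: "'i::countable \<Rightarrow> real^'c \<Rightarrow> complex"
    and a :: "'i \<Rightarrow> ennreal" and d :: "'i \<Rightarrow> int^'c"
  assumes p: "1 \<le> p" and w: "w \<in> Lp_set lborel p" and v: "\<And>\<tau>. v \<tau> \<in> Lp_set lborel p"
    and le: "\<And>i. ennreal (cell_norm p w i) \<le> (\<integral>\<^sup>+\<tau>. a \<tau> * ennreal (cell_norm p (v \<tau>) (i - d \<tau>)) \<partial>count_space UNIV)"
  shows "ennreal (lpnorm lborel p w) \<le> (\<integral>\<^sup>+\<tau>. a \<tau> * ennreal (lpnorm lborel p (v \<tau>)) \<partial>count_space UNIV)" (is "_ \<le> ?S")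
\<comment> \<open>In the remaining case finiteness of \<open>?S\<close> gives a real bound for
  \<open>p = \<infinity>\<close>, and \<open>W > 0\<close> allows the factor
  \<open>W powr (q - 1)\<close> to be cancelled for finite \<open>p\<close>.\<close>
proof (cases "?S = \<infinity> \<or> lpnorm lborel p w = 0")
  case True
  then show ?thesis by auto
next
  case False
  define W where "W = lpnorm lborel p w"
  have W: "0 < W" using False lpnorm_nonneg[of lborel p w] by (auto simp: W_def)
  show ?thesis
  proof (cases "p = \<infinity>")
    case True
    have "ennreal (cell_norm p w i) \<le> ?S" for i
      by (rule order_trans[OF le]) (intro nn_integral_mono mult_left_mono ennreal_leI piece_Lp p v; simp)
    moreover obtain s where s: "0 \<le> s" "?S = ennreal s" using False by (cases ?S) auto
    ultimately have "cell_norm p w i \<le> s" for i by (simp add: ennreal_le_iff)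
    then have "lp_bd lborel p w s"
      using True s(1) by (intro lp_bd_cells p Lp_measurable[OF w] piece_Lp(1)[OF p w]) auto
    from ennreal_leI[OF lp_bd_imp(2)[OF p this]] show ?thesis unfolding s(2) .
  next
    case fin: False
    define q where "q = enn2real p"
    have q: "1 \<le> q" using enn2real_ge_1[OF p fin] by (simp add: q_def)
    have eq: "(\<integral>\<^sup>+k. ennreal (cell_norm p x k powr q) \<partial>count_space UNIV) = ennreal (lpnorm lborel p x powr q)"
      if x: "x \<in> Lp_set lborel p" for x
      unfolding q_def
      by (subst nn_integral_cell_norm[OF p fin Lp_measurable[OF x] piece_Lp(1)[OF p x]])
         (rule nn_integral_lpnorm[OF p fin x])
    have powr1: "r powr q = r powr (q - 1) * r" if "0 \<le> r" for r :: real
      using that powr_mult_base[of r "q - 1"] by (simp add: mult.commute)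
    let ?w = "\<lambda>i. cell_norm p w i"
    have hoe: "(\<integral>\<^sup>+i. ennreal (?w i powr (q - 1) * cell_norm p (v \<tau>) (i - d \<tau>)) \<partial>count_space UNIV)
        \<le> ennreal (W powr (q - 1) * lpnorm lborel p (v \<tau>))" for \<tau>
    proof (rule Hoelder_count_space[OF q _ _ W])
      show "(\<integral>\<^sup>+i. ennreal (cell_norm p (v \<tau>) (i - d \<tau>) powr q) \<partial>count_space UNIV) \<le> ennreal (lpnorm lborel p (v \<tau>) powr q)"
        using nn_integral_count_space_reindex[OF bij_diff_right, of "\<lambda>i. ennreal (cell_norm p (v \<tau>) i powr q)" "d \<tau>"] eq[OF v, of \<tau>]
        by simp
    qed (auto simp: cell_norm_nonneg lpnorm_nonneg eq[OF w] W_def)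
    have "ennreal (W powr (q - 1)) * ennreal W = (\<integral>\<^sup>+i. ennreal (?w i powr q) \<partial>count_space UNIV)"
      using eq[OF w] W by (simp add: ennreal_mult[symmetric] powr1 W_def)
    also have "\<dots> = (\<integral>\<^sup>+i. ennreal (?w i powr (q - 1)) * ennreal (?w i) \<partial>count_space UNIV)"
      by (simp add: ennreal_mult[symmetric] powr1 cell_norm_nonneg)
    also have "\<dots> \<le> (\<integral>\<^sup>+i. ennreal (?w i powr (q - 1)) * (\<integral>\<^sup>+\<tau>. a \<tau> * ennreal (cell_norm p (v \<tau>) (i - d \<tau>)) \<partial>count_space UNIV) \<partial>count_space UNIV)"
      by (intro nn_integral_mono mult_left_mono le) auto
    also have "\<dots> = (\<integral>\<^sup>+i. (\<integral>\<^sup>+\<tau>. a \<tau> * ennreal (?w i powr (q - 1) * cell_norm p (v \<tau>) (i - d \<tau>)) \<partial>count_space UNIV) \<partial>count_space UNIV)"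
      by (simp add: nn_integral_cmult[symmetric] ennreal_mult cell_norm_nonneg mult_ac)
    also have "\<dots> = (\<integral>\<^sup>+\<tau>. (\<integral>\<^sup>+i. a \<tau> * ennreal (?w i powr (q - 1) * cell_norm p (v \<tau>) (i - d \<tau>)) \<partial>count_space UNIV) \<partial>count_space UNIV)"
      by (rule nn_integral_count_space_swap)
    also have "\<dots> = (\<integral>\<^sup>+\<tau>. a \<tau> * (\<integral>\<^sup>+i. ennreal (?w i powr (q - 1) * cell_norm p (v \<tau>) (i - d \<tau>)) \<partial>count_space UNIV) \<partial>count_space UNIV)"
      by (simp add: nn_integral_cmult)
    also have "\<dots> \<le> (\<integral>\<^sup>+\<tau>. a \<tau> * ennreal (W powr (q - 1) * lpnorm lborel p (v \<tau>)) \<partial>count_space UNIV)"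
      by (intro nn_integral_mono mult_left_mono hoe) auto
    also have "\<dots> = ennreal (W powr (q - 1)) * ?S"
      by (simp add: nn_integral_cmult[symmetric] ennreal_mult lpnorm_nonneg mult_ac)
    finally show ?thesis
      using W by (subst (asm) ennreal_mult_le_mult_iff) (auto simp: W_def)
  qed
qed

lemma sum_le_nn_integral_count_space:
  assumes "finite J"
  shows "(\<Sum>i\<in>J. f i) \<le> (\<integral>\<^sup>+i. f i \<partial>count_space UNIV)"
proof -
  have "(\<Sum>i\<in>J. f i) = (\<integral>\<^sup>+i. f i * indicator J i \<partial>count_space UNIV)"
    using assms by (simp add: nn_integral_indicator_finite)
  also have "\<dots> \<le> (\<integral>\<^sup>+i. f i \<partial>count_space UNIV)"
    by (intro nn_integral_mono) (auto simp: indicator_def)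
  finally show ?thesis .
qed

lemma lpnorm_space_cong:
  assumes "1 \<le> p" "h \<in> Lp_set M p" "\<And>x. x \<in> space M \<Longrightarrow> f x = h x"
  shows "f \<in> Lp_set M p" "lpnorm M p f = lpnorm M p h"
proof -
  have "f \<in> borel_measurable M \<longleftrightarrow> h \<in> borel_measurable M" by (rule measurable_cong[OF assms(3)])
  then have "f \<in> borel_measurable M" using Lp_measurable[OF assms(2)] by simp
  moreover have "AE x in M. f x = h x" using assms(3) by (intro AE_I2) auto
  ultimately show "f \<in> Lp_set M p" "lpnorm M p f = lpnorm M p h" using lpnorm_cong[OF assms(1,2)] by auto
qed

lemma space_cube_iff: "t \<in> space cube_measure \<longleftrightarrow> cell t = 0"
  by (simp add: space_cube_measure cell_eq_0_iff)

lemma cell_norm_AE_cong: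
  assumes "1 \<le> p" "x \<in> Lp_set lborel p" "y \<in> borel_measurable lborel" "AE t in lborel. y t = x t"
  shows "cell_norm p y k = cell_norm p x k"
  unfolding cell_norm_def
  by (rule lpnorm_cong(2)[OF assms(1) piece_Lp(1)[OF assms(1,2)] piece_AE_cong[OF assms(4)] piece_measurable[OF assms(3)]])

lemma cell_norm_cmult:
  assumes "1 \<le> p" "x \<in> Lp_set lborel p"
  shows "cell_norm p (\<lambda>t. c * x t) k = cmod c * cell_norm p x k"
  using lpnorm_cmult(2)[OF assms(1) piece_Lp(1)[OF assms(1,2)], of c k]
  by (simp add: cell_norm_def piece_def)

section \<open>Functions living on one cell, and multipliers constant on cells\<close>

definition embed_cell :: "int^'c::finite \<Rightarrow> (real^'c \<Rightarrow> complex) \<Rightarrow> (real^'c \<Rightarrow> complex)" where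
  "embed_cell s z = (\<lambda>t. if cell t = s then z (t - int_vec s) else 0)"

text \<open>\<open>piece\<close> returns a function on the whole space of which only the values on
  the unit cube matter, hence the restriction to \<open>cell t = 0\<close>.\<close>

lemma piece_embed: "cell t = 0 \<Longrightarrow> piece k (embed_cell s z) t = (if k = s then z t else 0)"
  by (auto simp: piece_def embed_cell_def cell_add)

lemma embed_measurable:
  assumes "z \<in> borel_measurable cube_measure"
  shows "embed_cell s z \<in> borel_measurable lborel"
proof -
  have "(\<lambda>u. indicator unit_cube u *\<^sub>R z u) \<in> borel_measurable lborel"
    using assms unfolding cube_measure_def by (subst (asm) borel_measurable_restrict_space_iff) auto
  then have "(\<lambda>t. indicator unit_cube (t - int_vec s) *\<^sub>R z (t - int_vec s)) \<in> borel_measurable lborel"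
    by (rule measurable_compose[rotated]) simp
  also have "(\<lambda>t. indicator unit_cube (t - int_vec s) *\<^sub>R z (t - int_vec s)) = embed_cell s z"
    by (auto simp: fun_eq_iff embed_cell_def indicator_def cell_eq_0_iff cell_diff)
  finally show ?thesis .
qed

lemma cell_norm_embed:
  assumes p: "1 \<le> p" and z: "z \<in> Lp_set cube_measure p"
  shows "piece k (embed_cell s z) \<in> Lp_set cube_measure p"
    "cell_norm p (embed_cell s z) k = (if k = s then lpnorm cube_measure p z else 0)"
proof -
  have "piece k (embed_cell s z) \<in> Lp_set cube_measure p \<and>
     lpnorm cube_measure p (piece k (embed_cell s z)) = (if k = s then lpnorm cube_measure p z else 0)"
  proof (cases "k = s")
    case True
    then show ?thesis using lpnorm_space_cong[OF p z, of "piece k (embed_cell s z)"]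
      by (auto simp: space_cube_iff piece_embed)
  next
    case False
    then show ?thesis using lpnorm_space_cong[OF p Lp_zero[OF p], of cube_measure "piece k (embed_cell s z)"]
      by (auto simp: space_cube_iff piece_embed lpnorm_zero[OF p])
  qed
  then show "piece k (embed_cell s z) \<in> Lp_set cube_measure p"
    "cell_norm p (embed_cell s z) k = (if k = s then lpnorm cube_measure p z else 0)"
    by (auto simp: cell_norm_def)
qed

lemma embed_Lp:
  assumes p: "1 \<le> p" and z: "z \<in> Lp_set cube_measure p"
  shows "embed_cell s z \<in> Lp_set lborel p" "lpnorm lborel p (embed_cell s z) \<le> lpnorm cube_measure p z"
proof -
  let ?n = "lpnorm cube_measure p z"
  have "lp_bd lborel p (embed_cell s z) ?n"
  proof (rule lp_bd_cells[OF p embed_measurable[OF Lp_measurable[OF z]] cell_norm_embed(1)[OF p z] lpnorm_nonneg])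
    show "cell_norm p (embed_cell s z) k \<le> ?n" for k
      using lpnorm_nonneg[of cube_measure p z] by (simp add: cell_norm_embed(2)[OF p z])
    assume "p \<noteq> \<infinity>"
    have "(\<integral>\<^sup>+k. ennreal (cell_norm p (embed_cell s z) k powr enn2real p) \<partial>count_space UNIV)
        = (\<integral>\<^sup>+k. ennreal (?n powr enn2real p) * indicator {s} k \<partial>count_space UNIV)"
      by (intro nn_integral_cong) (auto simp: cell_norm_embed(2)[OF p z])
    then show "(\<integral>\<^sup>+k. ennreal (cell_norm p (embed_cell s z) k powr enn2real p) \<partial>count_space UNIV) \<le> ennreal (?n powr enn2real p)"
      by (simp add: nn_integral_cmult)
  qed
  from lp_bd_imp[OF p this] show "embed_cell s z \<in> Lp_set lborel p" "lpnorm lborel p (embed_cell s z) \<le> ?n" by auto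
qed

definition cell_mult :: "(int^'c::finite \<Rightarrow> real) \<Rightarrow> (real^'c \<Rightarrow> complex) \<Rightarrow> (real^'c \<Rightarrow> complex)" where
  "cell_mult \<psi> x = (\<lambda>t. of_real (\<psi> (cell t)) * x t)"

lemma piece_cell_mult: "cell t = 0 \<Longrightarrow> piece k (cell_mult \<psi> x) t = of_real (\<psi> k) * piece k x t"
  by (auto simp: piece_def cell_mult_def cell_add)

lemma cell_mult_Lp:
  assumes p: "1 \<le> p" and x: "x \<in> Lp_set lborel p" and B: "\<And>k. \<bar>\<psi> k\<bar> \<le> B"
  shows "cell_mult \<psi> x \<in> Lp_set lborel p"
proof (rule lpnorm_mono(1)[OF p lpnorm_cmult(1)[OF p x, of "of_real B"]])
  have [measurable]: "x \<in> borel_measurable lborel" using Lp_measurable[OF x] .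
  show "cell_mult \<psi> x \<in> borel_measurable lborel" unfolding cell_mult_def by measurable
  have "0 \<le> B" using B[of 0] by simp
  then show "AE t in lborel. cmod (cell_mult \<psi> x t) \<le> cmod (complex_of_real B * x t)"
    using B by (auto simp: cell_mult_def norm_mult intro!: mult_right_mono)
qed

lemma cell_norm_cell_mult:
  assumes p: "1 \<le> p" and x: "x \<in> Lp_set lborel p"
  shows "cell_norm p (cell_mult \<psi> x) k = \<bar>\<psi> k\<bar> * cell_norm p x k"
proof -
  have "lpnorm cube_measure p (piece k (cell_mult \<psi> x)) = lpnorm cube_measure p (\<lambda>t. of_real (\<psi> k) * piece k x t)"
    by (rule lpnorm_space_cong[OF p lpnorm_cmult(1)[OF p piece_Lp(1)[OF p x]]])
       (simp add: space_cube_iff piece_cell_mult)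
  then show ?thesis by (simp add: cell_norm_def lpnorm_cmult(2)[OF p piece_Lp(1)[OF p x]])
qed

section \<open>Bounded operators and domination of cell norms\<close>

lemma bounded_op_Lp: "bounded_op M p T \<Longrightarrow> f \<in> Lp_set M p \<Longrightarrow> T f \<in> Lp_set M p"
  by (simp add: bounded_op_def)

lemma bounded_op_cong: "bounded_op M p T \<Longrightarrow> f \<in> Lp_set M p \<Longrightarrow> h \<in> Lp_set M p \<Longrightarrow>
    AE x in M. f x = h x \<Longrightarrow> AE x in M. T f x = T h x"
  by (simp add: bounded_op_def)

lemma bounded_op_add: "bounded_op M p T \<Longrightarrow> f \<in> Lp_set M p \<Longrightarrow> h \<in> Lp_set M p \<Longrightarrow>
    AE x in M. T (\<lambda>y. f y + h y) x = T f x + T h x"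
  by (simp add: bounded_op_def)

lemma bounded_op_cmult: "bounded_op M p T \<Longrightarrow> f \<in> Lp_set M p \<Longrightarrow>
    AE x in M. T (\<lambda>y. c * f y) x = c * T f x"
  by (simp add: bounded_op_def)

lemma bounded_op_bound:
  assumes "bounded_op M p T"
  obtains K where "0 \<le> K" "\<And>f. f \<in> Lp_set M p \<Longrightarrow> lpnorm M p (T f) \<le> K * lpnorm M p f"
proof -
  obtain K where K: "\<forall>f\<in>Lp_set M p. lpnorm M p (T f) \<le> K * lpnorm M p f"
    using assms by (auto simp: bounded_op_def)
  have "lpnorm M p (T f) \<le> max K 0 * lpnorm M p f" if "f \<in> Lp_set M p" for f
    using bspec[OF K that] mult_right_mono[OF _ lpnorm_nonneg[of M p f], of K "max K 0"] by simp
  then show ?thesis using that[of "max K 0"] by auto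
qed

lemma bounded_op_zero: "1 \<le> p \<Longrightarrow> bounded_op M p T \<Longrightarrow> AE x in M. T (\<lambda>y. 0) x = 0"
  using bounded_op_cmult[of M p T "\<lambda>y. 0" 0] by (simp add: Lp_zero)

lemma bounded_op_diff:
  assumes p: "1 \<le> p" and T: "bounded_op M p T" and f: "f \<in> Lp_set M p" and h: "h \<in> Lp_set M p"
  shows "AE x in M. T (\<lambda>y. f y - h y) x = T f x - T h x"
  using bounded_op_add[OF T f lpnorm_cmult(1)[OF p h, of "-1"]] bounded_op_cmult[OF T h, of "-1"]
  by eventually_elim simp

lemma bounded_op_sum:
  assumes p: "1 \<le> p" and T: "bounded_op M p T" and f: "\<And>i. i \<in> I \<Longrightarrow> f i \<in> Lp_set M p"
  shows "AE x in M. T (\<lambda>y. \<Sum>i\<in>I. f i y) x = (\<Sum>i\<in>I. T (f i) x)"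
  using f
proof (induction I rule: infinite_finite_induct)
  case (insert i I)
  have "AE x in M. T (\<lambda>y. f i y + (\<Sum>i\<in>I. f i y)) x = T (f i) x + T (\<lambda>y. \<Sum>i\<in>I. f i y) x"
    using insert.prems by (intro bounded_op_add[OF T] lpnorm_sum p) auto
  moreover have "AE x in M. T (\<lambda>y. \<Sum>i\<in>I. f i y) x = (\<Sum>i\<in>I. T (f i) x)" using insert by auto
  ultimately show ?case
    by eventually_elim (use insert.hyps in simp)
qed (auto intro: bounded_op_zero[OF p T])

text \<open>Domination by the convolution operator with kernel \<alpha>. It is demanded of all
  \<open>x\<close> and not only of those supported in one cell, because for
  \<open>p = \<infinity>\<close> the latter would not imply the former. Values in
  \<open>ennreal\<close> separate the inequality from questions of summability.\<close>

definition dominated_op :: "ennreal \<Rightarrow> ((real^'c::finite \<Rightarrow> complex) \<Rightarrow> (real^'c \<Rightarrow> complex)) \<Rightarrow> (int^'c \<Rightarrow> ennreal) \<Rightarrow> bool" where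
  "dominated_op p D \<alpha> \<longleftrightarrow> (\<forall>x\<in>Lp_set lborel p. \<forall>k.
     ennreal (cell_norm p (D x) k) \<le> (\<integral>\<^sup>+l. \<alpha> (k - l) * ennreal (cell_norm p x l) \<partial>count_space UNIV))"

section \<open>Norms of functionals and remainders of nuclear expansions\<close>

lemma fun_norm_bound:
  assumes a: "bounded_fun M p a" and f: "f \<in> Lp_set M p"
  shows "cmod (a f) \<le> fun_norm M p a * lpnorm M p f" "0 \<le> fun_norm M p a"
proof -
  let ?S = "{K. 0 \<le> K \<and> (\<forall>f\<in>Lp_set M p. cmod (a f) \<le> K * lpnorm M p f)}"
  obtain K where K: "\<forall>f\<in>Lp_set M p. cmod (a f) \<le> K * lpnorm M p f"
    using a unfolding bounded_fun_def by blast
  define L where "L = max K 0"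
  have L: "cmod (a f) \<le> L * lpnorm M p f" if "f \<in> Lp_set M p" for f
    using bspec[OF K that] mult_right_mono[OF _ lpnorm_nonneg[of M p f], of K L] by (simp add: L_def)
  have "0 \<le> L" by (simp add: L_def)
  then have ne: "L \<in> ?S" using L by blast
  have "?S \<noteq> {}" using ne by blast
  then show "0 \<le> fun_norm M p a" unfolding fun_norm_def by (rule cInf_greatest) blast
  show "cmod (a f) \<le> fun_norm M p a * lpnorm M p f"
  proof (cases "lpnorm M p f = 0")
    case True
    then show ?thesis using L[OF f] by simp
  next
    case False
    then have pos: "0 < lpnorm M p f" using lpnorm_nonneg[of M p f] by simp
    have "cmod (a f) / lpnorm M p f \<le> fun_norm M p a" unfolding fun_norm_def
    proof (rule cInf_greatest)
      show "?S \<noteq> {}" using ne by blast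
      fix K assume "K \<in> ?S"
      then have "cmod (a f) \<le> K * lpnorm M p f" using f by blast
      then show "cmod (a f) / lpnorm M p f \<le> K" using pos by (simp add: divide_le_eq)
    qed
    then show ?thesis using pos by (simp add: divide_le_eq)
  qed
qed

text \<open>For \<open>n\<close> beyond \<open>I\<close> the error splits into the remainder after
  \<open>n\<close> terms, which tends to 0, and the terms below \<open>n\<close> outside
  \<open>I\<close>. Arbitrary finite \<open>I\<close> are allowed because the ideal property
  rearranges several expansions into one series, whose partial sums cut each of them in an arbitrary
  finite set. With \<open>I\<close> empty this bounds the operator norm by the sum of the
  expansion.\<close>

lemma nuclear_rep_remainder:
  assumes p: "1 \<le> p" and rep: "nuclear_rep M p T a y" and f: "f \<in> Lp_set M p" "T f \<in> Lp_set M p" and I: "finite I"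
  shows "ennreal (lpnorm M p (\<lambda>t. T f t - (\<Sum>i\<in>I. a i f * y i t)))
    \<le> (\<integral>\<^sup>+i. indicator (- I) i * ennreal (fun_norm M p (a i) * lpnorm M p (y i)) \<partial>count_space UNIV) * ennreal (lpnorm M p f)" (is "_ \<le> ?R")
proof -
  have a: "bounded_fun M p (a i)" and y: "y i \<in> Lp_set M p" for i using rep by (auto simp: nuclear_rep_def)
  let ?e = "\<lambda>n. lpnorm M p (\<lambda>t. T f t - (\<Sum>i<n. a i f * y i t))"
  let ?n = "\<lambda>i. fun_norm M p (a i) * lpnorm M p (y i)"
  have nn: "0 \<le> ?n i" for i using fun_norm_bound(2)[OF a f(1), of i] lpnorm_nonneg[of M p "y i"] by simp
  have lim: "?e \<longlonglongrightarrow> 0" using rep f by (auto simp: nuclear_rep_def)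
  have ev: "ennreal (lpnorm M p (\<lambda>t. T f t - (\<Sum>i\<in>I. a i f * y i t))) \<le> ennreal (?e n) + ?R" if I: "I \<subseteq> {..<n}" for n
  proof -
    have yL: "(\<lambda>t. a i f * y i t) \<in> Lp_set M p" for i by (rule lpnorm_cmult(1)[OF p y])
    have "lpnorm M p (\<lambda>t. T f t - (\<Sum>i\<in>I. a i f * y i t))
       = lpnorm M p (\<lambda>t. (T f t - (\<Sum>i<n. a i f * y i t)) + (\<Sum>i\<in>{..<n}-I. a i f * y i t))"
      by (simp add: sum_diff[OF _ I])
    also have "\<dots> \<le> ?e n + lpnorm M p (\<lambda>t. \<Sum>i\<in>{..<n}-I. a i f * y i t)"
      by (intro lpnorm_add p lpnorm_diff lpnorm_sum f yL)
    also have "lpnorm M p (\<lambda>t. \<Sum>i\<in>{..<n}-I. a i f * y i t) \<le> (\<Sum>i\<in>{..<n}-I. lpnorm M p (\<lambda>t. a i f * y i t))"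
      by (intro lpnorm_sum p yL)
    also have "\<dots> \<le> (\<Sum>i\<in>{..<n}-I. ?n i * lpnorm M p f)"
    proof (rule sum_mono)
      fix i
      show "lpnorm M p (\<lambda>t. a i f * y i t) \<le> ?n i * lpnorm M p f"
        using mult_right_mono[OF fun_norm_bound(1)[OF a f(1)] lpnorm_nonneg[of M p "y i"], of i]
        by (simp add: lpnorm_cmult(2)[OF p y] mult_ac)
    qed
    also have "\<dots> = (\<Sum>i\<in>{..<n}-I. ?n i) * lpnorm M p f" by (simp add: sum_distrib_right)
    finally have "ennreal (lpnorm M p (\<lambda>t. T f t - (\<Sum>i\<in>I. a i f * y i t))) \<le> ennreal (?e n + (\<Sum>i\<in>{..<n}-I. ?n i) * lpnorm M p f)"
      by (intro ennreal_leI) simp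
    also have "\<dots> = ennreal (?e n) + (\<Sum>i\<in>{..<n}-I. indicator (- I) i * ennreal (?n i)) * ennreal (lpnorm M p f)"
    proof -
      have "ennreal (\<Sum>i\<in>{..<n}-I. ?n i) = (\<Sum>i\<in>{..<n}-I. ennreal (?n i))"
        using nn by (intro sum_ennreal[symmetric]) auto
      also have "\<dots> = (\<Sum>i\<in>{..<n}-I. indicator (- I) i * ennreal (?n i))"
        by (intro sum.cong) auto
      finally show ?thesis
        using ennreal_linear_comb[of 1 "?e n" "\<Sum>i\<in>{..<n}-I. ?n i" "lpnorm M p f"] nn
        by (simp add: lpnorm_nonneg sum_nonneg)
    qed
    also have "\<dots> \<le> ennreal (?e n) + ?R"
      by (intro add_left_mono mult_right_mono sum_le_nn_integral_count_space) auto
    finally show ?thesis .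
  qed
  have "(\<lambda>n. ennreal (?e n) + ?R) \<longlonglongrightarrow> ennreal 0 + ?R"
    by (intro tendsto_add tendsto_const tendsto_ennrealI lim)
  moreover have "eventually (\<lambda>n. ennreal (lpnorm M p (\<lambda>t. T f t - (\<Sum>i\<in>I. a i f * y i t))) \<le> ennreal (?e n) + ?R) sequentially"
  proof -
    obtain n0 where "I \<subseteq> {..<n0}" using finite_nat_iff_bounded I by blast
    then show ?thesis by (intro eventually_sequentiallyI[of n0] ev) auto
  qed
  ultimately show ?thesis using tendsto_lowerbound[of "\<lambda>n. ennreal (?e n) + ?R" "ennreal 0 + ?R" sequentially] by simp
qed

section \<open>Summation over countable index sets\<close>

lemma summable_on_nn_integral_iff:
  fixes f :: "'i \<Rightarrow> real"
  assumes "\<And>i. 0 \<le> f i"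
  shows "f summable_on UNIV \<longleftrightarrow> (\<integral>\<^sup>+i. ennreal (f i) \<partial>count_space UNIV) < \<infinity>"
proof -
  have "f summable_on UNIV \<longleftrightarrow> (\<lambda>i. norm (f i)) summable_on UNIV"
    using assms by simp
  also have "\<dots> \<longleftrightarrow> integrable (count_space UNIV) f"
    using abs_summable_equivalent[of f UNIV] unfolding Infinite_Set_Sum.abs_summable_on_def .
  also have "\<dots> \<longleftrightarrow> (\<integral>\<^sup>+i. ennreal (f i) \<partial>count_space UNIV) < \<infinity>"
    using assms by (simp add: integrable_iff_bounded)
  finally show ?thesis .
qed

text \<open>The tail is small off every superset of \<open>F\<close>, which is the form of
  convergence that \<open>lp_has_sum\<close> asks for. The proof is dominated convergence along an
  enumeration of the index type.\<close>

lemma nn_integral_count_space_tail: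
  fixes u :: "'i::countable \<Rightarrow> ennreal"
  assumes fin: "(\<integral>\<^sup>+i. u i \<partial>count_space UNIV) < \<infinity>" and e: "0 < e"
  obtains F where "finite F" "\<And>G. F \<subseteq> G \<Longrightarrow> (\<integral>\<^sup>+i. indicator (- G) i * u i \<partial>count_space UNIV) < e"
proof -
  let ?f = "\<lambda>n i. indicator {i. n \<le> to_nat i} i * u i"
  have "(\<lambda>n. \<integral>\<^sup>+i. ?f n i \<partial>count_space UNIV) \<longlonglongrightarrow> (\<integral>\<^sup>+i. (0::ennreal) \<partial>count_space (UNIV::'i set))"
  proof (rule nn_integral_dominated_convergence[where w = u])
    show "AE i in count_space UNIV. (\<lambda>n. ?f n i) \<longlonglongrightarrow> 0"
    proof (rule AE_I2)
      fix i
      have "eventually (\<lambda>n. ?f n i = 0) sequentially"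
        by (rule eventually_sequentiallyI[of "Suc (to_nat i)"]) (auto simp: indicator_def)
      then show "(\<lambda>n. ?f n i) \<longlonglongrightarrow> 0" by (rule tendsto_eventually)
    qed
  qed (use fin in \<open>auto simp: indicator_def\<close>)
  then have "eventually (\<lambda>n. (\<integral>\<^sup>+i. ?f n i \<partial>count_space UNIV) < e) sequentially"
    using e by (intro order_tendstoD) auto
  then obtain n where n: "(\<integral>\<^sup>+i. ?f n i \<partial>count_space UNIV) < e" by (auto simp: eventually_sequentially)
  show ?thesis
  proof
    show "finite {i::'i. to_nat i < n}"
      using finite_vimageI[of "{..<n}" "to_nat :: 'i \<Rightarrow> nat"] by (simp add: vimage_def)
    fix G :: "'i set" assume "{i. to_nat i < n} \<subseteq> G"
    then have "(\<integral>\<^sup>+i. indicator (- G) i * u i \<partial>count_space UNIV) \<le> (\<integral>\<^sup>+i. ?f n i \<partial>count_space UNIV)"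
      by (intro nn_integral_mono) (auto simp: indicator_def not_less[symmetric])
    then show "(\<integral>\<^sup>+i. indicator (- G) i * u i \<partial>count_space UNIV) < e" using n by simp
  qed
qed

section \<open>Convolution of nonnegative families, and weights\<close>

definition conv :: "('a::ab_group_add \<Rightarrow> ennreal) \<Rightarrow> ('a \<Rightarrow> ennreal) \<Rightarrow> 'a \<Rightarrow> ennreal" where
  "conv f h k = (\<integral>\<^sup>+l. f (k - l) * h l \<partial>count_space UNIV)"

lemma conv_assoc:
  fixes f h u :: "'a::{countable,ab_group_add} \<Rightarrow> ennreal"
  shows "conv f (conv h u) k = conv (conv f h) u k"
proof -
  have "conv f (conv h u) k = (\<integral>\<^sup>+l. \<integral>\<^sup>+s. f (k - l) * (h (l - s) * u s) \<partial>count_space UNIV \<partial>count_space UNIV)"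
    by (simp add: conv_def nn_integral_cmult)
  also have "\<dots> = (\<integral>\<^sup>+s. \<integral>\<^sup>+l. f (k - l) * (h (l - s) * u s) \<partial>count_space UNIV \<partial>count_space UNIV)"
    by (rule nn_integral_count_space_swap)
  also have "\<dots> = (\<integral>\<^sup>+s. \<integral>\<^sup>+l. f (k - (l + s)) * (h ((l + s) - s) * u s) \<partial>count_space UNIV \<partial>count_space UNIV)"
  proof (rule nn_integral_cong)
    fix s
    show "(\<integral>\<^sup>+l. f (k - l) * (h (l - s) * u s) \<partial>count_space UNIV)
        = (\<integral>\<^sup>+l. f (k - (l + s)) * (h ((l + s) - s) * u s) \<partial>count_space UNIV)"
      using nn_integral_count_space_reindex[OF bij_diff_right, of "\<lambda>l. f (k - l) * (h (l - s) * u s)" "- s"] by simp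
  qed
  also have "\<dots> = conv (conv f h) u k"
    unfolding conv_def
  proof (rule nn_integral_cong)
    fix s
    show "(\<integral>\<^sup>+l. f (k - (l + s)) * (h ((l + s) - s) * u s) \<partial>count_space UNIV)
      = (\<integral>\<^sup>+l. f (k - s - l) * h l \<partial>count_space UNIV) * u s"
      by (subst nn_integral_multc[symmetric]) (simp_all add: algebra_simps)
  qed
  finally show ?thesis .
qed

lemma conv_mono: "(\<And>l. h l \<le> u l) \<Longrightarrow> conv f h k \<le> conv f u k"
  unfolding conv_def by (intro nn_integral_mono mult_left_mono) auto

text \<open>Two weights are kept apart for two uses. With both equal to \<open>g\<close> this is the
  algebra property of weighted l_1; in the Neumann series \<open>G\<close> is an equivalent weight
  and \<open>w\<close> the factor by which a translation can enlarge it.\<close>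

lemma weight_conv:
  fixes G w f h :: "'a::{countable,ab_group_add} \<Rightarrow> ennreal"
  assumes "\<And>m n. G (m + n) \<le> w m * G n"
  shows "(\<integral>\<^sup>+k. G k * conv f h k \<partial>count_space UNIV)
    \<le> (\<integral>\<^sup>+k. w k * f k \<partial>count_space UNIV) * (\<integral>\<^sup>+k. G k * h k \<partial>count_space UNIV)"
proof -
  have "(\<integral>\<^sup>+k. G k * conv f h k \<partial>count_space UNIV) = (\<integral>\<^sup>+k. \<integral>\<^sup>+l. G k * (f (k - l) * h l) \<partial>count_space UNIV \<partial>count_space UNIV)"
    by (simp add: conv_def nn_integral_cmult)
  also have "\<dots> = (\<integral>\<^sup>+l. \<integral>\<^sup>+k. G k * (f (k - l) * h l) \<partial>count_space UNIV \<partial>count_space UNIV)"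
    by (rule nn_integral_count_space_swap)
  also have "\<dots> \<le> (\<integral>\<^sup>+l. \<integral>\<^sup>+k. (w (k - l) * f (k - l)) * (G l * h l) \<partial>count_space UNIV \<partial>count_space UNIV)"
  proof (intro nn_integral_mono)
    fix l k
    have "G k * (f (k - l) * h l) \<le> (w (k - l) * G l) * (f (k - l) * h l)"
      using assms[of "k - l" l] by (intro mult_right_mono) auto
    then show "G k * (f (k - l) * h l) \<le> (w (k - l) * f (k - l)) * (G l * h l)" by (simp add: mult_ac)
  qed
  also have "\<dots> = (\<integral>\<^sup>+l. (\<integral>\<^sup>+k. w k * f k \<partial>count_space UNIV) * (G l * h l) \<partial>count_space UNIV)"
    using nn_integral_count_space_reindex[OF bij_diff_right, of "\<lambda>k. w k * f k"]
    by (simp add: nn_integral_multc)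
  also have "\<dots> = (\<integral>\<^sup>+k. w k * f k \<partial>count_space UNIV) * (\<integral>\<^sup>+k. G k * h k \<partial>count_space UNIV)"
    by (simp add: nn_integral_cmult)
  finally show ?thesis .
qed

lemma weight_submult: "weight g \<Longrightarrow> ennreal (g (m + n)) \<le> ennreal (g m) * ennreal (g n)"
  and weight_ge_1: "weight g \<Longrightarrow> 1 \<le> g n"
proof -
  assume g: "weight g"
  then have "0 \<le> g m" for m by (auto simp: weight_def intro: less_imp_le)
  then show "ennreal (g (m + n)) \<le> ennreal (g m) * ennreal (g n)"
    using g by (simp add: ennreal_mult[symmetric] weight_def ennreal_leI)
qed (auto simp: weight_def)

lemma weight_le_sum: "weight g \<Longrightarrow> (\<integral>\<^sup>+k. f k \<partial>count_space UNIV) \<le> (\<integral>\<^sup>+k. ennreal (g k) * f k \<partial>count_space UNIV)"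
proof (rule nn_integral_mono)
  fix k assume "weight g"
  from ennreal_leI[OF weight_ge_1[OF this, of k]]
  show "f k \<le> ennreal (g k) * f k" using mult_right_mono[of 1 "ennreal (g k)" "f k"] by simp
qed

section \<open>Majorants of a locally nuclear operator\<close>

lemma locally_nuclear_reps:
  assumes g: "weight g" and A: "locally_nuclear p g A"
  obtains b a y \<alpha> where "(\<integral>\<^sup>+m. ennreal (g m) * \<alpha> m \<partial>count_space UNIV) < \<infinity>"
    "\<And>k m. bounded_op cube_measure p (b k m)"
    "\<And>k m. nuclear_rep cube_measure p (b k m) (a k m) (y k m)"
    "\<And>k m. (\<integral>\<^sup>+i. ennreal (fun_norm cube_measure p (a k m i) * lpnorm cube_measure p (y k m i)) \<partial>count_space UNIV) \<le> \<alpha> m"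
    "\<And>x k. x \<in> Lp_set lborel p \<Longrightarrow> lp_has_sum cube_measure p (\<lambda>m. b k m (piece (k - m) x)) (piece k (A x))"
proof -
  obtain b \<beta> where b0: "\<forall>m. 0 \<le> \<beta> m" and gb: "(\<lambda>m. g m * \<beta> m) summable_on UNIV"
    and bn: "\<forall>k m. nuclear cube_measure p (b k m) \<and> nuclear_norm cube_measure p (b k m) \<le> \<beta> m"
    and sm: "\<forall>x\<in>Lp_set lborel p. \<forall>k. lp_has_sum cube_measure p (\<lambda>m. b k m (piece (k - m) x)) (piece k (A x))"
    using A unfolding locally_nuclear_def by blast
  have gpos: "0 < g m" for m using weight_ge_1[OF g, of m] by simp
  \<comment> \<open>The infimum in \<open>nuclear_norm\<close> need not be attained, so each block
    gets an expansion with some slack. Dividing by \<open>g m\<close> keeps the total slack summable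
    against the weight; the slack depends on the diagonal \<open>m\<close> only and is thus uniform
    in \<open>k\<close>.\<close>
  define \<epsilon> where "\<epsilon> m = (1/2) ^ to_nat m / g m" for m
  have \<epsilon>: "0 < \<epsilon> m" for m using gpos[of m] by (simp add: \<epsilon>_def)
  have ge: "(\<lambda>m. g m * \<epsilon> m) summable_on UNIV"
  proof -
    have "(\<lambda>n::nat. (1/2::real) ^ n) summable_on range (to_nat :: int^'a \<Rightarrow> nat)"
      by (rule summable_on_subset_banach[OF _ subset_UNIV])
         (simp add: summable_on_UNIV_nonneg_real_iff summable_geometric)
    then have "((\<lambda>n::nat. (1/2::real) ^ n) \<circ> (to_nat :: int^'a \<Rightarrow> nat)) summable_on UNIV"
      by (subst (asm) summable_on_reindex) auto
    moreover have "g m * \<epsilon> m = (1/2) ^ to_nat m" for m using gpos[of m] by (simp add: \<epsilon>_def)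
    ultimately show ?thesis by (simp add: o_def)
  qed
  have "\<exists>a y. nuclear_rep cube_measure p (b k m) a y \<and>
      (\<Sum>i. fun_norm cube_measure p (a i) * lpnorm cube_measure p (y i)) < \<beta> m + \<epsilon> m" for k m
  proof -
    let ?S = "{(\<Sum>i. fun_norm cube_measure p (a i) * lpnorm cube_measure p (y i)) | a y. nuclear_rep cube_measure p (b k m) a y}"
    have "?S \<noteq> {}" using bn unfolding nuclear_def by blast
    moreover have "Inf ?S < \<beta> m + \<epsilon> m"
      using bn[rule_format, of k m] \<epsilon>[of m] unfolding nuclear_norm_def by linarith
    ultimately obtain s where "s \<in> ?S" "s < \<beta> m + \<epsilon> m" using cInf_lessD by meson
    then show ?thesis by blast
  qed
  then obtain a y where ay: "\<And>k m. nuclear_rep cube_measure p (b k m) (a k m) (y k m)"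
     "\<And>k m. (\<Sum>i. fun_norm cube_measure p (a k m i) * lpnorm cube_measure p (y k m i)) < \<beta> m + \<epsilon> m"
    by metis
  show ?thesis
  proof (rule that[of "\<lambda>m. ennreal (\<beta> m + \<epsilon> m)" b a y])
    have "(\<lambda>m. g m * \<beta> m + g m * \<epsilon> m) summable_on UNIV" by (intro summable_on_add gb ge)
    then have "(\<integral>\<^sup>+m. ennreal (g m * \<beta> m + g m * \<epsilon> m) \<partial>count_space UNIV) < \<infinity>"
      by (subst (asm) summable_on_nn_integral_iff)
         (use b0 \<epsilon> gpos in \<open>auto intro!: add_nonneg_nonneg mult_nonneg_nonneg simp: less_imp_le\<close>)
    also have "(\<lambda>m. ennreal (g m * \<beta> m + g m * \<epsilon> m)) = (\<lambda>m. ennreal (g m) * ennreal (\<beta> m + \<epsilon> m))"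
      using gpos b0 \<epsilon> by (simp add: ennreal_mult[symmetric] less_imp_le distrib_left del: ennreal_plus)
    finally show "(\<integral>\<^sup>+m. ennreal (g m) * ennreal (\<beta> m + \<epsilon> m) \<partial>count_space UNIV) < \<infinity>" .
    show "bounded_op cube_measure p (b k m)" for k m using bn unfolding nuclear_def by blast
    show "nuclear_rep cube_measure p (b k m) (a k m) (y k m)" for k m by (rule ay)
    show "x \<in> Lp_set lborel p \<Longrightarrow> lp_has_sum cube_measure p (\<lambda>m. b k m (piece (k - m) x)) (piece k (A x))" for x k
      using sm by blast
    fix k m
    let ?u = "\<lambda>i. fun_norm cube_measure p (a k m i) * lpnorm cube_measure p (y k m i)"
    have a: "bounded_fun cube_measure p (a k m i)" "y k m i \<in> Lp_set cube_measure p" for i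
      using ay(1)[of k m] unfolding nuclear_rep_def by blast+
    have nn: "0 \<le> ?u i" for i
      using fun_norm_bound(2)[OF a(1) a(2)] lpnorm_nonneg by (intro mult_nonneg_nonneg) auto
    have "summable ?u" using ay(1)[of k m] unfolding nuclear_rep_def by blast
    then have "(\<Sum>i. ennreal (?u i)) = ennreal (\<Sum>i. ?u i)" using nn by (intro suminf_ennreal2) auto
    then show "(\<integral>\<^sup>+i. ennreal (?u i) \<partial>count_space UNIV) \<le> ennreal (\<beta> m + \<epsilon> m)"
      using ay(2)[of k m] by (simp add: nn_integral_count_space_nat ennreal_leI del: ennreal_plus)
  qed
qed

text \<open>Each block is bounded in operator norm by the sum of its expansion. A finite partial sum
  of the block series approximates the cell of \<open>A x\<close> up to \<open>e\<close>, and its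
  norm is at most the full convolution.\<close>

lemma locally_nuclear_dominated:
  assumes p: "1 \<le> p" and A: "bounded_op lborel p A"
    and b: "\<And>k m. bounded_op cube_measure p (b k m)"
    and rep: "\<And>k m. nuclear_rep cube_measure p (b k m) (a k m) (y k m)"
    and \<alpha>: "\<And>k m. (\<integral>\<^sup>+i. ennreal (fun_norm cube_measure p (a k m i) * lpnorm cube_measure p (y k m i)) \<partial>count_space UNIV) \<le> \<alpha> m"
    and sm: "\<And>x k. x \<in> Lp_set lborel p \<Longrightarrow> lp_has_sum cube_measure p (\<lambda>m. b k m (piece (k - m) x)) (piece k (A x))"
  shows "dominated_op p A \<alpha>"
  unfolding dominated_op_def
proof safe
  fix x :: "(real, 'a) vec \<Rightarrow> complex" and k :: "int^'a"
  assume x: "x \<in> Lp_set lborel p"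
  let ?R = "\<integral>\<^sup>+l. \<alpha> (k - l) * ennreal (cell_norm p x l) \<partial>count_space UNIV"
  note xL = piece_Lp(1)[OF p x] and AL = piece_Lp(1)[OF p bounded_op_Lp[OF A x]]
  have bL: "b k m (piece (k - m) x) \<in> Lp_set cube_measure p" for m
    by (rule bounded_op_Lp[OF b xL])
  have bn: "ennreal (lpnorm cube_measure p (b k m (piece (k - m) x))) \<le> \<alpha> m * ennreal (cell_norm p x (k - m))" for m
  proof -
    have "ennreal (lpnorm cube_measure p (b k m (piece (k - m) x)))
       \<le> (\<integral>\<^sup>+i. ennreal (fun_norm cube_measure p (a k m i) * lpnorm cube_measure p (y k m i)) \<partial>count_space UNIV) * ennreal (cell_norm p x (k - m))"
      using nuclear_rep_remainder[OF p rep xL bL finite.emptyI, of m] by (simp add: cell_norm_def)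
    also have "\<dots> \<le> \<alpha> m * ennreal (cell_norm p x (k - m))" by (intro mult_right_mono \<alpha>) auto
    finally show ?thesis .
  qed
  show "ennreal (cell_norm p (A x) k) \<le> ?R"
  proof (rule ennreal_le_epsilon)
    fix e :: real assume e: "0 < e"
    obtain F where F: "finite F" and Fe: "lpnorm cube_measure p (\<lambda>t. piece k (A x) t - (\<Sum>m\<in>F. b k m (piece (k - m) x) t)) < e"
      using sm[OF x, of k] e unfolding lp_has_sum_def by blast
    have "cell_norm p (A x) k = lpnorm cube_measure p (\<lambda>t. (piece k (A x) t - (\<Sum>m\<in>F. b k m (piece (k - m) x) t)) + (\<Sum>m\<in>F. b k m (piece (k - m) x) t))"
      by (simp add: cell_norm_def)
    also have "\<dots> \<le> lpnorm cube_measure p (\<lambda>t. piece k (A x) t - (\<Sum>m\<in>F. b k m (piece (k - m) x) t)) + lpnorm cube_measure p (\<lambda>t. \<Sum>m\<in>F. b k m (piece (k - m) x) t)"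
      by (intro lpnorm_add lpnorm_diff lpnorm_sum p AL bL)
    also have "\<dots> \<le> e + (\<Sum>m\<in>F. lpnorm cube_measure p (b k m (piece (k - m) x)))"
      by (intro add_mono lpnorm_sum p bL less_imp_le Fe)
    finally have "ennreal (cell_norm p (A x) k) \<le> ennreal e + ennreal (\<Sum>m\<in>F. lpnorm cube_measure p (b k m (piece (k - m) x)))"
      using e by (simp add: ennreal_leI sum_nonneg lpnorm_nonneg ennreal_plus[symmetric] del: ennreal_plus)
    also have "ennreal (\<Sum>m\<in>F. lpnorm cube_measure p (b k m (piece (k - m) x))) = (\<Sum>m\<in>F. ennreal (lpnorm cube_measure p (b k m (piece (k - m) x))))"
      by (intro sum_ennreal[symmetric] lpnorm_nonneg)
    also have "\<dots> \<le> (\<Sum>m\<in>F. \<alpha> m * ennreal (cell_norm p x (k - m)))" by (intro sum_mono bn)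
    also have "\<dots> \<le> (\<integral>\<^sup>+m. \<alpha> m * ennreal (cell_norm p x (k - m)) \<partial>count_space UNIV)"
      by (rule sum_le_nn_integral_count_space[OF F])
    also have "\<dots> = ?R"
      using nn_integral_count_space_reindex[OF bij_diff_left, of "\<lambda>l. \<alpha> (k - l) * ennreal (cell_norm p x l)" k] by simp
    finally show "ennreal (cell_norm p (A x) k) \<le> ?R + ennreal e" by (simp add: add.commute)
  qed
qed

section \<open>The left ideal of locally nuclear operators\<close>

lemma dominated_op_cell_norm_embed:
  assumes p: "1 \<le> p" and D: "dominated_op p D \<Gamma>" and z: "z \<in> Lp_set cube_measure p"
  shows "ennreal (cell_norm p (D (embed_cell l z)) k) \<le> \<Gamma> (k - l) * ennreal (lpnorm cube_measure p z)"
proof -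
  have "ennreal (cell_norm p (D (embed_cell l z)) k) \<le> (\<integral>\<^sup>+l'. \<Gamma> (k - l') * ennreal (cell_norm p (embed_cell l z) l') \<partial>count_space UNIV)"
    using D embed_Lp(1)[OF p z] unfolding dominated_op_def by blast
  also have "\<dots> = (\<integral>\<^sup>+l'. (\<Gamma> (k - l) * ennreal (lpnorm cube_measure p z)) * indicator {l} l' \<partial>count_space UNIV)"
    by (intro nn_integral_cong) (auto simp: cell_norm_embed(2)[OF p z])
  finally show ?thesis by (simp add: nn_integral_cmult)
qed

lemma embed_add: "embed_cell s (\<lambda>t. z t + w t) = (\<lambda>t. embed_cell s z t + embed_cell s w t)"
  and embed_cmult: "embed_cell s (\<lambda>t. c * z t) = (\<lambda>t. c * embed_cell s z t)"
  by (auto simp: embed_cell_def)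

lemma embed_AE_cong:
  assumes "AE t in cube_measure. z t = w t"
  shows "AE t in lborel. embed_cell s z t = embed_cell s w t"
  unfolding AE_cells
proof
  fix k
  have "AE t in cube_measure. t \<in> space cube_measure" by (rule AE_space)
  with assms show "AE t in cube_measure. embed_cell s z (t + int_vec k) = embed_cell s w (t + int_vec k)"
    by eventually_elim (auto simp: embed_cell_def space_cube_iff cell_add)
qed

lemma bounded_op_comp:
  assumes p: "1 \<le> p" and A: "bounded_op M p A" and D: "bounded_op M p D"
  shows "bounded_op M p (\<lambda>x. D (A x))"
proof -
  obtain K L where K: "0 \<le> K" "\<And>f. f \<in> Lp_set M p \<Longrightarrow> lpnorm M p (A f) \<le> K * lpnorm M p f"
    and L: "0 \<le> L" "\<And>f. f \<in> Lp_set M p \<Longrightarrow> lpnorm M p (D f) \<le> L * lpnorm M p f"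
    using bounded_op_bound[OF A] bounded_op_bound[OF D] by metis
  show ?thesis unfolding bounded_op_def
  proof (intro conjI ballI impI allI)
    show "f \<in> Lp_set M p \<Longrightarrow> D (A f) \<in> Lp_set M p" for f
      by (intro bounded_op_Lp[OF D] bounded_op_Lp[OF A])
    show "AE x in M. D (A f) x = D (A h) x"
      if "f \<in> Lp_set M p" "h \<in> Lp_set M p" "AE x in M. f x = h x" for f h
      by (intro bounded_op_cong[OF D] bounded_op_cong[OF A] bounded_op_Lp[OF A] that)
    show "AE x in M. D (A (\<lambda>y. f y + h y)) x = D (A f) x + D (A h) x"
      if f: "f \<in> Lp_set M p" and h: "h \<in> Lp_set M p" for f h
    proof -
      have "AE x in M. D (A (\<lambda>y. f y + h y)) x = D (\<lambda>y. A f y + A h y) x"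
        by (intro bounded_op_cong[OF D] bounded_op_add[OF A] bounded_op_Lp[OF A] lpnorm_add p f h)
      moreover have "AE x in M. D (\<lambda>y. A f y + A h y) x = D (A f) x + D (A h) x"
        by (intro bounded_op_add[OF D] bounded_op_Lp[OF A] f h)
      ultimately show ?thesis by eventually_elim simp
    qed
    show "AE x in M. D (A (\<lambda>y. c * f y)) x = c * D (A f) x" if f: "f \<in> Lp_set M p" for f c
    proof -
      have "AE x in M. D (A (\<lambda>y. c * f y)) x = D (\<lambda>y. c * A f y) x"
        by (intro bounded_op_cong[OF D] bounded_op_cmult[OF A] bounded_op_Lp[OF A] lpnorm_cmult p f)
      moreover have "AE x in M. D (\<lambda>y. c * A f y) x = c * D (A f) x"
        by (intro bounded_op_cmult[OF D] bounded_op_Lp[OF A] f)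
      ultimately show ?thesis by eventually_elim simp
    qed
    have "lpnorm M p (D (A f)) \<le> (L * K) * lpnorm M p f" if f: "f \<in> Lp_set M p" for f
      using L(2)[OF bounded_op_Lp[OF A f]] mult_left_mono[OF K(2)[OF f] L(1)] by (simp add: mult.assoc)
    then show "\<exists>K. \<forall>f\<in>Lp_set M p. lpnorm M p (D (A f)) \<le> K * lpnorm M p f" by blast
  qed
qed

lemma bounded_op_block:
  assumes p: "1 \<le> p" and T: "bounded_op lborel p T"
  shows "bounded_op cube_measure p (\<lambda>z. piece k (T (embed_cell s z)))"
proof -
  obtain K where K: "0 \<le> K" "\<And>f. f \<in> Lp_set lborel p \<Longrightarrow> lpnorm lborel p (T f) \<le> K * lpnorm lborel p f"
    using bounded_op_bound[OF T] by metis
  have eL: "embed_cell s f \<in> Lp_set lborel p" if "f \<in> Lp_set cube_measure p" for f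
    by (rule embed_Lp(1)[OF p that])
  show ?thesis unfolding bounded_op_def
  proof (intro conjI ballI impI allI)
    show "f \<in> Lp_set cube_measure p \<Longrightarrow> piece k (T (embed_cell s f)) \<in> Lp_set cube_measure p" for f
      by (intro piece_Lp(1)[OF p] bounded_op_Lp[OF T] eL)
    show "AE x in cube_measure. piece k (T (embed_cell s f)) x = piece k (T (embed_cell s h)) x"
      if "f \<in> Lp_set cube_measure p" "h \<in> Lp_set cube_measure p" "AE x in cube_measure. f x = h x" for f h
      by (intro piece_AE_cong bounded_op_cong[OF T] eL embed_AE_cong that)
    show "AE x in cube_measure. piece k (T (embed_cell s (\<lambda>y. f y + h y))) x = piece k (T (embed_cell s f)) x + piece k (T (embed_cell s h)) x"
      if "f \<in> Lp_set cube_measure p" "h \<in> Lp_set cube_measure p" for f h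
      using bounded_op_add[OF T eL[OF that(1)] eL[OF that(2)]]
      by (auto simp: AE_cells piece_def embed_add)
    show "AE x in cube_measure. piece k (T (embed_cell s (\<lambda>y. c * f y))) x = c * piece k (T (embed_cell s f)) x"
      if "f \<in> Lp_set cube_measure p" for f c
      using bounded_op_cmult[OF T eL[OF that], of c]
      by (auto simp: AE_cells piece_def embed_cmult)
    have "lpnorm cube_measure p (piece k (T (embed_cell s f))) \<le> K * lpnorm cube_measure p f"
      if f: "f \<in> Lp_set cube_measure p" for f
      using piece_Lp(2)[OF p bounded_op_Lp[OF T eL[OF f]], of k] K(2)[OF eL[OF f]]
        mult_left_mono[OF embed_Lp(2)[OF p f, of s] K(1)] by (simp add: cell_norm_def)
    then show "\<exists>K. \<forall>f\<in>Lp_set cube_measure p. lpnorm cube_measure p (piece k (T (embed_cell s f))) \<le> K * lpnorm cube_measure p f"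
      by blast
  qed
qed

text \<open>Stated with the norm because the block expansion is only known as a norm limit.\<close>
lemma column_eq_block:
  assumes p: "1 \<le> p" and A: "bounded_op lborel p A" and b: "\<And>k m. bounded_op cube_measure p (b k m)"
    and sm: "lp_has_sum cube_measure p (\<lambda>m. b k m (piece (k - m) (embed_cell s z))) (piece k (A (embed_cell s z)))"
    and z: "z \<in> Lp_set cube_measure p"
  shows "lpnorm cube_measure p (\<lambda>t. piece k (A (embed_cell s z)) t - b k (k - s) z t) = 0"
proof -
  note eL = embed_Lp(1)[OF p z]
  note AL = piece_Lp(1)[OF p bounded_op_Lp[OF A eL]]
  have bL: "b k m (piece (k - m) (embed_cell s z)) \<in> Lp_set cube_measure p" for m
    by (rule bounded_op_Lp[OF b piece_Lp(1)[OF p eL]])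
  have one: "AE t in cube_measure. b k m (piece (k - m) (embed_cell s z)) t = (if m = k - s then b k (k - s) z t else 0)" for m
  proof (cases "m = k - s")
    case True
    have "AE t in cube_measure. t \<in> space cube_measure" by (rule AE_space)
    then have "AE t in cube_measure. piece (k - m) (embed_cell s z) t = z t"
      by eventually_elim (use True in \<open>simp add: space_cube_iff piece_embed\<close>)
    then have "AE t in cube_measure. b k m (piece (k - m) (embed_cell s z)) t = b k m z t"
      by (intro bounded_op_cong[OF b] piece_Lp(1) p eL z)
    then show ?thesis by (rule eventually_mono) (simp add: True)
  next
    case False
    have "AE t in cube_measure. t \<in> space cube_measure" by (rule AE_space)
    then have "AE t in cube_measure. piece (k - m) (embed_cell s z) t = 0"
      by eventually_elim (use False in \<open>auto simp: space_cube_iff piece_embed\<close>)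
    from bounded_op_cong[OF b piece_Lp(1)[OF p eL] Lp_zero[OF p] this, of k m]
      bounded_op_zero[OF p b, of k m] show ?thesis
      by eventually_elim (use False in simp)
  qed
  have small: "lpnorm cube_measure p (\<lambda>t. piece k (A (embed_cell s z)) t - b k (k - s) z t) \<le> e" if e: "0 < e" for e
  proof -
    from sm[unfolded lp_has_sum_def, rule_format, OF e] obtain F where
      F': "finite F \<and> (\<forall>G. finite G \<and> F \<subseteq> G \<longrightarrow>
        lpnorm cube_measure p (\<lambda>t. piece k (A (embed_cell s z)) t - (\<Sum>m\<in>G. b k m (piece (k - m) (embed_cell s z)) t)) < e)" ..
    then have F: "finite F" ..
    have Fe: "lpnorm cube_measure p (\<lambda>t. piece k (A (embed_cell s z)) t - (\<Sum>m\<in>G. b k m (piece (k - m) (embed_cell s z)) t)) < e"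
      if "finite G" "F \<subseteq> G" for G
      using F'[THEN conjunct2, rule_format, OF conjI[OF that]] .
    \<comment> \<open>The approximation holds for every finite superset of \<open>F\<close>, so the
      only index with a nonzero term may be added.\<close>
    define G where "G = insert (k - s) F"
    have G: "finite G" "F \<subseteq> G" "k - s \<in> G" using F by (auto simp: G_def)
    have "AE t in cube_measure. \<forall>m\<in>G. b k m (piece (k - m) (embed_cell s z)) t = (if m = k - s then b k (k - s) z t else 0)"
      by (rule AE_finite_allI[OF G(1) one])
    then have "AE t in cube_measure. piece k (A (embed_cell s z)) t - b k (k - s) z t
        = piece k (A (embed_cell s z)) t - (\<Sum>m\<in>G. b k m (piece (k - m) (embed_cell s z)) t)"
      by eventually_elim (use G in simp)
    moreover have "(\<lambda>t. piece k (A (embed_cell s z)) t - (\<Sum>m\<in>G. b k m (piece (k - m) (embed_cell s z)) t)) \<in> Lp_set cube_measure p"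
      by (intro lpnorm_diff(1) lpnorm_sum(1) p AL bL)
    moreover have "(\<lambda>t. piece k (A (embed_cell s z)) t - b k (k - s) z t) \<in> borel_measurable cube_measure"
      by (rule Lp_measurable[OF lpnorm_diff(1)[OF p AL bounded_op_Lp[OF b z]]])
    ultimately have "lpnorm cube_measure p (\<lambda>t. piece k (A (embed_cell s z)) t - b k (k - s) z t)
       = lpnorm cube_measure p (\<lambda>t. piece k (A (embed_cell s z)) t - (\<Sum>m\<in>G. b k m (piece (k - m) (embed_cell s z)) t))"
      by (intro lpnorm_cong(2) p)
    then show ?thesis using Fe[OF G(1,2)] by simp
  qed
  have "lpnorm cube_measure p (\<lambda>t. piece k (A (embed_cell s z)) t - b k (k - s) z t) \<le> 0"
  proof (rule field_le_epsilon)
    fix e :: real assume "0 < e"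
    from small[OF this] show "lpnorm cube_measure p (\<lambda>t. piece k (A (embed_cell s z)) t - b k (k - s) z t) \<le> 0 + e"
      unfolding add_0 .
  qed
  then show ?thesis by (intro antisym lpnorm_nonneg)
qed

lemma bounded_fun_fun_norm_nonneg: "bounded_fun M p a \<Longrightarrow> 1 \<le> p \<Longrightarrow> 0 \<le> fun_norm M p a"
  using fun_norm_bound(2)[OF _ Lp_zero] .

lemma nuclear_norm_le:
  assumes p: "1 \<le> p" and rep: "nuclear_rep M p T a y"
  shows "nuclear_norm M p T \<le> (\<Sum>i. fun_norm M p (a i) * lpnorm M p (y i))"
  unfolding nuclear_norm_def
proof (rule cInf_lower)
  show "bdd_below {(\<Sum>i. fun_norm M p (a i) * lpnorm M p (y i)) |a y. nuclear_rep M p T a y}"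
  proof (rule bdd_belowI[of _ 0])
    fix s assume "s \<in> {(\<Sum>i. fun_norm M p (a i) * lpnorm M p (y i)) |a y. nuclear_rep M p T a y}"
    then obtain a y where s: "s = (\<Sum>i. fun_norm M p (a i) * lpnorm M p (y i))" and r: "nuclear_rep M p T a y"
      by (elim CollectE exE conjE) (rule that)
    have "bounded_fun M p (a i)" for i using r unfolding nuclear_rep_def by blast
    then have "0 \<le> fun_norm M p (a i) * lpnorm M p (y i)" for i
      by (intro mult_nonneg_nonneg lpnorm_nonneg bounded_fun_fun_norm_nonneg p)
    moreover have "summable (\<lambda>i. fun_norm M p (a i) * lpnorm M p (y i))" using r unfolding nuclear_rep_def by blast
    ultimately show "0 \<le> s" unfolding s by (intro suminf_nonneg) auto
  qed
  show "(\<Sum>i. fun_norm M p (a i) * lpnorm M p (y i)) \<in> {(\<Sum>i. fun_norm M p (a i) * lpnorm M p (y i)) |a y. nuclear_rep M p T a y}"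
    by (intro CollectI exI[of _ a] exI[of _ y] conjI refl rep)
qed

text \<open>The block of \<open>D A\<close> from cell \<open>s\<close> to cell \<open>k\<close> is
  formally the sum over \<open>l\<close> of the blocks of \<open>D\<close> from \<open>l\<close> to
  \<open>k\<close> after the blocks of \<open>A\<close> from \<open>s\<close> to \<open>l\<close>.
  Expanding the latter, the functionals \<open>a l (l - s) i\<close> are kept and the vectors are
  moved to cell \<open>k\<close> by \<open>D\<close>. All pairs (l, i) together form one nuclear
  expansion.\<close>

lemma left_ideal_block:
  fixes \<Gamma> :: "int^'c::finite \<Rightarrow> ennreal"
  assumes p: "1 \<le> p" and A: "bounded_op lborel p A" and D: "bounded_op lborel p D"
    and dom: "dominated_op p D \<Gamma>" and b: "\<And>k m. bounded_op cube_measure p (b k m)"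
    and rep: "\<And>k m. nuclear_rep cube_measure p (b k m) (a k m) (y k m)"
    and \<alpha>: "\<And>k m. (\<integral>\<^sup>+i. ennreal (fun_norm cube_measure p (a k m i) * lpnorm cube_measure p (y k m i)) \<partial>count_space UNIV) \<le> \<alpha> m"
    and sm: "\<And>x k. x \<in> Lp_set lborel p \<Longrightarrow> lp_has_sum cube_measure p (\<lambda>m. b k m (piece (k - m) x)) (piece k (A x))"
    and fin: "conv \<Gamma> \<alpha> (k - s) < \<infinity>"
  shows "nuclear cube_measure p (\<lambda>z. piece k (D (A (embed_cell s z))))"
    "nuclear_norm cube_measure p (\<lambda>z. piece k (D (A (embed_cell s z)))) \<le> enn2real (conv \<Gamma> \<alpha> (k - s))"
proof -
  let ?T = "\<lambda>z. piece k (D (A (embed_cell s z)))"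
  define N where "N l i = ennreal (fun_norm cube_measure p (a l (l - s) i) * lpnorm cube_measure p (y l (l - s) i))" for l i
  \<comment> \<open>Majorant of the term with index (l, i): the size of \<open>D\<close> from cell
    \<open>l\<close> to cell \<open>k\<close> times the size of the i-th term in the expansion of
    the block of \<open>A\<close> from \<open>s\<close> to \<open>l\<close>.\<close>
  define u where "u x = \<Gamma> (k - fst x) * N (fst x) (snd x)" for x :: "(int^'c) \<times> nat"
  have aB: "bounded_fun cube_measure p (a l m i)" and yL: "y l m i \<in> Lp_set cube_measure p" for l m i
    using rep[of l m] unfolding nuclear_rep_def by blast+
  have nn: "0 \<le> fun_norm cube_measure p (a l m i)" for l m i by (rule bounded_fun_fun_norm_nonneg[OF aB p])
  have u_sum: "(\<integral>\<^sup>+x. u x \<partial>count_space UNIV) \<le> conv \<Gamma> \<alpha> (k - s)"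
  proof -
    have "(\<integral>\<^sup>+x. u x \<partial>count_space UNIV) = (\<integral>\<^sup>+l. \<integral>\<^sup>+i. \<Gamma> (k - l) * N l i \<partial>count_space UNIV \<partial>count_space UNIV)"
      by (subst nn_integral_fst_count_space[symmetric]) (simp add: u_def)
    also have "\<dots> = (\<integral>\<^sup>+l. \<Gamma> (k - l) * (\<integral>\<^sup>+i. N l i \<partial>count_space UNIV) \<partial>count_space UNIV)"
      by (simp add: nn_integral_cmult)
    also have "\<dots> \<le> (\<integral>\<^sup>+l. \<Gamma> (k - l) * \<alpha> (l - s) \<partial>count_space UNIV)"
      unfolding N_def by (intro nn_integral_mono mult_left_mono \<alpha>) auto
    also have "\<dots> = conv \<Gamma> \<alpha> (k - s)"
      using nn_integral_count_space_reindex[OF bij_diff_right, of "\<lambda>l. \<Gamma> (k - s - l) * \<alpha> l" s]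
      by (simp add: conv_def)
    finally show ?thesis .
  qed
  \<comment> \<open>Any enumeration of the pairs serves, since the remainders are controlled by the
    tails of the summable \<open>u\<close>.\<close>
  define e where "e = from_nat_into (UNIV :: ((int^'c) \<times> nat) set)"
  have e: "bij e"
    unfolding e_def by (intro bij_betw_from_nat_into) (simp_all add: finite_prod)
  define a' where "a' n = a (fst (e n)) (fst (e n) - s) (snd (e n))" for n
  define y' where "y' n = piece k (D (embed_cell (fst (e n)) (y (fst (e n)) (fst (e n) - s) (snd (e n)))))" for n
  have DeL: "D (embed_cell l (y l m i)) \<in> Lp_set lborel p" for l m i
    by (intro bounded_op_Lp[OF D] embed_Lp(1) p yL)
  have y'L: "y' n \<in> Lp_set cube_measure p" for n unfolding y'_def by (intro piece_Lp(1) p DeL)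
  have a'B: "bounded_fun cube_measure p (a' n)" for n unfolding a'_def by (rule aB)
  let ?v = "\<lambda>n. fun_norm cube_measure p (a' n) * lpnorm cube_measure p (y' n)"
  have v_nn: "0 \<le> ?v n" for n
    by (intro mult_nonneg_nonneg lpnorm_nonneg bounded_fun_fun_norm_nonneg[OF a'B p])
  have v_le: "ennreal (?v n) \<le> u (e n)" for n
  proof -
    have "ennreal (?v n) = ennreal (fun_norm cube_measure p (a' n)) * ennreal (lpnorm cube_measure p (y' n))"
      by (intro ennreal_mult lpnorm_nonneg bounded_fun_fun_norm_nonneg[OF a'B p])
    also have "\<dots> \<le> ennreal (fun_norm cube_measure p (a' n)) * (\<Gamma> (k - fst (e n)) * ennreal (lpnorm cube_measure p (y (fst (e n)) (fst (e n) - s) (snd (e n)))))"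
      unfolding y'_def cell_norm_def[symmetric]
      by (intro mult_left_mono dominated_op_cell_norm_embed p dom yL) simp
    also have "\<dots> = u (e n)"
      by (simp add: u_def N_def a'_def ennreal_mult nn lpnorm_nonneg mult_ac)
    finally show ?thesis .
  qed
  have v_int: "(\<integral>\<^sup>+n. ennreal (?v n) \<partial>count_space UNIV) \<le> conv \<Gamma> \<alpha> (k - s)"
  proof -
    have "(\<integral>\<^sup>+n. ennreal (?v n) \<partial>count_space UNIV) \<le> (\<integral>\<^sup>+n. u (e n) \<partial>count_space UNIV)"
      by (intro nn_integral_mono v_le)
    also have "\<dots> \<le> conv \<Gamma> \<alpha> (k - s)" unfolding nn_integral_count_space_reindex[OF e] by (rule u_sum)
    finally show ?thesis .
  qed
  have v_sum: "summable ?v"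
  proof -
    have "(\<Sum>n. ennreal (?v n)) \<noteq> \<infinity>"
      using le_less_trans[OF v_int fin] by (simp add: nn_integral_count_space_nat)
    then show ?thesis by (intro summable_suminf_not_top v_nn) auto
  qed
  have remainder: "ennreal (lpnorm cube_measure p (\<lambda>t. ?T z t - (\<Sum>i<n. a' i z * y' i t)))
      \<le> (\<integral>\<^sup>+x. indicator (- e ` {..<n}) x * u x \<partial>count_space UNIV) * ennreal (lpnorm cube_measure p z)"
    if z: "z \<in> Lp_set cube_measure p" for z n
  proof -
    let ?F = "e ` {..<n}"
    let ?f = "A (embed_cell s z)"
    define c where "c x = a (fst x) (fst x - s) (snd x) z" for x
    define w where "w x = embed_cell (fst x) (y (fst x) (fst x - s) (snd x))" for x
    have fL: "?f \<in> Lp_set lborel p" by (intro bounded_op_Lp[OF A] embed_Lp(1) p z)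
    have wL: "w x \<in> Lp_set lborel p" for x unfolding w_def by (intro embed_Lp(1) p yL)
    have cwL: "(\<lambda>t. c x * w x t) \<in> Lp_set lborel p" for x by (intro lpnorm_cmult(1) p wL)
    have sL: "(\<lambda>t. \<Sum>x\<in>?F. c x * w x t) \<in> Lp_set lborel p" by (intro lpnorm_sum(1) p cwL)
    \<comment> \<open>The remainder is a piece of \<open>D ?h\<close> for one function
      \<open>?h\<close>, so domination applies to it directly and only finite sums have to be passed
      through \<open>D\<close>.\<close>
    let ?h = "\<lambda>t. ?f t - (\<Sum>x\<in>?F. c x * w x t)"
    have hL: "?h \<in> Lp_set lborel p" by (intro lpnorm_diff(1) p fL sL)
    have Dh: "AE t in lborel. D ?f t - (\<Sum>x\<in>?F. c x * D (w x) t) = D ?h t"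
    proof -
      have 1: "AE t in lborel. D ?h t = D ?f t - D (\<lambda>t. \<Sum>x\<in>?F. c x * w x t) t"
        by (rule bounded_op_diff[OF p D fL sL])
      have 2: "AE t in lborel. D (\<lambda>t. \<Sum>x\<in>?F. c x * w x t) t = (\<Sum>x\<in>?F. D (\<lambda>t. c x * w x t) t)"
        by (rule bounded_op_sum[OF p D cwL])
      have 3: "AE t in lborel. \<forall>x\<in>?F. D (\<lambda>t. c x * w x t) t = c x * D (w x) t"
        by (intro AE_finite_allI bounded_op_cmult[OF D wL]) auto
      from 1 2 3 show ?thesis by eventually_elim simp
    qed
    have sum_eq: "(\<Sum>i<n. a' i z * y' i t) = (\<Sum>x\<in>?F. c x * piece k (D (w x)) t)" for t
      by (subst sum.reindex) (use e in \<open>auto simp: a'_def y'_def c_def w_def bij_def inj_on_def\<close>)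
    have "cell_norm p (\<lambda>t. D ?f t - (\<Sum>x\<in>?F. c x * D (w x) t)) k = cell_norm p (D ?h) k"
      by (intro cell_norm_AE_cong p bounded_op_Lp[OF D] hL Dh Lp_measurable[OF lpnorm_diff(1)[OF p]] fL lpnorm_sum(1) lpnorm_cmult(1) wL)
    then have "lpnorm cube_measure p (\<lambda>t. ?T z t - (\<Sum>i<n. a' i z * y' i t)) = cell_norm p (D ?h) k"
      by (simp add: sum_eq cell_norm_def piece_def)
    also have "ennreal \<dots> \<le> (\<integral>\<^sup>+l. \<Gamma> (k - l) * ennreal (cell_norm p ?h l) \<partial>count_space UNIV)"
      using dom hL unfolding dominated_op_def by blast
    also have "\<dots> \<le> (\<integral>\<^sup>+l. \<Gamma> (k - l) * ((\<integral>\<^sup>+i. indicator (- ?F) (l, i) * N l i \<partial>count_space UNIV) * ennreal (lpnorm cube_measure p z)) \<partial>count_space UNIV)"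
    proof (intro nn_integral_mono mult_left_mono)
      fix l
      \<comment> \<open>The terms already summed that live in cell \<open>l\<close>; in general this
        is not an initial segment.\<close>
      let ?I = "{i. (l, i) \<in> ?F}"
      have finI: "finite ?I"
        using finite_vimageI[of ?F "Pair l"] by (simp add: vimage_def inj_on_def)
      have bL: "b l (l - s) z \<in> Lp_set cube_measure p" by (rule bounded_op_Lp[OF b z])
      have lfL: "piece l ?f \<in> Lp_set cube_measure p" by (rule piece_Lp(1)[OF p fL])
      have ayL: "(\<lambda>t. \<Sum>i\<in>?I. a l (l - s) i z * y l (l - s) i t) \<in> Lp_set cube_measure p"
        by (intro lpnorm_sum(1) lpnorm_cmult(1) p yL)
      \<comment> \<open>The first difference has norm 0 by \<open>column_eq_block\<close>; the
        second is the remainder of the nuclear expansion of \<open>b l (l - s)\<close> at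
        \<open>z\<close>.\<close>
      have *: "piece l ?h t = (piece l ?f t - b l (l - s) z t) + (b l (l - s) z t - (\<Sum>i\<in>?I. a l (l - s) i z * y l (l - s) i t))"
        if "t \<in> space cube_measure" for t
      proof -
        have "(\<Sum>x\<in>?F. c x * piece l (w x) t) = (\<Sum>x\<in>Pair l ` ?I. c x * piece l (w x) t)"
        proof -
          have P: "Pair l ` {i. (l, i) \<in> S} = {x \<in> S. fst x = l}" for S :: "((int^'c) \<times> nat) set"
            by force
          show ?thesis unfolding P
            using that by (intro sum.mono_neutral_right) (auto simp: w_def space_cube_iff piece_embed)
        qed
        also have "\<dots> = (\<Sum>i\<in>?I. a l (l - s) i z * y l (l - s) i t)"
          using that by (subst sum.reindex) (auto simp: inj_on_def w_def c_def space_cube_iff piece_embed)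
        finally show ?thesis by (simp add: piece_def)
      qed
      have "cell_norm p ?h l = lpnorm cube_measure p (\<lambda>t. (piece l ?f t - b l (l - s) z t) + (b l (l - s) z t - (\<Sum>i\<in>?I. a l (l - s) i z * y l (l - s) i t)))"
        unfolding cell_norm_def
        by (rule lpnorm_space_cong(2)[OF p _ *]) (intro lpnorm_add(1) lpnorm_diff(1) p bL lfL ayL)
      also have "\<dots> \<le> lpnorm cube_measure p (\<lambda>t. piece l ?f t - b l (l - s) z t) + lpnorm cube_measure p (\<lambda>t. b l (l - s) z t - (\<Sum>i\<in>?I. a l (l - s) i z * y l (l - s) i t))"
        by (intro lpnorm_add(2) lpnorm_diff(1) p bL lfL ayL)
      also have "lpnorm cube_measure p (\<lambda>t. piece l ?f t - b l (l - s) z t) = 0"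
        by (rule column_eq_block[OF p A b sm[OF embed_Lp(1)[OF p z]] z])
      finally have "ennreal (cell_norm p ?h l) \<le> ennreal (lpnorm cube_measure p (\<lambda>t. b l (l - s) z t - (\<Sum>i\<in>?I. a l (l - s) i z * y l (l - s) i t)))"
        by (intro ennreal_leI) simp
      also have "\<dots> \<le> (\<integral>\<^sup>+i. indicator (- ?I) i * N l i \<partial>count_space UNIV) * ennreal (lpnorm cube_measure p z)"
        unfolding N_def by (rule nuclear_rep_remainder[OF p rep z bL finI])
      also have "(\<lambda>i. indicator (- ?I) i :: ennreal) = (\<lambda>i. indicator (- ?F) (l, i))"
        by (auto simp: indicator_def)
      finally show "ennreal (cell_norm p ?h l) \<le> (\<integral>\<^sup>+i. indicator (- ?F) (l, i) * N l i \<partial>count_space UNIV) * ennreal (lpnorm cube_measure p z)" .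
    qed simp
    also have "\<dots> = (\<integral>\<^sup>+l. \<integral>\<^sup>+i. indicator (- ?F) (l, i) * u (l, i) \<partial>count_space UNIV \<partial>count_space UNIV) * ennreal (lpnorm cube_measure p z)"
      by (simp add: u_def nn_integral_multc[symmetric] nn_integral_cmult[symmetric] mult_ac)
    also have "(\<integral>\<^sup>+l. \<integral>\<^sup>+i. indicator (- ?F) (l, i) * u (l, i) \<partial>count_space UNIV \<partial>count_space UNIV) = (\<integral>\<^sup>+x. indicator (- ?F) x * u x \<partial>count_space UNIV)"
      by (rule nn_integral_fst_count_space)
    finally show ?thesis .
  qed
  have rep': "nuclear_rep cube_measure p ?T a' y'"
    unfolding nuclear_rep_def
  proof (intro conjI allI ballI a'B y'L v_sum)
    fix z :: "(real, 'c) vec \<Rightarrow> complex" assume z: "z \<in> Lp_set cube_measure p"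
    let ?r = "\<lambda>n. lpnorm cube_measure p (\<lambda>t. ?T z t - (\<Sum>i<n. a' i z * y' i t))"
    show "?r \<longlonglongrightarrow> 0"
    proof (rule LIMSEQ_I)
      fix r :: real assume r: "0 < r"
      define d where "d = r / (lpnorm cube_measure p z + 1)"
      have zn: "0 \<le> lpnorm cube_measure p z" by (rule lpnorm_nonneg)
      have d: "0 < d" using r zn by (simp add: d_def)
      obtain F where F: "finite F" "\<And>G. F \<subseteq> G \<Longrightarrow> (\<integral>\<^sup>+x. indicator (- G) x * u x \<partial>count_space UNIV) < ennreal d"
        using nn_integral_count_space_tail[OF le_less_trans[OF u_sum fin], of "ennreal d"] d by auto
      have "finite (e -` F)" using F(1) e by (intro finite_vimageI) (auto simp: bij_def)
      then obtain n0 where n0: "e -` F \<subseteq> {..<n0}" using finite_nat_iff_bounded by blast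
      show "\<exists>n0. \<forall>n\<ge>n0. norm (?r n - 0) < r"
      proof (intro exI allI impI)
        fix n assume n: "n0 \<le> n"
        have "F \<subseteq> e ` {..<n}"
        proof
          fix x assume "x \<in> F"
          moreover obtain j where "x = e j" using e unfolding bij_def by (metis surjD)
          ultimately show "x \<in> e ` {..<n}" using n0 n by auto
        qed
        have "ennreal (?r n) \<le> ennreal d * ennreal (lpnorm cube_measure p z)"
          by (rule order_trans[OF remainder[OF z]]) (rule mult_right_mono[OF less_imp_le[OF F(2)[OF \<open>F \<subseteq> e ` {..<n}\<close>]] zero_le])
        also have "\<dots> = ennreal (d * lpnorm cube_measure p z)" using d zn by (simp add: ennreal_mult)
        finally have "?r n \<le> d * lpnorm cube_measure p z" using d zn by (simp add: ennreal_le_iff)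
        also have "\<dots> < d * (lpnorm cube_measure p z + 1)" using d by (intro mult_strict_left_mono) auto
        also have "\<dots> = r" using zn by (simp add: d_def)
        finally show "norm (?r n - 0) < r" by (simp add: abs_of_nonneg[OF lpnorm_nonneg])
      qed
    qed
  qed
  show "nuclear cube_measure p ?T"
    unfolding nuclear_def using rep' bounded_op_block[OF p bounded_op_comp[OF p A D]] by blast
  have "nuclear_norm cube_measure p ?T \<le> (\<Sum>n. ?v n)" by (rule nuclear_norm_le[OF p rep'])
  also have "\<dots> \<le> enn2real (conv \<Gamma> \<alpha> (k - s))"
  proof -
    have "ennreal (\<Sum>n. ?v n) = (\<Sum>n. ennreal (?v n))"
      using v_sum v_nn by (intro suminf_ennreal2[symmetric]) auto
    also have "\<dots> \<le> conv \<Gamma> \<alpha> (k - s)" using v_int by (simp add: nn_integral_count_space_nat)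
    finally have "enn2real (ennreal (\<Sum>n. ?v n)) \<le> enn2real (conv \<Gamma> \<alpha> (k - s))"
      using fin by (intro enn2real_mono) auto
    then show ?thesis using v_sum v_nn by (simp add: suminf_nonneg)
  qed
  finally show "nuclear_norm cube_measure p ?T \<le> enn2real (conv \<Gamma> \<alpha> (k - s))" .
qed

lemma dominated_op_comp:
  fixes \<Gamma> \<alpha> :: "int^'c::finite \<Rightarrow> ennreal"
  assumes A: "bounded_op lborel p A" and domA: "dominated_op p A \<alpha>" and domD: "dominated_op p D \<Gamma>"
  shows "dominated_op p (\<lambda>x. D (A x)) (conv \<Gamma> \<alpha>)"
  unfolding dominated_op_def
proof safe
  fix x :: "(real, 'c) vec \<Rightarrow> complex" and k :: "int^'c" assume x: "x \<in> Lp_set lborel p"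
  have "ennreal (cell_norm p (D (A x)) k) \<le> conv \<Gamma> (\<lambda>l. ennreal (cell_norm p (A x) l)) k"
    using domD bounded_op_Lp[OF A x] unfolding dominated_op_def conv_def by blast
  also have "\<dots> \<le> conv \<Gamma> (conv \<alpha> (\<lambda>l. ennreal (cell_norm p x l))) k"
    by (rule conv_mono) (use domA x in \<open>unfold dominated_op_def conv_def, blast\<close>)
  also have "\<dots> = conv (conv \<Gamma> \<alpha>) (\<lambda>l. ennreal (cell_norm p x l)) k" by (rule conv_assoc)
  finally show "ennreal (cell_norm p (D (A x)) k)
      \<le> (\<integral>\<^sup>+l. conv \<Gamma> \<alpha> (k - l) * ennreal (cell_norm p x l) \<partial>count_space UNIV)"
    by (simp add: conv_def[of "conv \<Gamma> \<alpha>"])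
qed

text \<open>For p = \<infinity> the truncations of x do not converge to x in norm; the domination by
  a summable sequence makes the block expansion converge cell by cell nevertheless.\<close>
lemma dominated_op_lp_has_sum:
  fixes \<delta> :: "int^'c::finite \<Rightarrow> ennreal"
  assumes p: "1 \<le> p" and T: "bounded_op lborel p T" and dom: "dominated_op p T \<delta>"
    and fin: "(\<integral>\<^sup>+m. \<delta> m \<partial>count_space UNIV) < \<infinity>" and x: "x \<in> Lp_set lborel p"
  shows "lp_has_sum cube_measure p (\<lambda>m. piece k (T (embed_cell (k - m) (piece (k - m) x)))) (piece k (T x))"
  unfolding lp_has_sum_def
proof (intro allI impI)
  fix e :: real assume e: "0 < e"
  define d where "d = e / (lpnorm lborel p x + 1)"
  have xn: "0 \<le> lpnorm lborel p x" by (rule lpnorm_nonneg)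
  have d: "0 < d" using e xn by (simp add: d_def)
  obtain F where F: "finite F" "\<And>G. F \<subseteq> G \<Longrightarrow> (\<integral>\<^sup>+m. indicator (- G) m * \<delta> m \<partial>count_space UNIV) < ennreal d"
    using nn_integral_count_space_tail[OF fin, of "ennreal d"] d by auto
  have "lpnorm cube_measure p (\<lambda>t. piece k (T x) t - (\<Sum>m\<in>G. piece k (T (embed_cell (k - m) (piece (k - m) x))) t)) < e"
    if G: "finite G" "F \<subseteq> G" for G
  proof -
    define w where "w m = embed_cell (k - m) (piece (k - m) x)" for m
    have wL: "w m \<in> Lp_set lborel p" for m unfolding w_def by (intro embed_Lp(1) piece_Lp(1) p x)
    have sL: "(\<lambda>t. \<Sum>m\<in>G. w m t) \<in> Lp_set lborel p" by (intro lpnorm_sum(1) p wL)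
    let ?h = "\<lambda>t. x t - (\<Sum>m\<in>G. w m t)"
    have hL: "?h \<in> Lp_set lborel p" by (intro lpnorm_diff(1) p x sL)
    have Th: "AE t in lborel. T x t - (\<Sum>m\<in>G. T (w m) t) = T ?h t"
    proof -
      have 1: "AE t in lborel. T ?h t = T x t - T (\<lambda>t. \<Sum>m\<in>G. w m t) t" by (rule bounded_op_diff[OF p T x sL])
      have 2: "AE t in lborel. T (\<lambda>t. \<Sum>m\<in>G. w m t) t = (\<Sum>m\<in>G. T (w m) t)" by (rule bounded_op_sum[OF p T wL])
      from 1 2 show ?thesis by eventually_elim simp
    qed
    \<comment> \<open>Subtracting the parts of \<open>x\<close> in the cells \<open>k - m\<close>
      with \<open>m \<in> G\<close> leaves a function that vanishes on those cells. Only the tail of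
      \<delta> outside \<open>G\<close> meets the rest, and there the cell norms are merely
      bounded.\<close>
    have h_cell: "ennreal (cell_norm p ?h l) \<le> indicator (- G) (k - l) * ennreal (lpnorm lborel p x)" for l
    proof -
      have *: "piece l ?h t = indicator (- G) (k - l) * piece l x t" if "t \<in> space cube_measure" for t
      proof -
        have "(\<Sum>m\<in>G. piece l (w m) t) = (\<Sum>m\<in>G. if m = k - l then piece l x t else 0)"
          using that by (intro sum.cong) (auto simp: w_def space_cube_iff piece_embed)
        also have "\<dots> = (if k - l \<in> G then piece l x t else 0)" using G by simp
        finally show ?thesis by (simp add: piece_def indicator_def)
      qed
      have "cell_norm p ?h l = lpnorm cube_measure p (\<lambda>t. indicator (- G) (k - l) * piece l x t)"
        unfolding cell_norm_def
        by (rule lpnorm_space_cong(2)[OF p lpnorm_cmult(1)[OF p piece_Lp(1)[OF p x]] *])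
      also have "\<dots> = indicator (- G) (k - l) * cell_norm p x l"
        unfolding cell_norm_def by (subst lpnorm_cmult(2)[OF p piece_Lp(1)[OF p x]]) (simp add: indicator_def)
      finally show ?thesis using piece_Lp(2)[OF p x, of l] by (simp add: indicator_def ennreal_leI)
    qed
    have "cell_norm p (\<lambda>t. T x t - (\<Sum>m\<in>G. T (w m) t)) k = cell_norm p (T ?h) k"
      by (intro cell_norm_AE_cong p bounded_op_Lp[OF T] hL Th Lp_measurable[OF lpnorm_diff(1)[OF p]] x lpnorm_sum(1) wL)
    then have "lpnorm cube_measure p (\<lambda>t. piece k (T x) t - (\<Sum>m\<in>G. piece k (T (w m)) t)) = cell_norm p (T ?h) k"
      by (simp add: cell_norm_def piece_def)
    also have "ennreal \<dots> \<le> (\<integral>\<^sup>+l. \<delta> (k - l) * ennreal (cell_norm p ?h l) \<partial>count_space UNIV)"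
      using dom hL unfolding dominated_op_def by blast
    also have "\<dots> \<le> (\<integral>\<^sup>+l. \<delta> (k - l) * (indicator (- G) (k - l) * ennreal (lpnorm lborel p x)) \<partial>count_space UNIV)"
      by (intro nn_integral_mono mult_left_mono h_cell) simp
    also have "\<dots> = (\<integral>\<^sup>+m. \<delta> m * (indicator (- G) m * ennreal (lpnorm lborel p x)) \<partial>count_space UNIV)"
      by (rule nn_integral_count_space_reindex[OF bij_diff_left])
    also have "\<dots> = (\<integral>\<^sup>+m. indicator (- G) m * \<delta> m \<partial>count_space UNIV) * ennreal (lpnorm lborel p x)"
      by (subst nn_integral_multc[symmetric]) (simp_all add: mult_ac)
    also have "\<dots> \<le> ennreal d * ennreal (lpnorm lborel p x)"
      using F(2)[OF G(2)] by (intro mult_right_mono) auto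
    also have "\<dots> = ennreal (d * lpnorm lborel p x)" using d xn by (simp add: ennreal_mult)
    finally have "lpnorm cube_measure p (\<lambda>t. piece k (T x) t - (\<Sum>m\<in>G. piece k (T (w m)) t)) \<le> d * lpnorm lborel p x"
      using d xn by (simp add: ennreal_le_iff)
    also have "\<dots> < d * (lpnorm lborel p x + 1)" using d by (intro mult_strict_left_mono) auto
    also have "\<dots> = e" using xn by (simp add: d_def)
    finally show ?thesis by (simp add: w_def)
  qed
  then show "\<exists>F0. finite F0 \<and> (\<forall>G. finite G \<and> F0 \<subseteq> G \<longrightarrow>
      lpnorm cube_measure p (\<lambda>t. piece k (T x) t - (\<Sum>m\<in>G. piece k (T (embed_cell (k - m) (piece (k - m) x))) t)) < e)"
    using F(1) by (intro exI[of _ F]) auto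
qed

text \<open>The blocks are read off by applying \<open>D A\<close> to functions on a single cell.
  Their majorant \<open>conv \<Gamma> \<alpha>\<close> is summable against \<open>g\<close> because
  \<open>g\<close> is submultiplicative.\<close>

lemma locally_nuclear_left_ideal:
  fixes \<Gamma> :: "int^'c::finite \<Rightarrow> ennreal"
  assumes p: "1 \<le> p" and g: "weight g" and A: "locally_nuclear p g A"
    and D: "bounded_op lborel p D" and dom: "dominated_op p D \<Gamma>"
    and \<Gamma>: "(\<integral>\<^sup>+m. ennreal (g m) * \<Gamma> m \<partial>count_space UNIV) < \<infinity>"
  shows "locally_nuclear p g (\<lambda>x. D (A x))"
proof -
  have Ab: "bounded_op lborel p A" using A unfolding locally_nuclear_def by (rule conjunct1)
  obtain b a y \<alpha> where \<alpha>: "(\<integral>\<^sup>+m. ennreal (g m) * \<alpha> m \<partial>count_space UNIV) < \<infinity>"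
    and b: "\<And>k m. bounded_op cube_measure p (b k m)"
    and rep: "\<And>k m. nuclear_rep cube_measure p (b k m) (a k m) (y k m)"
    and ay: "\<And>k m. (\<integral>\<^sup>+i. ennreal (fun_norm cube_measure p (a k m i) * lpnorm cube_measure p (y k m i)) \<partial>count_space UNIV) \<le> \<alpha> m"
    and sm: "\<And>x k. x \<in> Lp_set lborel p \<Longrightarrow> lp_has_sum cube_measure p (\<lambda>m. b k m (piece (k - m) x)) (piece k (A x))"
    by (rule locally_nuclear_reps[OF g A]) (rule that)
  have domA: "dominated_op p A \<alpha>" by (rule locally_nuclear_dominated[OF p Ab b rep ay sm])
  let ?\<delta> = "conv \<Gamma> \<alpha>"
  have gd: "(\<integral>\<^sup>+m. ennreal (g m) * ?\<delta> m \<partial>count_space UNIV) < \<infinity>"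
    using weight_conv[of "\<lambda>m. ennreal (g m)" "\<lambda>m. ennreal (g m)" \<Gamma> \<alpha>, OF weight_submult[OF g]] \<Gamma> \<alpha>
    by (auto simp: ennreal_mult_less_top intro: le_less_trans)
  have dfin: "(\<integral>\<^sup>+m. ?\<delta> m \<partial>count_space UNIV) < \<infinity>"
    by (rule le_less_trans[OF weight_le_sum[OF g] gd])
  \<comment> \<open>The definition asks for a real majorant, and \<open>enn2real\<close> sends
    \<open>\<infinity>\<close> to 0, so pointwise finiteness is settled first.\<close>
  have dm: "?\<delta> m < \<infinity>" for m
    using nn_integral_ge_point[of m UNIV ?\<delta>] dfin by (auto intro: le_less_trans)
  have DA: "bounded_op lborel p (\<lambda>x. D (A x))" by (rule bounded_op_comp[OF p Ab D])
  let ?b = "\<lambda>k m z. piece k (D (A (embed_cell (k - m) z)))"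
  show ?thesis
    unfolding locally_nuclear_def
  proof (intro conjI exI[of _ ?b] exI[of _ "\<lambda>m. enn2real (?\<delta> m)"] allI ballI DA enn2real_nonneg)
    have eq: "ennreal (g m * enn2real (?\<delta> m)) = ennreal (g m) * ?\<delta> m" for m
      using dm[of m] weight_ge_1[OF g, of m] by (simp add: ennreal_mult less_top)
    show "(\<lambda>m. g m * enn2real (?\<delta> m)) summable_on UNIV"
    proof (subst summable_on_nn_integral_iff)
      show "0 \<le> g m * enn2real (?\<delta> m)" for m using weight_ge_1[OF g, of m] by simp
    qed (use gd in \<open>simp only: eq\<close>)
    fix k m
    show "nuclear cube_measure p (?b k m)" "nuclear_norm cube_measure p (?b k m) \<le> enn2real (?\<delta> m)"
      using left_ideal_block[OF p Ab D dom b rep ay sm, of k "k - m"] dm[of m] by simp_all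
  next
    fix x :: "(real, 'c) vec \<Rightarrow> complex" and k :: "int^'c" assume x: "x \<in> Lp_set lborel p"
    show "lp_has_sum cube_measure p (\<lambda>m. ?b k m (piece (k - m) x)) (piece k (D (A x)))"
      using dominated_op_lp_has_sum[OF p DA dominated_op_comp[OF Ab domA dom] dfin x, of k] .
  qed
qed

section \<open>Scalar convolution inequalities with weights\<close>

lemma weight_sum_le_prod:
  assumes "weight g" "finite F"
  shows "g (\<Sum>t\<in>F. f t) \<le> (\<Prod>t\<in>F. g (f t))"
  using assms(2)
proof (induction F rule: finite_induct)
  case empty
  then show ?case using assms by (simp add: weight_def)
next
  case (insert t F)
  have "g (f t + (\<Sum>t\<in>F. f t)) \<le> g (f t) * g (\<Sum>t\<in>F. f t)" using assms by (simp add: weight_def)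
  also have "\<dots> \<le> g (f t) * (\<Prod>t\<in>F. g (f t))"
    using insert.IH assms(1) by (intro mult_left_mono) (auto simp: weight_def less_imp_le)
  finally show ?case using insert by simp
qed

text \<open>Condition (e) enters here. It bounds \<open>g (int k *s t)\<close> by a pure power for
  large \<open>k\<close>; the finitely many smaller \<open>k\<close>, including 0 where
  \<open>root 0\<close> says nothing, are absorbed into \<open>C\<close>.\<close>

lemma weight_subexponential:
  assumes g: "weight g" and \<eta>: "0 < \<eta>"
  obtains C where "\<And>k. g (int k *s t) \<le> C * (1 + \<eta>) ^ k" "0 < C"
proof -
  have gpos: "0 < g n" for n using g by (simp add: weight_def)
  have "(\<lambda>n. root n (g (int n *s t))) \<longlonglongrightarrow> 1" using g by (simp add: weight_def)
  then have "eventually (\<lambda>n. root n (g (int n *s t)) < 1 + \<eta>) sequentially"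
    using \<eta> by (intro order_tendstoD) auto
  then obtain k0 where k0: "\<And>n. k0 \<le> n \<Longrightarrow> root n (g (int n *s t)) < 1 + \<eta>"
    by (auto simp: eventually_sequentially)
  define C where "C = 1 + (\<Sum>k\<le>k0. g (int k *s t))"
  have C1: "1 \<le> C" using gpos by (auto simp: C_def sum_nonneg less_imp_le)
  have "g (int k *s t) \<le> C * (1 + \<eta>) ^ k" for k
  proof (cases "k \<le> k0")
    case True
    have "g (int k *s t) \<le> (\<Sum>k\<le>k0. g (int k *s t))"
      using True gpos by (intro member_le_sum) (auto simp: less_imp_le)
    also have "\<dots> \<le> C * 1" by (simp add: C_def)
    also have "\<dots> \<le> C * (1 + \<eta>) ^ k" using C1 \<eta> by (intro mult_left_mono one_le_power) auto
    finally show ?thesis .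
  next
    case False
    have "g (int k *s t) = root k (g (int k *s t)) ^ k"
      using False gpos[of "int k *s t"] by (simp add: less_imp_le)
    also have "\<dots> \<le> (1 + \<eta>) ^ k"
      using k0[of k] False gpos[of "int k *s t"] by (intro power_mono) (auto simp: less_imp_le)
    also have "\<dots> \<le> C * (1 + \<eta>) ^ k" using C1 \<eta> by simp
    finally show ?thesis .
  qed
  with C1 show ?thesis by (intro that[of C]) auto
qed

text \<open>This reduces the weighted spectral radius of a scalar sequence to the unweighted one: up to a small
  tail the sequence is supported in F, where the factor 1 + \<eta> replaces g.\<close>
lemma equivalent_weight:
  fixes g :: "int^'c::finite \<Rightarrow> real"
  assumes g: "weight g" and F: "finite F" and \<eta>: "0 < \<eta>"
  obtains G :: "int^'c \<Rightarrow> ennreal" and C :: real where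
    "\<And>m. ennreal (g m) \<le> G m" "\<And>m. G m \<le> ennreal (C * g m)"
    "\<And>t m. t \<in> F \<Longrightarrow> G (t + m) \<le> ennreal (1 + \<eta>) * G m"
    "\<And>m n. G (m + n) \<le> ennreal (g m) * G n"
proof -
  have gpos: "0 < g n" for n using g by (simp add: weight_def)
  have sub: "g (m + n) \<le> g m * g n" for m n using g by (simp add: weight_def)
  have "\<exists>C. (\<forall>k. g (int k *s t) \<le> C * (1 + \<eta>) ^ k) \<and> 0 < C" for t
    by (rule weight_subexponential[OF g \<eta>, of t]) blast
  then obtain C where C: "\<And>t k. g (int k *s t) \<le> C t * (1 + \<eta>) ^ k" "\<And>t. 0 < C t" by metis
  define sh where "sh n = (\<Sum>t\<in>F. int (n t) *s t)" for n :: "int^'c \<Rightarrow> nat"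
  define E where "E n = (1 + \<eta>) ^ (\<Sum>t\<in>F. n t)" for n :: "int^'c \<Rightarrow> nat"
  have E: "0 < E n" for n using \<eta> by (simp add: E_def)
  \<comment> \<open>A renorming: the supremum runs over all translations by nonnegative integer
    combinations of \<open>F\<close>, each discounted by \<open>1 + \<eta>\<close> per step.
    Subexponential growth along each direction keeps it below a multiple of
    \<open>g\<close>.\<close>
  define G where "G m = (SUP n. ennreal (g (m + sh n) / E n))" for m
  have ub: "g (m + sh n) / E n \<le> (\<Prod>t\<in>F. C t) * g m" for m n
  proof -
    have "g (sh n) \<le> (\<Prod>t\<in>F. g (int (n t) *s t))" unfolding sh_def by (rule weight_sum_le_prod[OF g F])
    also have "\<dots> \<le> (\<Prod>t\<in>F. C t * (1 + \<eta>) ^ n t)"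
      using C gpos by (intro prod_mono) (auto simp: less_imp_le)
    also have "\<dots> = (\<Prod>t\<in>F. C t) * E n" by (simp add: prod.distrib E_def power_sum)
    finally have "g m * g (sh n) \<le> g m * ((\<Prod>t\<in>F. C t) * E n)"
      using gpos[of m] by (intro mult_left_mono) auto
    then have "g (m + sh n) \<le> (\<Prod>t\<in>F. C t) * g m * E n" using sub[of m "sh n"] by (simp add: mult_ac)
    then show ?thesis using E[of n] by (simp add: divide_le_eq)
  qed
  show ?thesis
  proof (rule that[of G "\<Prod>t\<in>F. C t"])
    show "ennreal (g m) \<le> G m" for m
      unfolding G_def by (rule SUP_upper2[of "\<lambda>_. 0"]) (auto simp: sh_def E_def)
    show "G m \<le> ennreal ((\<Prod>t\<in>F. C t) * g m)" for m
      unfolding G_def by (intro SUP_least ennreal_leI ub)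
    show "G (m + n) \<le> ennreal (g m) * G n" for m n
      unfolding G_def
    proof (rule SUP_least)
      fix j
      have "g (m + n + sh j) / E j \<le> g m * (g (n + sh j) / E j)"
        using sub[of m "n + sh j"] E[of j] by (simp add: divide_le_cancel add.assoc)
      then have "ennreal (g (m + n + sh j) / E j) \<le> ennreal (g m) * ennreal (g (n + sh j) / E j)"
        using gpos[of m] gpos[of "n + sh j"] E[of j] by (simp add: ennreal_mult[symmetric] ennreal_leI less_imp_le)
      also have "\<dots> \<le> ennreal (g m) * (SUP j. ennreal (g (n + sh j) / E j))"
        by (intro mult_left_mono SUP_upper) auto
      finally show "ennreal (g (m + n + sh j) / E j) \<le> \<dots>" .
    qed
    show "G (t + m) \<le> ennreal (1 + \<eta>) * G m" if t: "t \<in> F" for t m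
      unfolding G_def
    proof (rule SUP_least)
      fix n :: "int^'c \<Rightarrow> nat"
      \<comment> \<open>One more step in direction \<open>t\<close> is again an admissible
        translation, at the price of exactly one factor \<open>1 + \<eta>\<close>.\<close>
      let ?n = "n(t := Suc (n t))"
      have *: "int (Suc j) *s u = int j *s u + u" for j and u :: "int^'c"
        by (simp add: vec_eq_iff algebra_simps)
      have "sh ?n = (\<Sum>u\<in>F. int (n u) *s u + (if u = t then t else 0))"
        unfolding sh_def by (intro sum.cong) (auto simp: * simp del: of_nat_Suc)
      also have "\<dots> = sh n + t" using t F by (simp add: sum.distrib sh_def)
      finally have s: "sh ?n = sh n + t" .
      have "(\<Sum>u\<in>F. ?n u) = (\<Sum>u\<in>F. n u + (if u = t then 1 else 0))" by (intro sum.cong) auto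
      also have "\<dots> = Suc (\<Sum>u\<in>F. n u)" using t F by (simp add: sum.distrib)
      finally have e: "E ?n = (1 + \<eta>) * E n" by (simp add: E_def)
      have "g (t + m + sh n) / E n = (1 + \<eta>) * (g (m + sh ?n) / E ?n)"
        using \<eta> by (simp add: s e add_ac)
      then have "ennreal (g (t + m + sh n) / E n) = ennreal (1 + \<eta>) * ennreal (g (m + sh ?n) / E ?n)"
        using \<eta> gpos[of "m + sh ?n"] E[of ?n]
        by (simp only:) (intro ennreal_mult divide_nonneg_nonneg; simp add: less_imp_le)
      also have "\<dots> \<le> ennreal (1 + \<eta>) * (SUP n. ennreal (g (m + sh n) / E n))"
        by (intro mult_left_mono SUP_upper) auto
      finally show "ennreal (g (t + m + sh n) / E n) \<le> \<dots>" .
    qed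
  qed
qed

lemma conv_indicator_0: "conv (indicator {0}) V k = V k" for V :: "'a::{countable,ab_group_add} \<Rightarrow> ennreal"
proof -
  have "conv (indicator {0}) V k = (\<integral>\<^sup>+l. V k * indicator {k} l \<partial>count_space UNIV)"
    unfolding conv_def by (intro nn_integral_cong) (auto simp: indicator_def)
  then show ?thesis by (simp add: nn_integral_cmult)
qed

lemma conv_add_left: "conv (\<lambda>m. f m + h m) V k = conv f V k + conv h V k"
  by (simp add: conv_def distrib_right nn_integral_add)

lemma conv_add_right: "conv f (\<lambda>m. V m + W m) k = conv f V k + conv f W k"
  by (simp add: conv_def distrib_left nn_integral_add)

lemma conv_const: "conv f (\<lambda>m. c) k = (\<integral>\<^sup>+m. f m \<partial>count_space UNIV) * c"
  using nn_integral_count_space_reindex[OF bij_diff_left, of f k] by (simp add: conv_def nn_integral_multc)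

text \<open>\<Gamma> is the sum of all convolution powers of \<kappa>, obtained as the increasing
  limit of its partial sums. Two estimates cooperate: in the equivalent weight, convolution with
  \<kappa> contracts by some \<open>q < 1\<close>, which makes \<Gamma> summable against
  \<open>g\<close>; the plain mass \<open>r < 1\<close> makes the iterated inequality for
  \<open>U\<close> converge.\<close>

lemma weighted_Neumann:
  fixes g :: "int^'c::finite \<Rightarrow> real" and \<kappa> :: "int^'c \<Rightarrow> ennreal"
  assumes g: "weight g" and gk: "(\<integral>\<^sup>+m. ennreal (g m) * \<kappa> m \<partial>count_space UNIV) < \<infinity>"
    and k1: "(\<integral>\<^sup>+m. \<kappa> m \<partial>count_space UNIV) < 1"
  obtains \<Gamma> where "(\<integral>\<^sup>+m. ennreal (g m) * \<Gamma> m \<partial>count_space UNIV) < \<infinity>"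
    "\<And>U V K k. K < \<infinity> \<Longrightarrow> \<forall>k. U k \<le> K \<Longrightarrow> \<forall>k. U k \<le> V k + conv \<kappa> U k \<Longrightarrow> U k \<le> conv \<Gamma> V k"
proof -
  obtain r where r: "(\<integral>\<^sup>+m. \<kappa> m \<partial>count_space UNIV) = ennreal r" "0 \<le> r" "r < 1"
    using k1 by (cases "\<integral>\<^sup>+m. \<kappa> m \<partial>count_space UNIV") (auto simp: ennreal_less_one_iff)
  \<comment> \<open>The same \<open>e\<close> is the excess factor on \<open>F\<close> and the
    weighted tail off \<open>F\<close>. It gives \<open>(1 + e) * r + e \<le> r + 2 * e\<close>,
    which is the midpoint between \<open>r\<close> and 1.\<close>
  define e where "e = (1 - r) / 4"
  have e: "0 < e" using r by (simp add: e_def)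
  obtain F where F: "finite F" "\<And>S. F \<subseteq> S \<Longrightarrow> (\<integral>\<^sup>+m. indicator (- S) m * (ennreal (g m) * \<kappa> m) \<partial>count_space UNIV) < ennreal e"
    using nn_integral_count_space_tail[OF gk, of "ennreal e"] e by auto
  obtain G C where G: "\<And>m. ennreal (g m) \<le> G m" "\<And>m. G m \<le> ennreal (C * g m)"
    "\<And>t m. t \<in> F \<Longrightarrow> G (t + m) \<le> ennreal (1 + e) * G m" "\<And>m n. G (m + n) \<le> ennreal (g m) * G n"
    by (rule equivalent_weight[OF g F(1) e]) (rule that)
  \<comment> \<open>The growth of \<open>G\<close> under translation by \<open>m\<close>: almost 1
    on \<open>F\<close> by construction of \<open>G\<close>, and \<open>g m\<close> elsewhere, where
    little of the weighted mass of \<kappa> is left.\<close>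
  define w where "w m = (if m \<in> F then ennreal (1 + e) else ennreal (g m))" for m
  define q where "q = (1 + e) * r + e"
  have q: "0 \<le> q" "q < 1"
  proof -
    have "e * r \<le> e * 1" using e r by (intro mult_left_mono) auto
    then have "q \<le> r + e + e" by (simp add: q_def distrib_right)
    also have "\<dots> < 1" using r by (simp add: e_def field_simps)
    finally show "q < 1" .
    show "0 \<le> q" using e r by (simp add: q_def)
  qed
  have wq: "(\<integral>\<^sup>+m. w m * \<kappa> m \<partial>count_space UNIV) \<le> ennreal q"
  proof -
    have "(\<integral>\<^sup>+m. w m * \<kappa> m \<partial>count_space UNIV)
        \<le> (\<integral>\<^sup>+m. ennreal (1 + e) * \<kappa> m + indicator (- F) m * (ennreal (g m) * \<kappa> m) \<partial>count_space UNIV)"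
      by (intro nn_integral_mono) (auto simp: w_def indicator_def)
    also have "\<dots> = ennreal (1 + e) * ennreal r + (\<integral>\<^sup>+m. indicator (- F) m * (ennreal (g m) * \<kappa> m) \<partial>count_space UNIV)"
      by (subst nn_integral_add) (simp_all add: nn_integral_cmult r)
    also have "\<dots> \<le> ennreal (1 + e) * ennreal r + ennreal e" using F(2)[of F] by (intro add_left_mono) auto
    also have "\<dots> = ennreal q"
      using ennreal_linear_comb[of "1 + e" r e 1] e r unfolding q_def by simp
    finally show ?thesis .
  qed
  define \<Gamma> where "\<Gamma> n = ((\<lambda>h k. indicator {0} k + conv \<kappa> h k) ^^ n) (\<lambda>_. 0)" for n
  have \<Gamma>_Suc: "\<Gamma> (Suc n) k = indicator {0} k + conv \<kappa> (\<Gamma> n) k" for n k by (simp add: \<Gamma>_def)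
  have \<Gamma>_mono: "\<Gamma> n k \<le> \<Gamma> (Suc n) k" for n k
  proof (induction n arbitrary: k)
    case 0
    then show ?case by (simp add: \<Gamma>_def)
  next
    case (Suc n)
    have "\<Gamma> (Suc n) k = indicator {0} k + conv \<kappa> (\<Gamma> n) k" by (rule \<Gamma>_Suc)
    also have "\<dots> \<le> indicator {0} k + conv \<kappa> (\<Gamma> (Suc n)) k" by (intro add_left_mono conv_mono Suc)
    also have "\<dots> = \<Gamma> (Suc (Suc n)) k" by (rule \<Gamma>_Suc[symmetric])
    finally show ?case .
  qed
  \<comment> \<open>\<open>c\<close> bounds \<open>G 0\<close>, the weight of the unit mass at 0,
    and \<open>L\<close> solves \<open>L = max c 0 + q * L\<close>, so the bound \<open>L\<close>
    reproduces itself along the recursion. The maximum with 0 is taken because no sign of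
    \<open>C\<close> is recorded.\<close>
  define c where "c = C * g 0"
  define L where "L = max c 0 / (1 - q)"
  have L: "0 \<le> L" "max c 0 + q * L = L" using q by (auto simp: L_def field_simps)
  have G\<Gamma>: "(\<integral>\<^sup>+m. G m * \<Gamma> n m \<partial>count_space UNIV) \<le> ennreal L" for n
  proof (induction n)
    case 0
    then show ?case by (simp add: \<Gamma>_def)
  next
    case (Suc n)
    have G0: "G 0 \<le> ennreal (max c 0)" using G(2)[of 0] by (rule order_trans) (auto simp: c_def intro: ennreal_leI)
    have "(\<integral>\<^sup>+m. G m * \<Gamma> (Suc n) m \<partial>count_space UNIV)
       = (\<integral>\<^sup>+m. G 0 * indicator {0} m + G m * conv \<kappa> (\<Gamma> n) m \<partial>count_space UNIV)"
      by (intro nn_integral_cong) (auto simp: \<Gamma>_Suc distrib_left indicator_def)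
    also have "\<dots> = G 0 + (\<integral>\<^sup>+m. G m * conv \<kappa> (\<Gamma> n) m \<partial>count_space UNIV)"
      by (subst nn_integral_add) (simp_all add: nn_integral_cmult)
    also have "(\<integral>\<^sup>+m. G m * conv \<kappa> (\<Gamma> n) m \<partial>count_space UNIV)
        \<le> (\<integral>\<^sup>+m. w m * \<kappa> m \<partial>count_space UNIV) * (\<integral>\<^sup>+m. G m * \<Gamma> n m \<partial>count_space UNIV)"
      by (rule weight_conv) (use G(3,4) in \<open>auto simp: w_def\<close>)
    also have "\<dots> \<le> ennreal q * ennreal L" by (intro mult_mono wq Suc) auto
    also have "G 0 + ennreal q * ennreal L \<le> ennreal (max c 0) + ennreal q * ennreal L"
      by (intro add_right_mono G0)
    also have "\<dots> = ennreal (max c 0 + q * L)" using q L(1) by (simp add: ennreal_mult)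
    finally show ?case unfolding L(2) by (simp add: add_left_mono)
  qed
  define \<Gamma>s where "\<Gamma>s k = (SUP n. \<Gamma> n k)" for k
  have inc: "incseq (\<lambda>n m. G m * \<Gamma> n m)"
    by (intro incseq_SucI le_funI mult_left_mono \<Gamma>_mono) auto
  have "(\<integral>\<^sup>+m. ennreal (g m) * \<Gamma>s m \<partial>count_space UNIV) \<le> (\<integral>\<^sup>+m. G m * \<Gamma>s m \<partial>count_space UNIV)"
    by (intro nn_integral_mono mult_right_mono G(1)) auto
  also have "\<dots> = (\<integral>\<^sup>+m. (SUP n. G m * \<Gamma> n m) \<partial>count_space UNIV)"
    by (simp add: \<Gamma>s_def SUP_mult_left_ennreal)
  also have "\<dots> = (SUP n. \<integral>\<^sup>+m. G m * \<Gamma> n m \<partial>count_space UNIV)"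
    by (rule nn_integral_monotone_convergence_SUP[OF inc]) simp
  also have "\<dots> \<le> ennreal L" by (intro SUP_least G\<Gamma>)
  finally have fin: "(\<integral>\<^sup>+m. ennreal (g m) * \<Gamma>s m \<partial>count_space UNIV) < \<infinity>"
    by (auto intro: le_less_trans)
  show ?thesis
  proof (rule that[OF fin])
    fix U V :: "int^'c \<Rightarrow> ennreal" and K k
    assume K: "K < \<infinity>" and UK: "\<forall>k. U k \<le> K" and UV: "\<forall>k. U k \<le> V k + conv \<kappa> U k"
    \<comment> \<open>\<open>U\<close> is known only to be bounded, and a convolution acts on a
      constant through its total mass. Hence \<open>r\<close>, and not \<open>q\<close>, governs the
      error, and finiteness of \<open>K\<close> makes it vanish in the limit.\<close>
    have iter: "U k \<le> conv (\<Gamma> n) V k + ennreal r ^ n * K" for n k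
    proof (induction n arbitrary: k)
      case 0
      then show ?case using UK by (simp add: \<Gamma>_def conv_def)
    next
      case (Suc n)
      have "U k \<le> V k + conv \<kappa> U k" by (rule UV[rule_format])
      also have "conv \<kappa> U k \<le> conv \<kappa> (\<lambda>l. conv (\<Gamma> n) V l + ennreal r ^ n * K) k" by (intro conv_mono Suc)
      also have "\<dots> = conv (conv \<kappa> (\<Gamma> n)) V k + ennreal r * (ennreal r ^ n * K)"
        by (simp add: conv_add_right conv_const conv_assoc r)
      also have "V k + (conv (conv \<kappa> (\<Gamma> n)) V k + ennreal r * (ennreal r ^ n * K))
          = conv (\<Gamma> (Suc n)) V k + ennreal r ^ Suc n * K"
        using conv_add_left[of "indicator {0}" "conv \<kappa> (\<Gamma> n)" V k]
        by (simp add: \<Gamma>_Suc[abs_def] conv_indicator_0 add.assoc mult.assoc)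
      finally show ?case by (simp add: add_left_mono)
    qed
    obtain K' where K': "K = ennreal K'" "0 \<le> K'" using K by (cases K) auto
    have bound: "U k \<le> conv \<Gamma>s V k + ennreal (r ^ n * K')" for n
    proof -
      have "conv (\<Gamma> n) V k \<le> conv \<Gamma>s V k"
        unfolding conv_def \<Gamma>s_def by (intro nn_integral_mono mult_right_mono SUP_upper) auto
      moreover have "ennreal r ^ n * K = ennreal (r ^ n * K')"
        using r K' by (simp add: ennreal_mult ennreal_power)
      ultimately show ?thesis using iter[of k n] by (metis add_right_mono order_trans)
    qed
    have "(\<lambda>n. r ^ n * K') \<longlonglongrightarrow> 0 * K'" using r by (intro tendsto_mult tendsto_const LIMSEQ_power_zero) auto
    then have "(\<lambda>n. conv \<Gamma>s V k + ennreal (r ^ n * K')) \<longlonglongrightarrow> conv \<Gamma>s V k + ennreal 0"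
      by (intro tendsto_add tendsto_const tendsto_ennrealI) simp
    then have "U k \<le> conv \<Gamma>s V k + ennreal 0"
      by (rule tendsto_lowerbound) (auto simp: bound)
    then show "U k \<le> conv \<Gamma>s V k" by simp
  qed
qed

section \<open>Cutoffs and commutators\<close>

text \<open>The sup norm on Z^c. Its balls are boxes, hence products of intervals with an explicit
  number of points.\<close>

definition vmax :: "int^'c::finite \<Rightarrow> int" where
  "vmax j = Max (range (\<lambda>i. \<bar>j $ i\<bar>))"

lemma vmax_le_iff: "vmax j \<le> n \<longleftrightarrow> (\<forall>i. \<bar>j $ i\<bar> \<le> n)"
  unfolding vmax_def by (subst Max_le_iff) auto

lemma vmax_ge: "\<bar>j $ i\<bar> \<le> vmax j"
  using vmax_le_iff[of j "vmax j"] by simp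

lemma vmax_nonneg: "0 \<le> vmax j"
  using vmax_ge[of j undefined] by linarith

lemma vmax_0 [simp]: "vmax 0 = 0"
  by (simp add: vmax_def)

lemma vmax_triangle: "vmax (j + k) \<le> vmax j + vmax k"
  unfolding vmax_le_iff
proof
  fix i
  have "\<bar>(j + k) $ i\<bar> \<le> \<bar>j $ i\<bar> + \<bar>k $ i\<bar>" by simp
  also have "\<dots> \<le> vmax j + vmax k" by (intro add_mono vmax_ge)
  finally show "\<bar>(j + k) $ i\<bar> \<le> vmax j + vmax k" .
qed

lemma vmax_minus: "vmax (- j) = vmax j"
  by (simp add: vmax_def)

lemma vmax_diff: "vmax (j - k) \<le> vmax j + vmax k"
  using vmax_triangle[of j "- k"] by (simp add: vmax_minus)

definition int_box :: "nat \<Rightarrow> (int^'c::finite) set" where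
  "int_box n = {j. vmax j \<le> int n}"

lemma int_box_eq: "int_box n = (\<lambda>f. \<chi> i. f i) ` (PiE UNIV (\<lambda>_. {- int n..int n}))"
proof (rule set_eqI)
  fix j :: "int^'c"
  have "(\<forall>i. \<bar>j $ i\<bar> \<le> int n) \<longleftrightarrow> ($) j \<in> PiE UNIV (\<lambda>_. {- int n..int n})"
  proof -
    have "\<bar>a\<bar> \<le> int n \<longleftrightarrow> a \<in> {- int n..int n}" for a by auto
    then show ?thesis by (simp only: PiE_iff) auto
  qed
  also have "\<dots> \<longleftrightarrow> j \<in> (\<lambda>f. \<chi> i. f i) ` (PiE UNIV (\<lambda>_. {- int n..int n}))"
  proof
    assume "($) j \<in> PiE UNIV (\<lambda>_. {- int n..int n})"
    then have "(\<chi> i. j $ i) \<in> (\<lambda>f. \<chi> i. f i) ` (PiE UNIV (\<lambda>_. {- int n..int n}))" by (rule imageI)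
    then show "j \<in> (\<lambda>f. \<chi> i. f i) ` (PiE UNIV (\<lambda>_. {- int n..int n}))" by simp
  next
    assume "j \<in> (\<lambda>f. \<chi> i. f i) ` (PiE UNIV (\<lambda>_. {- int n..int n}))"
    then obtain f where "f \<in> PiE UNIV (\<lambda>_. {- int n..int n})" "j = (\<chi> i. f i)" by (rule imageE)
    moreover from this have "($) j = f" by (simp add: fun_eq_iff)
    ultimately show "($) j \<in> PiE UNIV (\<lambda>_. {- int n..int n})" by simp
  qed
  finally show "j \<in> int_box n \<longleftrightarrow> j \<in> (\<lambda>f. \<chi> i. f i) ` (PiE UNIV (\<lambda>_. {- int n..int n}))"
    by (simp add: int_box_def vmax_le_iff)
qed

lemma finite_int_box [simp]: "finite (int_box n)"
  unfolding int_box_eq by (intro finite_imageI finite_PiE) auto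

lemma card_int_box: "card (int_box n :: (int^'c::finite) set) = (2 * n + 1) ^ CARD('c)"
proof -
  have "card (int_box n :: (int^'c) set) = card (PiE (UNIV :: 'c set) (\<lambda>_. {- int n..int n}))"
    unfolding int_box_eq by (intro card_image) (auto simp: inj_on_def vec_eq_iff fun_eq_iff)
  also have "\<dots> = (2 * n + 1) ^ CARD('c)" by (simp add: card_PiE nat_add_distrib nat_mult_distrib)
  finally show ?thesis .
qed

text \<open>For positive \<open>N\<close> a tent of height 1 with Lipschitz constant 1/N, supported
  in the box of radius \<open>N\<close>. Its value 1 at the centre later lets a single cell be
  recovered from its cutoff.\<close>

definition hat :: "nat \<Rightarrow> int^'c::finite \<Rightarrow> real" where
  "hat N j = max 0 (1 - real_of_int (vmax j) / real N)"

lemma hat_nonneg: "0 \<le> hat N j" and hat_le_1: "hat N j \<le> 1" and hat_0: "hat N 0 = 1"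
  using vmax_nonneg[of j] by (auto simp: hat_def)

lemma hat_support: "hat N j \<noteq> 0 \<Longrightarrow> 0 < N \<Longrightarrow> j \<in> int_box N"
  by (auto simp: hat_def int_box_def max_def field_simps split: if_splits)

lemma hat_Lipschitz: "0 < N \<Longrightarrow> \<bar>hat N i - hat N j\<bar> \<le> min 1 (real_of_int (vmax (i - j)) / real N)"
proof -
  assume N: "0 < N"
  have "vmax i \<le> vmax (i - j) + vmax j" using vmax_triangle[of "i - j" j] by simp
  moreover have "vmax j \<le> vmax (i - j) + vmax i"
    using vmax_triangle[of "j - i" i] vmax_minus[of "i - j"] by simp
  ultimately have "\<bar>real_of_int (vmax i) - real_of_int (vmax j)\<bar> \<le> real_of_int (vmax (i - j))" by linarith
  then have "\<bar>real_of_int (vmax i) / N - real_of_int (vmax j) / N\<bar> \<le> real_of_int (vmax (i - j)) / N"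
    using N by (simp add: diff_divide_distrib[symmetric] divide_right_mono)
  then have "\<bar>hat N i - hat N j\<bar> \<le> real_of_int (vmax (i - j)) / N" unfolding hat_def by linarith
  moreover have "\<bar>hat N i - hat N j\<bar> \<le> 1"
    using hat_nonneg[of N i] hat_nonneg[of N j] hat_le_1[of N i] hat_le_1[of N j] by linarith
  ultimately show ?thesis by simp
qed

text \<open>The factor that turns the translates of \<open>hat N\<close> into a partition of unity;
  its inverse is the overlap number. The type argument carries the dimension.\<close>

definition hat_const :: "'c::finite itself \<Rightarrow> nat \<Rightarrow> real" where
  "hat_const _ N = 1 / (\<Sum>j\<in>(int_box N :: (int^'c) set). hat N j)"

lemma hat_sum_pos: "0 < (\<Sum>j\<in>(int_box N :: (int^'c::finite) set). hat N j)"
proof (rule sum_pos2[of _ 0])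
  show "0 \<in> (int_box N :: (int^'c) set)" by (simp add: int_box_def)
qed (auto simp: hat_0 hat_nonneg)

lemma hat_const_pos: "0 < hat_const TYPE('c::finite) N"
  using hat_sum_pos by (simp add: hat_const_def)

lemma hat_partition:
  fixes s :: "int^'c::finite"
  assumes N: "0 < N"
  shows "(\<integral>\<^sup>+l. ennreal (hat_const TYPE('c) N * hat N (s - l)) \<partial>count_space UNIV) = 1"
proof -
  have "(\<integral>\<^sup>+l. ennreal (hat_const TYPE('c) N * hat N (s - l)) \<partial>count_space UNIV)
     = (\<integral>\<^sup>+j. ennreal (hat_const TYPE('c) N * hat N (j :: int^'c)) \<partial>count_space UNIV)"
    by (rule nn_integral_count_space_reindex[OF bij_diff_left])
  also have "\<dots> = (\<Sum>j\<in>(int_box N :: (int^'c) set). ennreal (hat_const TYPE('c) N * hat N j))"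
  proof -
    have "hat N j = 0" if "j \<notin> int_box N" for j :: "int^'c" using hat_support[OF _ N] that by blast
    then show ?thesis by (intro nn_integral_count_space') auto
  qed
  also have "\<dots> = ennreal (\<Sum>j\<in>(int_box N :: (int^'c) set). hat_const TYPE('c) N * hat N j)"
    using hat_const_pos[where 'c='c, of N] hat_nonneg by (intro sum_ennreal) (auto intro!: mult_nonneg_nonneg)
  also have "(\<Sum>j\<in>(int_box N :: (int^'c) set). hat_const TYPE('c) N * hat N j) = 1"
    using hat_sum_pos[where 'c='c, of N] unfolding sum_distrib_left[symmetric] hat_const_def by simp
  finally show ?thesis by simp
qed

text \<open>The doubling property of boxes: the number of cutoffs that meet a given one is comparable to the
  overlap number of the partition, uniformly in the scale.\<close>
lemma hat_const_bound:
  assumes M: "0 < M"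
  shows "hat_const TYPE('c::finite) (2 * M) * real (card (int_box (2 * (2 * M)) :: (int^'c) set)) \<le> 2 * 4 ^ CARD('c)"
proof -
  let ?S = "\<Sum>j\<in>(int_box (2 * M) :: (int^'c) set). hat (2 * M) j"
  have sub: "(int_box M :: (int^'c) set) \<subseteq> int_box (2 * M)" by (auto simp: int_box_def)
  have "real (card (int_box (2 * (2 * M)) :: (int^'c) set)) = real (8 * M + 1) ^ CARD('c)"
    by (simp add: card_int_box)
  \<comment> \<open>This is the inequality 8M + 1 <= 4 (2M + 1): four times the side of the box of
    half the radius, on which the tent is at least 1/2.\<close>
  also have "\<dots> \<le> (4 * real (2 * M + 1)) ^ CARD('c)" by (intro power_mono) auto
  also have "\<dots> = 4 ^ CARD('c) * real (card (int_box M :: (int^'c) set))"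
    by (simp only: card_int_box power_mult_distrib of_nat_power)
  also have "real (card (int_box M :: (int^'c) set)) = 2 * (\<Sum>j\<in>(int_box M :: (int^'c) set). 1/2)" by simp
  also have "(\<Sum>j\<in>(int_box M :: (int^'c) set). 1/2) \<le> (\<Sum>j\<in>(int_box M :: (int^'c) set). hat (2 * M) j)"
  proof (rule sum_mono)
    fix j :: "int^'c" assume "j \<in> int_box M"
    then have "real_of_int (vmax j) \<le> real M" by (simp add: int_box_def)
    then show "1 / 2 \<le> hat (2 * M) j" using M by (simp add: hat_def field_simps max_def)
  qed
  also have "\<dots> \<le> ?S" by (rule sum_mono2[OF _ sub]) (auto simp: hat_nonneg)
  finally have "real (card (int_box (2 * (2 * M)) :: (int^'c) set)) \<le> 4 ^ CARD('c) * (2 * ?S)" by simp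
  then show ?thesis
    using hat_sum_pos[where 'c='c, of "2 * M"] by (simp add: hat_const_def field_simps)
qed

text \<open>An estimate for the change of the cutoff at \<open>k\<close> under a jump by
  \<open>d\<close> from a point in the support of the cutoff at \<open>l\<close>, depending only on
  \<open>d\<close> and \<open>m = k - l\<close>. There are two boxes because either end of the jump
  may meet the support of the cutoff at \<open>k\<close>.\<close>

definition overlap :: "nat \<Rightarrow> int^'c::finite \<Rightarrow> int^'c \<Rightarrow> real" where
  "overlap N d m = min 1 (real_of_int (vmax d) / real N) * (indicator (int_box (2 * N)) m + indicator (int_box (2 * N)) (m - d))"

lemma overlap_nonneg: "0 \<le> overlap N d m"
  using vmax_nonneg[of d] by (simp add: overlap_def)

text \<open>The size of the difference is the Lipschitz bound. If it is nonzero, \<open>s\<close> or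
  \<open>s + d\<close> lies within \<open>N\<close> of \<open>k\<close>, while \<open>s\<close> lies
  within \<open>N\<close> of \<open>l\<close>; subtracting puts \<open>k - l\<close> or
  \<open>k - l - d\<close> into the box of radius \<open>2 * N\<close>.\<close>

lemma hat_commutator_bound:
  assumes N: "0 < N" and supp: "hat N (s - l) \<noteq> 0"
  shows "\<bar>hat N (s - k) - hat N (s + d - k)\<bar> \<le> overlap N d (k - l)"
proof (cases "hat N (s - k) = 0 \<and> hat N (s + d - k) = 0")
  case True
  then show ?thesis using overlap_nonneg[of N d "k - l"] by simp
next
  case False
  have sl: "vmax (s - l) \<le> int N" using hat_support[OF supp N] by (simp add: int_box_def)
  let ?\<mu> = "min 1 (real_of_int (vmax d) / real N)"
  have \<mu>: "0 \<le> ?\<mu>" using vmax_nonneg[of d] by simp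
  have "vmax ((s - k) - (s + d - k)) = vmax d" using vmax_minus[of d] by simp
  then have "\<bar>hat N (s - k) - hat N (s + d - k)\<bar> \<le> ?\<mu>"
    using hat_Lipschitz[OF N, of "s - k" "s + d - k"] by simp
  also have "?\<mu> * 1 \<le> overlap N d (k - l)"
    unfolding overlap_def
  proof (rule mult_left_mono[OF _ \<mu>])
    from False consider "s - k \<in> int_box N" | "s + d - k \<in> int_box N" using hat_support[OF _ N] by blast
    then show "1 \<le> (indicator (int_box (2 * N)) (k - l) + indicator (int_box (2 * N)) (k - l - d) :: real)"
    proof cases
      case 1
      then have "vmax ((s - l) - (s - k)) \<le> 2 * int N" using vmax_diff[of "s - l" "s - k"] sl by (simp add: int_box_def)
      then have "k - l \<in> int_box (2 * N)" by (simp add: int_box_def)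
      then show ?thesis by simp
    next
      case 2
      then have "vmax ((s - l) - (s + d - k)) \<le> 2 * int N" using vmax_diff[of "s - l" "s + d - k"] sl by (simp add: int_box_def)
      moreover have "(s - l) - (s + d - k) = k - l - d" by simp
      ultimately have "k - l - d \<in> int_box (2 * N)" by (simp add: int_box_def)
      then show ?thesis by simp
    qed
  qed
  finally show ?thesis by simp
qed

definition cutoff :: "nat \<Rightarrow> int^'c::finite \<Rightarrow> (real^'c \<Rightarrow> complex) \<Rightarrow> (real^'c \<Rightarrow> complex)" where
  "cutoff N k = cell_mult (\<lambda>j. hat N (j - k))"

lemma cutoff_Lp:
  assumes "1 \<le> p" "x \<in> Lp_set lborel p"
  shows "cutoff N k x \<in> Lp_set lborel p"
  unfolding cutoff_def by (rule cell_mult_Lp[OF assms, of _ 1]) (simp add: hat_nonneg hat_le_1)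

lemma cell_norm_cutoff:
  assumes "1 \<le> p" "x \<in> Lp_set lborel p"
  shows "cell_norm p (cutoff N k x) i = hat N (i - k) * cell_norm p x i"
  unfolding cutoff_def by (simp add: cell_norm_cell_mult[OF assms] hat_nonneg)

text \<open>The sequence gamma of the overview: the contributions of all diagonals \<open>d\<close>
  of a dominating sequence \<alpha>, normalised by the partition of unity.\<close>

definition comm_kernel :: "nat \<Rightarrow> (int^'c::finite \<Rightarrow> ennreal) \<Rightarrow> int^'c \<Rightarrow> ennreal" where
  "comm_kernel N \<alpha> m = (\<integral>\<^sup>+d. \<alpha> d * ennreal (hat_const TYPE('c) N * overlap N d m) \<partial>count_space UNIV)"

text \<open>On cell \<open>i\<close> the multiplier is the constant \<psi>(i), which commutes with
  \<open>A\<close>. The commutator there is thus \<open>A\<close> applied to a function in which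
  only differences of \<psi> occur.\<close>

lemma commutator_cell_norm:
  assumes p: "1 \<le> p" and A: "bounded_op lborel p A" and x: "x \<in> Lp_set lborel p" and B: "\<And>j. \<bar>\<psi> j\<bar> \<le> B"
  shows "cell_norm p (\<lambda>t. A (cell_mult \<psi> x) t - cell_mult \<psi> (A x) t) i
    = cell_norm p (A (cell_mult (\<lambda>j. \<psi> j - \<psi> i) x)) i"
proof -
  let ?c = "complex_of_real (\<psi> i)"
  have mL: "cell_mult \<psi> x \<in> Lp_set lborel p" by (rule cell_mult_Lp[OF p x B])
  have *: "cell_mult (\<lambda>j. \<psi> j - \<psi> i) x = (\<lambda>t. cell_mult \<psi> x t - ?c * x t)"
    by (simp add: cell_mult_def fun_eq_iff left_diff_distrib)
  have eq: "AE t in lborel. A (cell_mult (\<lambda>j. \<psi> j - \<psi> i) x) t = A (cell_mult \<psi> x) t - ?c * A x t"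
  proof -
    have "AE t in lborel. A (\<lambda>t. cell_mult \<psi> x t - ?c * x t) t = A (cell_mult \<psi> x) t - ?c * A x t"
      using bounded_op_diff[OF p A mL lpnorm_cmult(1)[OF p x, of ?c]] bounded_op_cmult[OF A x, of ?c]
      by eventually_elim simp
    then show ?thesis unfolding * .
  qed
  have AL: "(\<lambda>t. A (cell_mult \<psi> x) t - ?c * A x t) \<in> Lp_set lborel p"
    by (intro lpnorm_diff(1) lpnorm_cmult(1) p bounded_op_Lp[OF A] mL x)
  have "cell_norm p (A (cell_mult (\<lambda>j. \<psi> j - \<psi> i) x)) i = cell_norm p (\<lambda>t. A (cell_mult \<psi> x) t - ?c * A x t) i"
  proof (rule cell_norm_AE_cong[OF p AL _ eq])
    have "cell_mult (\<lambda>j. \<psi> j - \<psi> i) x \<in> Lp_set lborel p"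
      using B by (intro cell_mult_Lp[OF p x, of _ "B + B"]) (meson abs_triangle_ineq4 add_mono order_trans)
    then show "A (cell_mult (\<lambda>j. \<psi> j - \<psi> i) x) \<in> borel_measurable lborel"
      by (intro Lp_measurable[OF bounded_op_Lp[OF A]])
  qed
  also have "\<dots> = cell_norm p (\<lambda>t. A (cell_mult \<psi> x) t - cell_mult \<psi> (A x) t) i"
    unfolding cell_norm_def
    by (rule lpnorm_space_cong(2)[OF p, symmetric, OF piece_Lp(1)[OF p AL]])
       (simp add: piece_def cell_mult_def cell_add space_cube_iff)
  finally show ?thesis by simp
qed

text \<open>A partition of unity is inserted between \<open>A\<close> and \<open>x\<close>. On the
  support of the cutoff at \<open>l\<close>, the difference of the values of the cutoff at
  \<open>k\<close> is bounded by \<open>overlap\<close>, independently of the cell. What remains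
  dominates the cell norms by translated cell norms of the functions \<open>cutoff N l x\<close>,
  and Minkowski's inequality passes to norms.\<close>

lemma commutator_cutoff:
  fixes \<alpha> :: "int^'c::finite \<Rightarrow> ennreal"
  assumes p: "1 \<le> p" and A: "bounded_op lborel p A" and dom: "dominated_op p A \<alpha>"
    and N: "0 < N" and x: "x \<in> Lp_set lborel p"
  shows "ennreal (lpnorm lborel p (\<lambda>t. A (cutoff N k x) t - cutoff N k (A x) t))
    \<le> conv (comm_kernel N \<alpha>) (\<lambda>l. ennreal (lpnorm lborel p (cutoff N l x))) k"
proof -
  let ?c = "hat_const TYPE('c) N"
  let ?w = "\<lambda>t. A (cutoff N k x) t - cutoff N k (A x) t"
  let ?a = "\<lambda>\<tau>::(int^'c) \<times> (int^'c). \<alpha> (fst \<tau>) * ennreal (?c * overlap N (fst \<tau>) (k - snd \<tau>))"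
  have c: "0 < ?c" by (rule hat_const_pos)
  have wL: "?w \<in> Lp_set lborel p"
    by (intro lpnorm_diff(1) p bounded_op_Lp[OF A] cutoff_Lp x)
  have "ennreal (lpnorm lborel p ?w) \<le> (\<integral>\<^sup>+\<tau>. ?a \<tau> * ennreal (lpnorm lborel p (cutoff N (snd \<tau>) x)) \<partial>count_space UNIV)"
  \<comment> \<open>The index is a pair (d, l): the diagonal \<open>d\<close> of \<open>A\<close>
    acts as the translation, and \<open>l\<close> names the inserted cutoff.\<close>
  proof (rule Minkowski_cells[OF p wL cutoff_Lp[OF p x], where d = fst])
    fix i
    let ?\<psi> = "\<lambda>j. hat N (j - k) - hat N (i - k)"
    have b1: "\<bar>hat N (j - k)\<bar> \<le> 1" for j by (simp add: hat_nonneg hat_le_1)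
    have mL: "cell_mult ?\<psi> x \<in> Lp_set lborel p"
    proof (rule cell_mult_Lp[OF p x, of _ 1])
      show "\<bar>?\<psi> j\<bar> \<le> 1" for j
        using hat_nonneg[of N "j - k"] hat_nonneg[of N "i - k"] hat_le_1[of N "j - k"] hat_le_1[of N "i - k"] by linarith
    qed
    have "ennreal (cell_norm p ?w i) = ennreal (cell_norm p (A (cell_mult ?\<psi> x)) i)"
      unfolding cutoff_def by (subst commutator_cell_norm[OF p A x b1]) simp
    also have "\<dots> \<le> (\<integral>\<^sup>+s. \<alpha> (i - s) * ennreal (cell_norm p (cell_mult ?\<psi> x) s) \<partial>count_space UNIV)"
      using dom mL unfolding dominated_op_def by blast
    also have "\<dots> = (\<integral>\<^sup>+d. \<alpha> d * ennreal (cell_norm p (cell_mult ?\<psi> x) (i - d)) \<partial>count_space UNIV)"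
      using nn_integral_count_space_reindex[OF bij_diff_left, of "\<lambda>s. \<alpha> (i - s) * ennreal (cell_norm p (cell_mult ?\<psi> x) s)" i]
      by simp
    also have "\<dots> \<le> (\<integral>\<^sup>+d. \<integral>\<^sup>+l. ?a (d, l) * ennreal (cell_norm p (cutoff N l x) (i - d)) \<partial>count_space UNIV \<partial>count_space UNIV)"
    proof (rule nn_integral_mono)
      fix d
      let ?P = "cell_norm p x (i - d)"
      have P: "0 \<le> ?P" by (rule cell_norm_nonneg)
      have pw: "\<bar>?\<psi> (i - d)\<bar> * ?P * (?c * hat N (i - d - l)) \<le> (?c * overlap N d (k - l)) * (hat N (i - d - l) * ?P)" for l
      proof (cases "hat N (i - d - l) = 0")
        case False
        have "\<bar>?\<psi> (i - d)\<bar> \<le> overlap N d (k - l)"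
          using hat_commutator_bound[OF N False, of k d] by simp
        from mult_right_mono[OF this, of "?P * (?c * hat N (i - d - l))"] show ?thesis
          using P c hat_nonneg[of N "i - d - l"] by (simp add: mult_ac)
      qed simp
      have "\<alpha> d * ennreal (cell_norm p (cell_mult ?\<psi> x) (i - d))
         = \<alpha> d * ennreal (\<bar>?\<psi> (i - d)\<bar> * ?P) * (\<integral>\<^sup>+l. ennreal (?c * hat N (i - d - l)) \<partial>count_space UNIV)"
        by (simp add: hat_partition[OF N] cell_norm_cell_mult[OF p x])
      also have "\<dots> = (\<integral>\<^sup>+l. \<alpha> d * ennreal (\<bar>?\<psi> (i - d)\<bar> * ?P) * ennreal (?c * hat N (i - d - l)) \<partial>count_space UNIV)"
        by (simp add: nn_integral_cmult)
      also have "\<dots> \<le> (\<integral>\<^sup>+l. ?a (d, l) * ennreal (cell_norm p (cutoff N l x) (i - d)) \<partial>count_space UNIV)"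
      proof (rule nn_integral_mono)
        fix l
        have "ennreal (\<bar>?\<psi> (i - d)\<bar> * ?P) * ennreal (?c * hat N (i - d - l))
           = ennreal (\<bar>?\<psi> (i - d)\<bar> * ?P * (?c * hat N (i - d - l)))"
          using P c hat_nonneg by (intro ennreal_mult[symmetric] mult_nonneg_nonneg) auto
        also have "\<dots> \<le> ennreal ((?c * overlap N d (k - l)) * (hat N (i - d - l) * ?P))"
          by (rule ennreal_leI[OF pw])
        also have "\<dots> = ennreal (?c * overlap N d (k - l)) * ennreal (cell_norm p (cutoff N l x) (i - d))"
          unfolding cell_norm_cutoff[OF p x]
          using P c hat_nonneg overlap_nonneg by (intro ennreal_mult mult_nonneg_nonneg) auto
        finally show "\<alpha> d * ennreal (\<bar>?\<psi> (i - d)\<bar> * ?P) * ennreal (?c * hat N (i - d - l))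
            \<le> ?a (d, l) * ennreal (cell_norm p (cutoff N l x) (i - d))"
          by (simp add: mult.assoc mult_left_mono)
      qed
      finally show "\<alpha> d * ennreal (cell_norm p (cell_mult ?\<psi> x) (i - d))
          \<le> (\<integral>\<^sup>+l. ?a (d, l) * ennreal (cell_norm p (cutoff N l x) (i - d)) \<partial>count_space UNIV)" .
    qed
    also have "\<dots> = (\<integral>\<^sup>+\<tau>. ?a \<tau> * ennreal (cell_norm p (cutoff N (snd \<tau>) x) (i - fst \<tau>)) \<partial>count_space UNIV)"
      using nn_integral_fst_count_space[of "\<lambda>\<tau>. ?a \<tau> * ennreal (cell_norm p (cutoff N (snd \<tau>) x) (i - fst \<tau>))"] by simp
    finally show "ennreal (cell_norm p ?w i) \<le> \<dots>" .
  qed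
  also have "\<dots> = (\<integral>\<^sup>+d. \<integral>\<^sup>+l. ?a (d, l) * ennreal (lpnorm lborel p (cutoff N l x)) \<partial>count_space UNIV \<partial>count_space UNIV)"
    by (subst nn_integral_fst_count_space[symmetric]) simp
  also have "\<dots> = (\<integral>\<^sup>+l. \<integral>\<^sup>+d. ?a (d, l) * ennreal (lpnorm lborel p (cutoff N l x)) \<partial>count_space UNIV \<partial>count_space UNIV)"
    by (rule nn_integral_count_space_swap)
  also have "\<dots> = conv (comm_kernel N \<alpha>) (\<lambda>l. ennreal (lpnorm lborel p (cutoff N l x))) k"
    by (simp add: conv_def comm_kernel_def nn_integral_multc)
  finally show ?thesis .
qed

section \<open>Localisation of lower bounds\<close>

lemma overlap_ennreal:
  assumes "0 \<le> c"
  shows "ennreal (c * overlap N d m) = ennreal (c * min 1 (real_of_int (vmax d) / real N))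
     * (indicator (int_box (2 * N)) m + indicator (int_box (2 * N)) (m - d))"
proof -
  have "0 \<le> c * min 1 (real_of_int (vmax d) / real N)" using assms vmax_nonneg[of d] by simp
  then show ?thesis
    unfolding overlap_def mult.assoc[symmetric]
    by (subst ennreal_mult) (auto simp: indicator_def)
qed

text \<open>Used with \<open>h = g\<close> for finiteness of the weighted sum and with
  \<open>h = 1\<close> for smallness of the total mass. Each diagonal \<open>d\<close> contributes
  the sum of \<open>h\<close> over the box and over its translate by \<open>d\<close>.\<close>

lemma nn_integral_weighted_comm_kernel:
  fixes \<alpha> h :: "int^'c::finite \<Rightarrow> ennreal"
  shows "(\<integral>\<^sup>+m. h m * comm_kernel N \<alpha> m \<partial>count_space UNIV)
    = (\<integral>\<^sup>+d. \<alpha> d * ennreal (hat_const TYPE('c) N * min 1 (real_of_int (vmax d) / real N))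
       * ((\<Sum>m\<in>int_box (2 * N). h m) + (\<Sum>m\<in>int_box (2 * N). h (m + d))) \<partial>count_space UNIV)"
proof -
  let ?c = "hat_const TYPE('c) N"
  let ?\<mu> = "\<lambda>d. min 1 (real_of_int (vmax d) / real N)"
  let ?B = "int_box (2 * N) :: (int^'c) set"
  have c: "0 \<le> ?c" using hat_const_pos[where 'c='c, of N] by simp
  have "(\<integral>\<^sup>+m. h m * comm_kernel N \<alpha> m \<partial>count_space UNIV)
     = (\<integral>\<^sup>+m. \<integral>\<^sup>+d. h m * (\<alpha> d * ennreal (?c * overlap N d m)) \<partial>count_space UNIV \<partial>count_space UNIV)"
    by (simp add: comm_kernel_def nn_integral_cmult)
  also have "\<dots> = (\<integral>\<^sup>+d. \<integral>\<^sup>+m. h m * (\<alpha> d * ennreal (?c * overlap N d m)) \<partial>count_space UNIV \<partial>count_space UNIV)"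
    by (rule nn_integral_count_space_swap)
  also have "\<dots> = (\<integral>\<^sup>+d. \<alpha> d * ennreal (?c * ?\<mu> d) * ((\<Sum>m\<in>?B. h m) + (\<Sum>m\<in>?B. h (m + d))) \<partial>count_space UNIV)"
  proof (rule nn_integral_cong)
    fix d
    have 1: "(\<integral>\<^sup>+m. h m * indicator ?B m \<partial>count_space UNIV) = (\<Sum>m\<in>?B. h m)"
      by (simp add: nn_integral_indicator_finite)
    have "(\<integral>\<^sup>+m. h m * indicator ?B (m - d) \<partial>count_space UNIV) = (\<integral>\<^sup>+m. h (m + d) * indicator ?B m \<partial>count_space UNIV)"
      using nn_integral_count_space_reindex[OF bij_diff_right, of "\<lambda>m. h (m + d) * indicator ?B m" d] by simp
    then have 2: "(\<integral>\<^sup>+m. h m * indicator ?B (m - d) \<partial>count_space UNIV) = (\<Sum>m\<in>?B. h (m + d))"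
      by (simp add: nn_integral_indicator_finite)
    have "(\<integral>\<^sup>+m. h m * (\<alpha> d * ennreal (?c * overlap N d m)) \<partial>count_space UNIV)
        = (\<integral>\<^sup>+m. \<alpha> d * ennreal (?c * ?\<mu> d) * (h m * indicator ?B m + h m * indicator ?B (m - d)) \<partial>count_space UNIV)"
      unfolding overlap_ennreal[OF c] by (intro nn_integral_cong) (simp only: distrib_left mult_ac)
    also have "\<dots> = \<alpha> d * ennreal (?c * ?\<mu> d) * (\<integral>\<^sup>+m. h m * indicator ?B m + h m * indicator ?B (m - d) \<partial>count_space UNIV)"
      by (rule nn_integral_cmult) simp
    also have "(\<integral>\<^sup>+m. h m * indicator ?B m + h m * indicator ?B (m - d) \<partial>count_space UNIV) = (\<Sum>m\<in>?B. h m) + (\<Sum>m\<in>?B. h (m + d))"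
      by (subst nn_integral_add) (simp_all only: 1 2 measurable_count_space_eq1 borel_measurable_count_space, simp_all)
    finally show "(\<integral>\<^sup>+m. h m * (\<alpha> d * ennreal (?c * overlap N d m)) \<partial>count_space UNIV)
      = \<alpha> d * ennreal (?c * ?\<mu> d) * ((\<Sum>m\<in>?B. h m) + (\<Sum>m\<in>?B. h (m + d)))" .
  qed
  finally show ?thesis .
qed

text \<open>Submultiplicativity moves the weight of a translated box onto the diagonal
  \<open>d\<close>. The remaining sum of \<open>g\<close> over the box grows with \<open>N\<close>,
  which is harmless because only finiteness at a fixed scale is claimed.\<close>

lemma comm_kernel_weighted_finite:
  fixes g :: "int^'c::finite \<Rightarrow> real"
  assumes g: "weight g" and \<alpha>: "(\<integral>\<^sup>+m. ennreal (g m) * \<alpha> m \<partial>count_space UNIV) < \<infinity>"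
  shows "(\<integral>\<^sup>+m. ennreal (g m) * comm_kernel N \<alpha> m \<partial>count_space UNIV) < \<infinity>"
proof -
  let ?c = "hat_const TYPE('c) N"
  let ?B = "int_box (2 * N) :: (int^'c) set"
  let ?K = "\<Sum>m\<in>?B. ennreal (g m)"
  have c: "0 \<le> ?c" using hat_const_pos[where 'c='c, of N] by simp
  have K: "?K < \<infinity>" by simp
  have "(\<integral>\<^sup>+m. ennreal (g m) * comm_kernel N \<alpha> m \<partial>count_space UNIV)
     \<le> (\<integral>\<^sup>+d. ennreal (g d) * \<alpha> d * (ennreal ?c * (?K + ?K)) \<partial>count_space UNIV)"
    unfolding nn_integral_weighted_comm_kernel
  proof (rule nn_integral_mono)
    fix d
    have g1: "1 \<le> ennreal (g d)" using weight_ge_1[OF g, of d] by simp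
    have "(\<Sum>m\<in>?B. ennreal (g (m + d))) \<le> (\<Sum>m\<in>?B. ennreal (g m) * ennreal (g d))"
      by (intro sum_mono weight_submult g)
    also have "\<dots> = ennreal (g d) * ?K" by (subst sum_distrib_left) (simp only: mult.commute)
    finally have 1: "(\<Sum>m\<in>?B. ennreal (g (m + d))) \<le> ennreal (g d) * ?K" .
    have 2: "?K \<le> ennreal (g d) * ?K" using mult_right_mono[OF g1, of ?K] by simp
    have "?c * min 1 (real_of_int (vmax d) / real N) \<le> ?c * 1" using c by (intro mult_left_mono) auto
    then have "\<alpha> d * ennreal (?c * min 1 (real_of_int (vmax d) / real N)) * (?K + (\<Sum>m\<in>?B. ennreal (g (m + d))))
       \<le> \<alpha> d * ennreal ?c * (ennreal (g d) * ?K + ennreal (g d) * ?K)"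
      using 1 2 by (intro mult_mono mult_left_mono add_mono ennreal_leI) auto
    also have "\<dots> = ennreal (g d) * \<alpha> d * (ennreal ?c * (?K + ?K))" by (simp add: distrib_left mult_ac)
    finally show "\<alpha> d * ennreal (?c * min 1 (real_of_int (vmax d) / real N)) * (?K + (\<Sum>m\<in>?B. ennreal (g (m + d)))) \<le> \<dots>" .
  qed
  also have "\<dots> = (\<integral>\<^sup>+d. ennreal (g d) * \<alpha> d \<partial>count_space UNIV) * (ennreal ?c * (?K + ?K))"
    by (rule nn_integral_multc) simp
  also have "\<dots> < \<infinity>" using \<alpha> K by (simp add: ennreal_mult_less_top)
  finally show ?thesis .
qed

text \<open>The total mass is at most a constant independent of the scale times the sum of \<alpha>
  d * min(1, |d|/N), which tends to 0 by dominated convergence.\<close>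

lemma comm_kernel_small:
  fixes \<alpha> :: "int^'c::finite \<Rightarrow> ennreal"
  assumes \<alpha>: "(\<integral>\<^sup>+m. \<alpha> m \<partial>count_space UNIV) < \<infinity>" and e: "0 < e"
  obtains N where "0 < N" "(\<integral>\<^sup>+m. comm_kernel N \<alpha> m \<partial>count_space UNIV) < ennreal e"
proof -
  \<comment> \<open>Only even scales are used, because \<open>hat_const_bound\<close> compares with
    the box of half the radius. \<open>R\<close> is twice the constant found there, as
    \<open>overlap\<close> contains two boxes.\<close>
  let ?\<mu> = "\<lambda>M d. min 1 (real_of_int (vmax d) / real (2 * Suc M))"
  define R :: real where "R = 2 * (2 * 4 ^ CARD('c))"
  have R: "0 < R" by (simp add: R_def)
  have "(\<lambda>M. \<integral>\<^sup>+d. \<alpha> d * ennreal (?\<mu> M d) \<partial>count_space UNIV) \<longlonglongrightarrow> (\<integral>\<^sup>+d. (0::ennreal) \<partial>count_space (UNIV::(int^'c) set))"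
  proof (rule nn_integral_dominated_convergence[where w = \<alpha>])
    have "\<alpha> d < \<infinity>" for d using nn_integral_ge_point[of d UNIV \<alpha>] \<alpha> by (auto intro: le_less_trans)
    show "AE d in count_space UNIV. (\<lambda>M. \<alpha> d * ennreal (?\<mu> M d)) \<longlonglongrightarrow> 0"
    proof (rule AE_I2)
      fix d :: "int^'c"
      have "(\<lambda>M. real_of_int (vmax d) / 2 * inverse (real (Suc M))) \<longlonglongrightarrow> real_of_int (vmax d) / 2 * 0"
        by (intro tendsto_mult tendsto_const LIMSEQ_inverse_real_of_nat)
      then have "(\<lambda>M. real_of_int (vmax d) / real (2 * Suc M)) \<longlonglongrightarrow> 0"
        by (simp add: field_simps)
      then have "(\<lambda>M. ?\<mu> M d) \<longlonglongrightarrow> min 1 0" by (intro tendsto_min tendsto_const)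
      then have "(\<lambda>M. ennreal (?\<mu> M d)) \<longlonglongrightarrow> ennreal 0" by (intro tendsto_ennrealI) simp
      then have "(\<lambda>M. \<alpha> d * ennreal (?\<mu> M d)) \<longlonglongrightarrow> \<alpha> d * ennreal 0"
        using \<open>\<alpha> d < \<infinity>\<close> by (intro ennreal_tendsto_cmult) auto
      then show "(\<lambda>M. \<alpha> d * ennreal (?\<mu> M d)) \<longlonglongrightarrow> 0" by simp
    qed
    show "AE d in count_space UNIV. \<alpha> d * ennreal (?\<mu> M d) \<le> \<alpha> d" for M
    proof (rule AE_I2)
      fix d :: "int^'c"
      have "ennreal (?\<mu> M d) \<le> ennreal 1" by (intro ennreal_leI) simp
      then show "\<alpha> d * ennreal (?\<mu> M d) \<le> \<alpha> d" using mult_left_mono[of "ennreal (?\<mu> M d)" 1 "\<alpha> d"] by simp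
    qed
  qed (use \<alpha> in auto)
  then have "eventually (\<lambda>M. (\<integral>\<^sup>+d. \<alpha> d * ennreal (?\<mu> M d) \<partial>count_space UNIV) < ennreal (e / R)) sequentially"
    using e R by (intro order_tendstoD) auto
  then obtain M where M: "(\<integral>\<^sup>+d. \<alpha> d * ennreal (?\<mu> M d) \<partial>count_space UNIV) < ennreal (e / R)"
    by (auto simp: eventually_sequentially)
  let ?N = "2 * Suc M"
  let ?c = "hat_const TYPE('c) ?N"
  let ?B = "int_box (2 * ?N) :: (int^'c) set"
  have c: "0 < ?c" by (rule hat_const_pos)
  have cR: "?c * (2 * real (card ?B)) \<le> R" using hat_const_bound[where 'c='c, of "Suc M"] by (simp add: R_def)
  have "(\<integral>\<^sup>+m. comm_kernel ?N \<alpha> m \<partial>count_space UNIV)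
      = (\<integral>\<^sup>+d. \<alpha> d * ennreal (?c * ?\<mu> M d) * ((\<Sum>m\<in>?B. 1) + (\<Sum>m\<in>?B. 1)) \<partial>count_space UNIV)"
    using nn_integral_weighted_comm_kernel[of "\<lambda>_. 1" ?N \<alpha>] by simp
  also have "\<dots> \<le> (\<integral>\<^sup>+d. ennreal R * (\<alpha> d * ennreal (?\<mu> M d)) \<partial>count_space UNIV)"
  proof (rule nn_integral_mono)
    fix d :: "int^'c"
    have \<mu>: "0 \<le> ?\<mu> M d" using vmax_nonneg[of d] by simp
    have "((\<Sum>m\<in>?B. 1) + (\<Sum>m\<in>?B. 1)) = ennreal (2 * real (card ?B))"
    proof -
      have "(\<Sum>m\<in>?B. 1) = ennreal (real (card ?B))" by (simp only: sum_constant mult_1_right ennreal_of_nat_eq_real_of_nat)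
      then show ?thesis using ennreal_plus[of "real (card ?B)" "real (card ?B)"] by (simp only: mult_2 of_nat_0_le_iff)
    qed
    then have "ennreal (?c * ?\<mu> M d) * ((\<Sum>m\<in>?B. 1) + (\<Sum>m\<in>?B. 1)) = ennreal ((?c * ?\<mu> M d) * (2 * real (card ?B)))"
      using ennreal_mult[of "?c * ?\<mu> M d" "2 * real (card ?B)"] mult_nonneg_nonneg[OF less_imp_le[OF c] \<mu>] by simp
    also have "\<dots> \<le> ennreal (R * ?\<mu> M d)"
      using mult_right_mono[OF cR \<mu>] by (intro ennreal_leI) (simp only: mult_ac)
    also have "\<dots> = ennreal R * ennreal (?\<mu> M d)" using R \<mu> by (intro ennreal_mult) auto
    finally have "\<alpha> d * (ennreal (?c * ?\<mu> M d) * ((\<Sum>m\<in>?B. 1) + (\<Sum>m\<in>?B. 1))) \<le> \<alpha> d * (ennreal R * ennreal (?\<mu> M d))"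
      by (intro mult_left_mono) auto
    then show "\<alpha> d * ennreal (?c * ?\<mu> M d) * ((\<Sum>m\<in>?B. 1) + (\<Sum>m\<in>?B. 1)) \<le> ennreal R * (\<alpha> d * ennreal (?\<mu> M d))"
      by (simp only: mult_ac)
  qed
  also have "\<dots> = ennreal R * (\<integral>\<^sup>+d. \<alpha> d * ennreal (?\<mu> M d) \<partial>count_space UNIV)"
    by (rule nn_integral_cmult) simp
  also have "\<dots> < ennreal R * ennreal (e / R)" using M R by (intro ennreal_mult_strict_left_mono) auto
  also have "\<dots> = ennreal e" using R e by (simp add: ennreal_mult[symmetric])
  finally show ?thesis by (intro that[of ?N]) auto
qed

text \<open>A crude triangle inequality over the cells that meet the cutoff. Its loss depends on
  \<open>N\<close> alone, and \<open>N\<close> is fixed before it is used. It carries the solved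
  inequality from cutoff norms back to cell norms.\<close>

lemma cutoff_norm_le:
  assumes p: "1 \<le> p" and y: "y \<in> Lp_set lborel p"
  shows "ennreal (lpnorm lborel p (cutoff N l y)) \<le> conv (\<lambda>m. ennreal (hat N (- m))) (\<lambda>s. ennreal (cell_norm p y s)) l"
proof -
  let ?v = "\<lambda>s. embed_cell s (piece s y)"
  have "ennreal (lpnorm lborel p (cutoff N l y)) \<le> (\<integral>\<^sup>+s. ennreal (hat N (s - l)) * ennreal (lpnorm lborel p (?v s)) \<partial>count_space UNIV)"
  proof (rule Minkowski_cells[OF p cutoff_Lp[OF p y] embed_Lp(1)[OF p piece_Lp(1)[OF p y]], where d = "\<lambda>_. 0"])
    fix i
    have eq: "cell_norm p (?v s) i = (if i = s then cell_norm p y s else 0)" for s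
      unfolding cell_norm_embed(2)[OF p piece_Lp(1)[OF p y]] by (simp add: cell_norm_def)
    have "(\<integral>\<^sup>+s. ennreal (hat N (s - l)) * ennreal (cell_norm p (?v s) (i - 0)) \<partial>count_space UNIV)
       = (\<integral>\<^sup>+s. (ennreal (hat N (i - l)) * ennreal (cell_norm p y i)) * indicator {i} s \<partial>count_space UNIV)"
      by (intro nn_integral_cong) (auto simp: eq)
    then show "ennreal (cell_norm p (cutoff N l y) i) \<le> (\<integral>\<^sup>+s. ennreal (hat N (s - l)) * ennreal (cell_norm p (?v s) (i - 0)) \<partial>count_space UNIV)"
      by (simp add: nn_integral_cmult cell_norm_cutoff[OF p y] ennreal_mult hat_nonneg cell_norm_nonneg)
  qed
  also have "\<dots> \<le> (\<integral>\<^sup>+s. ennreal (hat N (s - l)) * ennreal (cell_norm p y s) \<partial>count_space UNIV)"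
    unfolding cell_norm_def by (intro nn_integral_mono mult_left_mono ennreal_leI embed_Lp(2) piece_Lp(1) p y) auto
  also have "\<dots> = conv (\<lambda>m. ennreal (hat N (- m))) (\<lambda>s. ennreal (cell_norm p y s)) l"
    by (simp add: conv_def)
  finally show ?thesis .
qed

lemma conv_cmult_left: "conv (\<lambda>m. c * f m) h k = c * conv f h k"
  by (simp add: conv_def nn_integral_cmult[symmetric] mult_ac)

text \<open>The matrix form of Wiener's lemma.\<close>
lemma lower_bound_localises:
  fixes g :: "int^'c::finite \<Rightarrow> real" and \<alpha> :: "int^'c \<Rightarrow> ennreal" and lam :: complex
  assumes p: "1 \<le> p" and g: "weight g" and A: "bounded_op lborel p A" and dom: "dominated_op p A \<alpha>"
    and \<alpha>: "(\<integral>\<^sup>+m. ennreal (g m) * \<alpha> m \<partial>count_space UNIV) < \<infinity>"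
    and C: "0 \<le> C" "\<And>x. x \<in> Lp_set lborel p \<Longrightarrow> lpnorm lborel p x \<le> C * lpnorm lborel p (\<lambda>t. lam * x t + A x t)"
  obtains \<Gamma> where "(\<integral>\<^sup>+m. ennreal (g m) * \<Gamma> m \<partial>count_space UNIV) < \<infinity>"
    "\<And>x k. x \<in> Lp_set lborel p \<Longrightarrow>
      ennreal (cell_norm p x k) \<le> conv \<Gamma> (\<lambda>l. ennreal (cell_norm p (\<lambda>t. lam * x t + A x t) l)) k"
proof -
  have \<alpha>1: "(\<integral>\<^sup>+m. \<alpha> m \<partial>count_space UNIV) < \<infinity>" by (rule le_less_trans[OF weight_le_sum[OF g] \<alpha>])
  \<comment> \<open>The choice \<open>1 / (C + 1)\<close> makes \<open>C\<close> times the mass at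
    most \<open>C / (C + 1) < 1\<close>, also when \<open>C = 0\<close>.\<close>
  obtain N where N: "0 < N" and small: "(\<integral>\<^sup>+m. comm_kernel N \<alpha> m \<partial>count_space UNIV) < ennreal (1 / (C + 1))"
    by (rule comm_kernel_small[OF \<alpha>1, of "1 / (C + 1)"]) (use C in auto)
  define \<kappa> where "\<kappa> m = ennreal C * comm_kernel N \<alpha> m" for m
  have k1: "(\<integral>\<^sup>+m. \<kappa> m \<partial>count_space UNIV) < 1"
  proof -
    have "(\<integral>\<^sup>+m. \<kappa> m \<partial>count_space UNIV) = ennreal C * (\<integral>\<^sup>+m. comm_kernel N \<alpha> m \<partial>count_space UNIV)"
      unfolding \<kappa>_def by (rule nn_integral_cmult) simp
    also have "\<dots> \<le> ennreal C * ennreal (1 / (C + 1))" by (intro mult_left_mono less_imp_le[OF small]) simp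
    also have "\<dots> = ennreal (C * (1 / (C + 1)))" using C by (intro ennreal_mult[symmetric]) auto
    also have "\<dots> < 1" using C by (simp add: ennreal_less_one_iff)
    finally show ?thesis .
  qed
  have gk: "(\<integral>\<^sup>+m. ennreal (g m) * \<kappa> m \<partial>count_space UNIV) < \<infinity>"
  proof -
    have "(\<integral>\<^sup>+m. ennreal (g m) * \<kappa> m \<partial>count_space UNIV) = ennreal C * (\<integral>\<^sup>+m. ennreal (g m) * comm_kernel N \<alpha> m \<partial>count_space UNIV)"
      unfolding \<kappa>_def by (subst nn_integral_cmult[symmetric]) (simp_all add: mult_ac)
    then show ?thesis using comm_kernel_weighted_finite[OF g \<alpha>, of N] by (simp add: ennreal_mult_less_top)
  qed
  obtain \<Gamma> where \<Gamma>: "(\<integral>\<^sup>+m. ennreal (g m) * \<Gamma> m \<partial>count_space UNIV) < \<infinity>"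
    and Neu: "\<And>U V K k. K < \<infinity> \<Longrightarrow> \<forall>k. U k \<le> K \<Longrightarrow> \<forall>k. U k \<le> V k + conv \<kappa> U k \<Longrightarrow> U k \<le> conv \<Gamma> V k"
    by (rule weighted_Neumann[OF g gk k1]) (rule that)
  \<comment> \<open>Converts the cutoff norms of \<open>lam * x + A x\<close> into its cell norms.
    Having finite support, it does not spoil the weighted summability of \<Gamma>.\<close>
  define h where "h m = ennreal C * ennreal (hat N (- m))" for m :: "int^'c"
  have hfin: "(\<integral>\<^sup>+m. ennreal (g m) * h m \<partial>count_space UNIV) < \<infinity>"
  proof -
    have "hat N (- m) = 0" if "m \<notin> int_box N" for m :: "int^'c"
      using hat_support[OF _ N, of "- m"] that by (auto simp: int_box_def vmax_minus)
    then have "(\<integral>\<^sup>+m. ennreal (g m) * h m \<partial>count_space UNIV) = (\<Sum>m\<in>int_box N. ennreal (g m) * h m)"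
      by (intro nn_integral_count_space') (auto simp: h_def)
    then show ?thesis by (simp add: h_def ennreal_mult_less_top)
  qed
  show ?thesis
  proof (rule that[of "conv \<Gamma> h"])
    show "(\<integral>\<^sup>+m. ennreal (g m) * conv \<Gamma> h m \<partial>count_space UNIV) < \<infinity>"
      using weight_conv[of "\<lambda>m. ennreal (g m)" "\<lambda>m. ennreal (g m)" \<Gamma> h, OF weight_submult[OF g]] \<Gamma> hfin
      by (auto simp: ennreal_mult_less_top intro: le_less_trans)
    fix x :: "(real, 'c) vec \<Rightarrow> complex" and k :: "int^'c" assume x: "x \<in> Lp_set lborel p"
    let ?T = "\<lambda>x t. lam * x t + A x t"
    let ?U = "\<lambda>k. ennreal (lpnorm lborel p (cutoff N k x))"
    let ?y = "?T x"
    let ?V = "\<lambda>l. ennreal C * ennreal (lpnorm lborel p (cutoff N l ?y))"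
    have yL: "?y \<in> Lp_set lborel p" by (intro lpnorm_add(1) lpnorm_cmult(1) p x bounded_op_Lp[OF A])
    \<comment> \<open>This a priori bound, uniform in \<open>k\<close>, is what the Neumann
      iteration needs to discard its remainder.\<close>
    have bdd: "?U k \<le> ennreal (lpnorm lborel p x)" for k
    proof (rule ennreal_leI, rule lpnorm_mono(2)[OF p x])
      show "cutoff N k x \<in> borel_measurable lborel" by (rule Lp_measurable[OF cutoff_Lp[OF p x]])
      show "AE t in lborel. cmod (cutoff N k x t) \<le> cmod (x t)"
        by (simp add: cutoff_def cell_mult_def norm_mult hat_nonneg hat_le_1 mult_left_le_one_le)
    qed
    have step: "?U k \<le> ?V k + conv \<kappa> ?U k" for k
    proof -
      let ?w = "\<lambda>t. A (cutoff N k x) t - cutoff N k (A x) t"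
      have wL: "?w \<in> Lp_set lborel p" by (intro lpnorm_diff(1) p bounded_op_Lp[OF A] cutoff_Lp x)
      have "lpnorm lborel p (cutoff N k x) \<le> C * lpnorm lborel p (?T (cutoff N k x))"
        by (rule C(2)[OF cutoff_Lp[OF p x]])
      \<comment> \<open>The scalar part commutes with cutoffs, so the error is the commutator with
        \<open>A\<close> alone.\<close>
      also have "?T (cutoff N k x) = (\<lambda>t. cutoff N k ?y t + ?w t)"
        by (simp add: cutoff_def cell_mult_def fun_eq_iff algebra_simps)
      also have "C * lpnorm lborel p (\<lambda>t. cutoff N k ?y t + ?w t) \<le> C * (lpnorm lborel p (cutoff N k ?y) + lpnorm lborel p ?w)"
        by (intro mult_left_mono C lpnorm_add(2) p cutoff_Lp yL wL)
      finally have "?U k \<le> ennreal (C * lpnorm lborel p (cutoff N k ?y) + C * lpnorm lborel p ?w)"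
        by (intro ennreal_leI) (simp add: distrib_left)
      also have "\<dots> = ?V k + ennreal C * ennreal (lpnorm lborel p ?w)"
        by (intro ennreal_linear_comb C(1) lpnorm_nonneg)
      also have "\<dots> \<le> ?V k + ennreal C * conv (comm_kernel N \<alpha>) ?U k"
        by (intro add_left_mono mult_left_mono commutator_cutoff p A dom N x) auto
      also have "ennreal C * conv (comm_kernel N \<alpha>) ?U k = conv \<kappa> ?U k"
        unfolding \<kappa>_def by (rule conv_cmult_left[symmetric])
      finally show ?thesis .
    qed
    have "ennreal (cell_norm p x k) = ennreal (cell_norm p (cutoff N k x) k)"
      by (simp add: cell_norm_cutoff[OF p x] hat_0)
    also have "\<dots> \<le> ?U k" by (intro ennreal_leI piece_Lp(2) p cutoff_Lp x)
    also have "\<dots> \<le> conv \<Gamma> ?V k" by (rule Neu[of "ennreal (lpnorm lborel p x)"]) (use bdd step in auto)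
    also have "\<dots> \<le> conv \<Gamma> (conv h (\<lambda>l. ennreal (cell_norm p ?y l))) k"
      unfolding h_def conv_cmult_left by (intro conv_mono mult_left_mono cutoff_norm_le p yL) simp
    also have "\<dots> = conv (conv \<Gamma> h) (\<lambda>l. ennreal (cell_norm p ?y l)) k" by (rule conv_assoc)
    finally show "ennreal (cell_norm p x k) \<le> conv (conv \<Gamma> h) (\<lambda>l. ennreal (cell_norm p ?y l)) k" .
  qed
qed

section \<open>Scalar multiples, and the form of the inverse\<close>

lemma bounded_op_scale:
  assumes p: "1 \<le> p" and B: "bounded_op M p B"
  shows "bounded_op M p (\<lambda>x t. c * B x t)"
proof -
  obtain K where K: "\<And>f. f \<in> Lp_set M p \<Longrightarrow> lpnorm M p (B f) \<le> K * lpnorm M p f"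
    using bounded_op_bound[OF B] by metis
  show ?thesis unfolding bounded_op_def
  proof (intro conjI ballI impI allI)
    show "f \<in> Lp_set M p \<Longrightarrow> (\<lambda>t. c * B f t) \<in> Lp_set M p" for f
      by (intro lpnorm_cmult(1) p bounded_op_Lp[OF B])
    show "AE x in M. c * B f x = c * B h x"
      if "f \<in> Lp_set M p" "h \<in> Lp_set M p" "AE x in M. f x = h x" for f h
      using bounded_op_cong[OF B that] by eventually_elim simp
    show "AE x in M. c * B (\<lambda>y. f y + h y) x = c * B f x + c * B h x"
      if "f \<in> Lp_set M p" "h \<in> Lp_set M p" for f h
      using bounded_op_add[OF B that] by eventually_elim (simp add: distrib_left)
    show "AE x in M. c * B (\<lambda>y. d * f y) x = d * (c * B f x)" if "f \<in> Lp_set M p" for f d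
      using bounded_op_cmult[OF B that, of d] by eventually_elim simp
    have "lpnorm M p (\<lambda>t. c * B f t) \<le> (cmod c * K) * lpnorm M p f" if f: "f \<in> Lp_set M p" for f
      using mult_left_mono[OF K[OF f], of "cmod c"] by (simp add: lpnorm_cmult(2)[OF p bounded_op_Lp[OF B f]] mult.assoc)
    then show "\<exists>K. \<forall>f\<in>Lp_set M p. lpnorm M p (\<lambda>t. c * B f t) \<le> K * lpnorm M p f" by blast
  qed
qed

lemma dominated_op_scale:
  assumes p: "1 \<le> p" and B: "bounded_op lborel p B" and dom: "dominated_op p B \<Gamma>"
  shows "dominated_op p (\<lambda>x t. c * B x t) (\<lambda>m. ennreal (cmod c) * \<Gamma> m)"
  unfolding dominated_op_def
proof safe
  fix x :: "(real, 'a) vec \<Rightarrow> complex" and k :: "int^'a" assume x: "x \<in> Lp_set lborel p"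
  have "ennreal (cell_norm p (\<lambda>t. c * B x t) k) = ennreal (cmod c) * ennreal (cell_norm p (B x) k)"
    by (simp add: cell_norm_cmult[OF p bounded_op_Lp[OF B x]] ennreal_mult cell_norm_nonneg)
  also have "\<dots> \<le> ennreal (cmod c) * conv \<Gamma> (\<lambda>l. ennreal (cell_norm p x l)) k"
    using dom x unfolding dominated_op_def conv_def by (intro mult_left_mono) auto
  also have "\<dots> = conv (\<lambda>m. ennreal (cmod c) * \<Gamma> m) (\<lambda>l. ennreal (cell_norm p x l)) k"
    by (rule conv_cmult_left[symmetric])
  finally show "ennreal (cell_norm p (\<lambda>t. c * B x t) k)
      \<le> (\<integral>\<^sup>+l. ennreal (cmod c) * \<Gamma> (k - l) * ennreal (cell_norm p x l) \<partial>count_space UNIV)"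
    by (simp add: conv_def)
qed

theorem mainTheorem2:
  fixes p :: ennreal and g :: "int^'c::finite \<Rightarrow> real"
    and A :: "(real^'c \<Rightarrow> complex) \<Rightarrow> (real^'c \<Rightarrow> complex)"
    and B :: "(real^'c \<Rightarrow> complex) \<Rightarrow> (real^'c \<Rightarrow> complex)"
    and lam :: complex
  assumes "1 \<le> p"
    and "weight g"
    and "locally_nuclear p g A"
    and "inverse_op lborel p (\<lambda>x t. lam * x t + A x t) B"
  shows "\<exists>(\<mu>::complex) A'. locally_nuclear p g A' \<and>
           (\<forall>x\<in>Lp_set lborel p. AE t in lborel. B x t = \<mu> * x t + A' x t)"
proof -
  note p = assms(1) and g = assms(2) and lnA = assms(3)
  let ?T = "\<lambda>x t. lam * x t + A x t"
  have A: "bounded_op lborel p A" using lnA unfolding locally_nuclear_def by (rule conjunct1)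
  have B: "bounded_op lborel p B"
    and BT: "\<And>x. x \<in> Lp_set lborel p \<Longrightarrow> AE t in lborel. B (?T x) t = x t"
    and TB: "\<And>x. x \<in> Lp_set lborel p \<Longrightarrow> AE t in lborel. ?T (B x) t = x t"
    using assms(4) unfolding inverse_op_def by simp_all
  obtain b a y \<alpha> where \<alpha>: "(\<integral>\<^sup>+m. ennreal (g m) * \<alpha> m \<partial>count_space UNIV) < \<infinity>"
    and b: "\<And>k m. bounded_op cube_measure p (b k m)"
    and rep: "\<And>k m. nuclear_rep cube_measure p (b k m) (a k m) (y k m)"
    and ay: "\<And>k m. (\<integral>\<^sup>+i. ennreal (fun_norm cube_measure p (a k m i) * lpnorm cube_measure p (y k m i)) \<partial>count_space UNIV) \<le> \<alpha> m"
    and sm: "\<And>x k. x \<in> Lp_set lborel p \<Longrightarrow> lp_has_sum cube_measure p (\<lambda>m. b k m (piece (k - m) x)) (piece k (A x))"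
    by (rule locally_nuclear_reps[OF g lnA]) (rule that)
  have domA: "dominated_op p A \<alpha>" by (rule locally_nuclear_dominated[OF p A b rep ay sm])
  have TL: "?T x \<in> Lp_set lborel p" if "x \<in> Lp_set lborel p" for x
    by (intro lpnorm_add(1) lpnorm_cmult(1) p that bounded_op_Lp[OF A])
  obtain C where C: "0 \<le> C" "\<And>f. f \<in> Lp_set lborel p \<Longrightarrow> lpnorm lborel p (B f) \<le> C * lpnorm lborel p f"
    using bounded_op_bound[OF B] by metis
  \<comment> \<open>Being a left inverse, \<open>B\<close> provides the global lower bound; that it
    is also a right inverse is used when the localised bound is transferred to
    \<open>B\<close>.\<close>
  have low: "lpnorm lborel p x \<le> C * lpnorm lborel p (?T x)" if x: "x \<in> Lp_set lborel p" for x
    using C(2)[OF TL[OF x]] lpnorm_cong(2)[OF p x BT[OF x] Lp_measurable[OF bounded_op_Lp[OF B TL[OF x]]]] by simp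
  obtain \<Gamma> where \<Gamma>: "(\<integral>\<^sup>+m. ennreal (g m) * \<Gamma> m \<partial>count_space UNIV) < \<infinity>"
    and loc: "\<And>x k. x \<in> Lp_set lborel p \<Longrightarrow>
      ennreal (cell_norm p x k) \<le> conv \<Gamma> (\<lambda>l. ennreal (cell_norm p (?T x) l)) k"
    by (rule lower_bound_localises[where lam = lam, OF p g A domA \<alpha> C(1)]) (rule low, assumption, rule that)
  \<comment> \<open>Every \<open>f\<close> equals \<open>?T (B f)\<close> almost everywhere, so the
    localised lower bound at \<open>B f\<close> is precisely domination of \<open>B\<close>.\<close>
  have domB: "dominated_op p B \<Gamma>"
    unfolding dominated_op_def
  proof safe
    fix f :: "(real, 'c) vec \<Rightarrow> complex" and k :: "int^'c" assume f: "f \<in> Lp_set lborel p"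
    note BL = bounded_op_Lp[OF B f]
    have "cell_norm p (?T (B f)) l = cell_norm p f l" for l
      by (rule cell_norm_AE_cong[OF p f Lp_measurable[OF TL[OF BL]] TB[OF f]])
    then show "ennreal (cell_norm p (B f) k) \<le> (\<integral>\<^sup>+l. \<Gamma> (k - l) * ennreal (cell_norm p f l) \<partial>count_space UNIV)"
      using loc[OF BL, of k] by (simp add: conv_def)
  qed
  show ?thesis
  proof (cases "lam = 0")
    case True
    \<comment> \<open>This case is vacuous, the identity of an infinite-dimensional space not being nuclear, but the
      ideal property settles it without that fact.\<close>
    have "locally_nuclear p g (\<lambda>x. B (B (A x)))"
      by (intro locally_nuclear_left_ideal[OF p g _ B domB \<Gamma>] lnA)
    moreover have "AE t in lborel. B x t = 0 * x t + B (B (A x)) t" if x: "x \<in> Lp_set lborel p" for x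
    proof -
      have "AE t in lborel. B (A x) t = x t" using BT[OF x] True by simp
      from bounded_op_cong[OF B bounded_op_Lp[OF B bounded_op_Lp[OF A x]] x this]
      show ?thesis by eventually_elim simp
    qed
    ultimately show ?thesis by blast
  next
    case False
    \<comment> \<open>Applying \<open>B\<close> to \<open>?T x\<close> gives
      \<open>x = lam * B x + B (A x)\<close>, that is, \<open>B = 1 / lam + D A\<close>. The scalar
      is put into the left factor, so that the left ideal property applies as it stands.\<close>
    define D where "D = (\<lambda>x t. - (1 / lam) * B x t)"
    have D: "bounded_op lborel p D" unfolding D_def by (rule bounded_op_scale[OF p B])
    have domD: "dominated_op p D (\<lambda>m. ennreal (cmod (- (1 / lam))) * \<Gamma> m)"
      unfolding D_def by (rule dominated_op_scale[OF p B domB])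
    have "(\<integral>\<^sup>+m. ennreal (g m) * (ennreal (cmod (- (1 / lam))) * \<Gamma> m) \<partial>count_space UNIV)
       = ennreal (cmod (- (1 / lam))) * (\<integral>\<^sup>+m. ennreal (g m) * \<Gamma> m \<partial>count_space UNIV)"
      by (subst nn_integral_cmult[symmetric]) (simp_all only: mult_ac measurable_count_space_eq1, simp)
    then have "(\<integral>\<^sup>+m. ennreal (g m) * (ennreal (cmod (- (1 / lam))) * \<Gamma> m) \<partial>count_space UNIV) < \<infinity>"
      using \<Gamma> by (simp add: ennreal_mult_less_top)
    from locally_nuclear_left_ideal[OF p g lnA D domD this]
    have "locally_nuclear p g (\<lambda>x. D (A x))" .
    moreover have "AE t in lborel. B x t = 1 / lam * x t + D (A x) t" if x: "x \<in> Lp_set lborel p" for x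
    proof -
      have "AE t in lborel. B (?T x) t = B (\<lambda>t. lam * x t) t + B (A x) t"
        by (rule bounded_op_add[OF B lpnorm_cmult(1)[OF p x] bounded_op_Lp[OF A x]])
      with BT[OF x] bounded_op_cmult[OF B x, of lam] show ?thesis
      proof eventually_elim
        case (elim t)
        then have "x t = lam * B x t + B (A x) t" by simp
        then show ?case using False by (simp add: D_def field_simps)
      qed
    qed
    ultimately show ?thesis by blast
  qed
qed

end
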